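(* For every $\gamma>0$, the Bessel potential operator $\mathcal{J}_\gamma f(x)=\int_{\mathbb{R}^d}G_\gamma(x-y)f(y)\,dy$ satisfies $$s_{p,w}(\mathcal{J}_\gamma)=[0,1]$$ for all $1\le p<\infty$ and all $A_p$-weights $w$.
   Context: The Bessel kernel $G_\gamma$ on $\mathbb{R}^d$ is the integrable function with Fourier transform $\widehat{G_\gamma}(\xi)=(1+|\xi_1|^2+\cdots+|\xi_d|^2)^{-\gamma/2}$, where $\hat f(\xi)=\int_{\mathbb{R}^d}f(x)e^{-ix\xi}dx$. A weight is a positive locally integrable function on $\mathbb{R}^d$. For $1<p<\infty$, $w$ is an $A_p$-weight if there is $A<\infty$ with $\big(\frac1{|Q|}\int_Qw\big)\big(\frac1{|Q|}\int_Qw^{-1/(p-1)}\big)^{p-1}\le A$ for all cubes $Q$; $w$ is an $A_1$-weight if there is $A<\infty$ with $\frac1{|Q|}\int_Qw\le A\inf_{x\in Q}w(x)$ for all cubes $Q$. $L^p_w$ is the space of measurable $f$ on $\mathbb{R}^d$ with $\|f\|_{p,w}=(\int|f|^pw\,dx)^{1/p}<\infty$; $\mathcal{J}_\gamma$ is bounded on $L^p_w$ for all such $p,w$. For a bounded operator $T$ on $L^p_w$, $s_{p,w}(T)$ is the set of all $z\in\mathbb{C}$ such that $zI-T$ does not have stability on $L^p_w$, where stability means that there is $C>0$ with $\|(zI-T)f\|_{p,w}\ge C\|f\|_{p,w}$ for all $f\in L^p_w$ ($I$ the identity operator). *)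

theory Defs
  imports "HOL-Analysis.Analysis"
begin

definition is_bessel_kernel :: "real \<Rightarrow> ('a::euclidean_space \<Rightarrow> complex) \<Rightarrow> bool" where
  "is_bessel_kernel \<gamma> G \<longleftrightarrow>
     integrable lebesgue G \<and>
     (\<forall>\<xi>. (LINT x|lebesgue. G x * exp (- (\<i> * complex_of_real (x \<bullet> \<xi>)))) =
          complex_of_real ((1 + (\<Sum>i\<in>Basis. \<bar>\<xi> \<bullet> i\<bar>\<^sup>2)) powr (- \<gamma> / 2)))"

(* An integrable function is determined up to a null set by its Fourier transform, so
   different choices give the same convolution operator. *)
definition bessel_kernel :: "real \<Rightarrow> 'a::euclidean_space \<Rightarrow> complex" where
  "bessel_kernel \<gamma> = (SOME G. is_bessel_kernel \<gamma> G)"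

definition bessel_potential ::
  "real \<Rightarrow> ('a::euclidean_space \<Rightarrow> complex) \<Rightarrow> 'a \<Rightarrow> complex" where
  "bessel_potential \<gamma> f = (\<lambda>x. LINT y|lebesgue. bessel_kernel \<gamma> (x - y) * f y)"

(* Weights matter only up to null sets; positivity is required almost everywhere, so that
   power weights, which may vanish at the origin, are covered. *)
definition weight :: "('a::euclidean_space \<Rightarrow> real) \<Rightarrow> bool" where
  "weight w \<longleftrightarrow>
     (AE x in lebesgue. 0 < w x) \<and>
     w \<in> borel_measurable lebesgue \<and>
     (\<forall>K. compact K \<longrightarrow> set_integrable lebesgue K w)"

definition cubes :: "'a::euclidean_space set set" where
  "cubes = {cbox a (a + r *\<^sub>R One) | a r. 0 < r}"

definition average :: "'a::euclidean_space set \<Rightarrow> ('a \<Rightarrow> real) \<Rightarrow> real" where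
  "average Q g = (LINT x:Q|lebesgue. g x) / measure lebesgue Q"

(* Case p = 1: the infimum over Q is the essential infimum, written out.  The pointwise
   infimum of a real-valued representative would exclude unbounded weights such as
   norm x powr (-a), whose value at the origin is conventionally infinite.
   Case p > 1: integrability of the dual weight has to be explicit, because the Bochner
   integral of a non-integrable function is 0. *)
definition Ap_weight :: "real \<Rightarrow> ('a::euclidean_space \<Rightarrow> real) \<Rightarrow> bool" where
  "Ap_weight p w \<longleftrightarrow>
     weight w \<and>
     (if p = 1 then
        \<exists>A. \<forall>Q\<in>cubes. AE x in lebesgue. x \<in> Q \<longrightarrow> average Q w \<le> A * w x
      else
        \<exists>A. \<forall>Q\<in>cubes.
          set_integrable lebesgue Q (\<lambda>x. w x powr (- 1 / (p - 1))) \<and>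
          average Q w * average Q (\<lambda>x. w x powr (- 1 / (p - 1))) powr (p - 1) \<le> A)"

definition Lpw :: "real \<Rightarrow> ('a::euclidean_space \<Rightarrow> real) \<Rightarrow> ('a \<Rightarrow> complex) set" where
  "Lpw p w = {f \<in> borel_measurable lebesgue.
                integrable lebesgue (\<lambda>x. norm (f x) powr p * w x)}"

definition Lpw_norm :: "real \<Rightarrow> ('a::euclidean_space \<Rightarrow> real) \<Rightarrow> ('a \<Rightarrow> complex) \<Rightarrow> real" where
  "Lpw_norm p w f = (LINT x|lebesgue. norm (f x) powr p * w x) powr (1 / p)"

definition stable_on_Lpw ::
  "real \<Rightarrow> ('a::euclidean_space \<Rightarrow> real) \<Rightarrow> (('a \<Rightarrow> complex) \<Rightarrow> 'a \<Rightarrow> complex) \<Rightarrow> bool" where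
  "stable_on_Lpw p w S \<longleftrightarrow> (\<exists>C>0. \<forall>f\<in>Lpw p w. Lpw_norm p w (S f) \<ge> C * Lpw_norm p w f)"

(* Meant for operators T that map Lpw p w boundedly into itself. *)
definition stability_spectrum ::
  "real \<Rightarrow> ('a::euclidean_space \<Rightarrow> real) \<Rightarrow> (('a \<Rightarrow> complex) \<Rightarrow> 'a \<Rightarrow> complex) \<Rightarrow> complex set" where
  "stability_spectrum p w T = {z. \<not> stable_on_Lpw p w (\<lambda>f x. z * f x - T f x)}"

end

theory Submission
  imports Defs "HOL-Complex_Analysis.Complex_Analysis"
begin

text \<open>The \<open>A\<^sub>p\<close> condition says directly that averaging over cubes of a fixed size is bounded on
  \<open>L\<^sup>p\<^sub>w\<close>, uniformly in the size. Superposing cubes, all kernels with exponential majorants, all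
  heat kernels, and hence the Bessel kernel (a superposition of heat kernels), act boundedly;
  no maximal function is needed.

  For \<open>z\<close> in \<open>[0, 1]\<close>, the functions \<open>exp (i x \<bullet> \<xi> - \<delta> |x|)\<close> are approximate eigenfunctions as
  \<open>\<delta> \<rightarrow> 0\<close>, where \<open>\<xi>\<close> is chosen so that the symbol \<open>m = (1 + |\<xi>|\<^sup>2) powr (- \<gamma> / 2)\<close> is (close to) \<open>z\<close>.
  For \<open>z\<close> outside \<open>[0, 1]\<close> and \<open>h = z f - J f\<close>, iterating \<open>z f = h + J f\<close> bounds \<open>f\<close> by \<open>h\<close> and
  \<open>J\<^sup>N f\<close>, and \<open>J\<^sup>N f = R * h\<close>, where \<open>R\<close> has the Fourier transform \<open>m\<^sup>N / (z - m)\<close>. For large \<open>N\<close> this is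
  integrable and extends holomorphically to a strip, so that \<open>R\<close> decays exponentially.\<close>

section \<open>Jensen's inequality for extended nonnegative functions\<close>

definition epow :: "real \<Rightarrow> ennreal \<Rightarrow> ennreal" where
  "epow p u = (if u = \<infinity> then \<infinity> else ennreal (enn2real u powr p))"

lemma epow_ennreal [simp]: "0 \<le> a \<Longrightarrow> epow p (ennreal a) = ennreal (a powr p)"
  by (simp add: epow_def)

lemma epow_top [simp]: "epow p top = top"
  by (simp add: epow_def)

lemma epow_zero [simp]: "epow p 0 = 0"
  by (simp add: epow_def)

lemma epow_measurable [measurable]: "epow p \<in> borel_measurable borel"
  unfolding epow_def by measurable

lemma epow_mono: "0 \<le> p \<Longrightarrow> u \<le> v \<Longrightarrow> epow p u \<le> epow p v"
  unfolding epow_def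
  by (auto intro!: ennreal_leI powr_mono2 enn2real_mono simp: less_top top.not_eq_extremum top_unique)

lemma epow_eq_0_iff: "epow p u = 0 \<longleftrightarrow> u = 0"
  by (cases u) auto

lemma epow_cmult:
  assumes "0 \<le> c" shows "epow p (ennreal c * u) = ennreal (c powr p) * epow p u"
proof (cases u)
  case (real r)
  then show ?thesis using assms by (simp add: ennreal_mult[symmetric] powr_mult)
next
  case top
  then show ?thesis using assms by (cases "c = 0") (auto simp: ennreal_mult_top epow_def)
qed

lemma epow_add:
  assumes "0 \<le> p" shows "epow p (u + v) \<le> ennreal (2 powr p) * (epow p u + epow p v)"
proof -
  have *: "epow p (u + v) \<le> ennreal (2 powr p) * epow p m" if "u \<le> m" "v \<le> m" for m
  proof -
    have "u + v \<le> ennreal 2 * m" using that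
      by (metis add_mono ennreal_numeral mult_2 zero_le_numeral)
    then have "epow p (u + v) \<le> epow p (ennreal 2 * m)" using assms by (rule epow_mono[rotated])
    also have "\<dots> = ennreal (2 powr p) * epow p m" by (rule epow_cmult) simp
    finally show ?thesis .
  qed
  show ?thesis
  proof (cases "u \<le> v")
    case True
    then show ?thesis using *[of v] by (intro order_trans[OF *[of v]] mult_left_mono) auto
  next
    case False
    then show ?thesis by (intro order_trans[OF *[of u]] mult_left_mono) auto
  qed
qed

lemma le_tangent_powr:
  fixes u l p :: real
  assumes "0 \<le> u" "0 < l" "1 \<le> p"
  shows "u \<le> l powr (1 - p) / p * u powr p + l * (1 - 1 / p)"
proof -
  define t where "t = u / l"
  have t: "0 \<le> t" using assms by (simp add: t_def)
  have "(t powr p) powr (1/p) * 1 powr (1 - 1/p) \<le> (1/p) * t powr p + (1 - 1/p) * 1"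
    if "t \<noteq> 0" using assms t that by (intro Youngs_inequality_0) auto
  then have "t \<le> t powr p / p + (1 - 1/p)" using t assms
    by (cases "t = 0") (auto simp: powr_powr divide_simps)
  then have "l * t \<le> l * (t powr p / p + (1 - 1/p))" using assms by (intro mult_left_mono) auto
  also have "l * (t powr p / p + (1 - 1/p)) = l powr (1 - p) / p * u powr p + l * (1 - 1 / p)"
    using assms by (simp add: t_def powr_divide powr_diff field_simps)
  finally show ?thesis using assms by (simp add: t_def)
qed

lemma jensen_epow:
  assumes F [measurable]: "F \<in> borel_measurable N" and V: "emeasure N (space N) \<le> ennreal V" "0 < V"
    and p: "1 \<le> p"
  shows "epow p (\<integral>\<^sup>+s. F s \<partial>N) \<le> ennreal (V powr (p - 1)) * (\<integral>\<^sup>+s. epow p (F s) \<partial>N)"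
proof -
  define P where "P = (\<integral>\<^sup>+s. epow p (F s) \<partial>N)"
  show ?thesis
  proof (cases P)
    case top
    then show ?thesis using V by (simp add: P_def[symmetric] ennreal_mult_top)
  next
    case (real P')
    show ?thesis
    proof (cases "P' = 0")
      case True
      then have "AE s in N. epow p (F s) = 0"
        using real by (simp add: P_def nn_integral_0_iff_AE)
      then have "(\<integral>\<^sup>+s. F s \<partial>N) = 0" by (simp add: epow_eq_0_iff nn_integral_0_iff_AE)
      then show ?thesis by simp
    next
      case False
      with real have P': "0 < P'" by simp
      define l where "l = (P' / V) powr (1/p)"
      have l: "0 < l" using P' V by (simp add: l_def)
      have pt: "F s \<le> ennreal (l powr (1 - p) / p) * epow p (F s) + ennreal (l * (1 - 1 / p))" for s
      proof (cases "F s")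
        case (real r)
        then show ?thesis using le_tangent_powr[of r l p] l p
          by (simp add: ennreal_mult[symmetric] ennreal_plus[symmetric] del: ennreal_plus)
      next
        case top
        then show ?thesis using l p by (simp add: ennreal_mult_top)
      qed
      have "(\<integral>\<^sup>+s. F s \<partial>N) \<le> (\<integral>\<^sup>+s. ennreal (l powr (1 - p) / p) * epow p (F s) + ennreal (l * (1 - 1 / p)) \<partial>N)"
        by (intro nn_integral_mono pt)
      also have "\<dots> = ennreal (l powr (1 - p) / p) * P + ennreal (l * (1 - 1 / p)) * emeasure N (space N)"
        by (simp add: nn_integral_add nn_integral_cmult P_def)
      also have "\<dots> \<le> ennreal (l powr (1 - p) / p) * ennreal P' + ennreal (l * (1 - 1 / p)) * ennreal V"
        using V real by (intro add_mono mult_left_mono) auto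
      also have "\<dots> = ennreal (l powr (1 - p) / p * P' + l * (1 - 1 / p) * V)"
        using V P' l p by (simp add: ennreal_mult[symmetric] ennreal_plus[symmetric] del: ennreal_plus)
      also have "l powr (1 - p) / p * P' + l * (1 - 1 / p) * V = l * V"
      proof -
        have "l powr (1 - p) = l / (P' / V)"
          using P' V p by (simp add: l_def powr_diff powr_powr)
        then show ?thesis using P' V p by (simp add: field_simps)
      qed
      finally have "epow p (\<integral>\<^sup>+s. F s \<partial>N) \<le> epow p (ennreal (l * V))" using p by (intro epow_mono) auto
      also have "\<dots> = ennreal (V powr (p - 1) * P')"
        using P' V p l by (simp add: powr_mult l_def powr_powr powr_diff)
      also have "\<dots> = ennreal (V powr (p - 1)) * P" using real P' by (simp add: ennreal_mult)
      finally show ?thesis by (simp add: P_def)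
    qed
  qed
qed

section \<open>Convolution kernels bounded on weighted spaces\<close>

definition Ap_bound :: "real \<Rightarrow> ('a::euclidean_space \<Rightarrow> real) \<Rightarrow> real \<Rightarrow> bool" where
  "Ap_bound p w A \<longleftrightarrow> (\<forall>Q\<in>cubes. \<forall>f\<in>borel_measurable borel.
     epow p (\<integral>\<^sup>+x\<in>Q. f x \<partial>lborel) * (\<integral>\<^sup>+x\<in>Q. ennreal (w x) \<partial>lborel)
       \<le> ennreal (A * measure lborel Q powr p) * (\<integral>\<^sup>+x\<in>Q. epow p (f x) * ennreal (w x) \<partial>lborel))"

lemma set_nn_integral_lborel_eq:
  fixes u u' :: "'a::euclidean_space \<Rightarrow> real"
  assumes "set_integrable lebesgue Q u" "AE x in lebesgue. u x = u' x"
    and [measurable]: "u' \<in> borel_measurable borel" and Q [measurable]: "Q \<in> sets borel"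
    and nn: "\<And>x. 0 \<le> u' x"
  shows "(\<integral>\<^sup>+x\<in>Q. ennreal (u' x) \<partial>lborel) = ennreal (LINT x:Q|lebesgue. u x)"
proof -
  have ae: "AE x in lebesgue. indicator Q x *\<^sub>R u x = indicator Q x *\<^sub>R u' x"
    using assms(2) by eventually_elim simp
  have "integrable lebesgue (\<lambda>x. indicator Q x *\<^sub>R u x)" using assms(1) by (simp add: set_integrable_def)
  moreover have m: "(\<lambda>x. indicator Q x *\<^sub>R u' x) \<in> borel_measurable lebesgue"
    by (intro measurable_completion) simp
  ultimately have i: "integrable lebesgue (\<lambda>x. indicator Q x *\<^sub>R u' x)"
    and e: "(LINT x|lebesgue. indicator Q x *\<^sub>R u' x) = (LINT x|lebesgue. indicator Q x *\<^sub>R u x)"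
    using ae by (auto intro: integrable_cong_AE_imp integral_cong_AE)
  have "(\<integral>\<^sup>+x\<in>Q. ennreal (u' x) \<partial>lborel) = (\<integral>\<^sup>+x. ennreal (indicator Q x *\<^sub>R u' x) \<partial>lebesgue)"
    by (auto simp: nn_integral_completion indicator_def intro!: nn_integral_cong)
  also have "\<dots> = ennreal (LINT x|lebesgue. indicator Q x *\<^sub>R u' x)"
    using i nn by (intro nn_integral_eq_integral) auto
  finally show ?thesis using e by (simp add: set_lebesgue_integral_def)
qed

lemma measure_cube:
  assumes "0 < r"
  shows "measure lborel (cbox a (a + r *\<^sub>R One) :: 'a::euclidean_space set) = r ^ DIM('a)"
    and "emeasure lborel (cbox a (a + r *\<^sub>R One) :: 'a::euclidean_space set) = ennreal (r ^ DIM('a))"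
proof -
  have "\<forall>b\<in>Basis. a \<bullet> b \<le> (a + r *\<^sub>R One) \<bullet> b" for a :: 'a
    using assms by (auto simp: inner_simps)
  then show "measure lborel (cbox a (a + r *\<^sub>R One) :: 'a::euclidean_space set) = r ^ DIM('a)"
    "emeasure lborel (cbox a (a + r *\<^sub>R One) :: 'a::euclidean_space set) = ennreal (r ^ DIM('a))"
    using assms by (auto simp: emeasure_lborel_cbox_eq measure_lborel_cbox_eq inner_simps)
qed

lemma Ap_weight_imp_bound:
  fixes w w' :: "'a::euclidean_space \<Rightarrow> real"
  assumes Ap: "Ap_weight p w" and p: "1 \<le> p"
    and w' [measurable]: "w' \<in> borel_measurable borel" and pos: "\<And>x. 0 < w' x"
    and ae: "AE x in lebesgue. w x = w' x"
  shows "\<exists>A\<ge>0. Ap_bound p w' A"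
proof -
  have wi: "set_integrable lebesgue Q w" if "Q \<in> cubes" for Q
    using that Ap unfolding Ap_weight_def weight_def cubes_def by auto
  have Qm: "Q \<in> sets borel" if "Q \<in> cubes" for Q :: "'a set"
    using that unfolding cubes_def by auto
  have W: "(\<integral>\<^sup>+x\<in>Q. ennreal (w' x) \<partial>lborel) = ennreal (LINT x:Q|lebesgue. w x)" if "Q \<in> cubes" for Q
    using that by (intro set_nn_integral_lborel_eq wi ae Qm less_imp_le[OF pos] w')
  have W0: "0 \<le> (LINT x:Q|lebesgue. w x)" if "Q \<in> cubes" for Q
    unfolding set_lebesgue_integral_def
    using Ap by (intro integral_nonneg_AE) (auto simp: Ap_weight_def weight_def elim!: eventually_mono)
  have Q0: "0 < measure lborel Q" "emeasure lborel Q \<noteq> 0" if "Q \<in> cubes" for Q :: "'a set"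
    using that by (auto simp: cubes_def measure_cube)
  show ?thesis
  proof (cases "p = 1")
    case True
    then obtain A where A: "\<And>Q. Q \<in> cubes \<Longrightarrow> AE x in lebesgue. x \<in> Q \<longrightarrow> average Q w \<le> A * w x"
      using Ap unfolding Ap_weight_def by auto
    have "epow p (\<integral>\<^sup>+x\<in>Q. f x \<partial>lborel) * (\<integral>\<^sup>+x\<in>Q. ennreal (w' x) \<partial>lborel)
       \<le> ennreal (\<bar>A\<bar> * measure lborel Q powr p) * (\<integral>\<^sup>+x\<in>Q. epow p (f x) * ennreal (w' x) \<partial>lborel)"
      if Q: "Q \<in> cubes" and f [measurable]: "f \<in> borel_measurable borel" for Q f
    proof -
      note [measurable] = Qm[OF Q]
      have e1: "epow 1 u = u" for u by (cases u) auto
      have "AE x in lebesgue. x \<in> Q \<longrightarrow> (LINT x:Q|lebesgue. w x) \<le> \<bar>A\<bar> * measure lborel Q * w' x"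
        using A[OF Q] ae
      proof eventually_elim
        case (elim x)
        show ?case
        proof
          assume "x \<in> Q"
          then have "average Q w \<le> A * w' x" using elim by simp
          also have "\<dots> \<le> \<bar>A\<bar> * w' x" using pos[of x] by (intro mult_right_mono) auto
          finally show "(LINT x:Q|lebesgue. w x) \<le> \<bar>A\<bar> * measure lborel Q * w' x"
            using Q0[OF Q] by (simp add: average_def field_simps)
        qed
      qed
      then have ae': "AE x in lborel. x \<in> Q \<longrightarrow> (LINT x:Q|lebesgue. w x) \<le> \<bar>A\<bar> * measure lborel Q * w' x"
        by (simp add: AE_completion_iff)
      have "(\<integral>\<^sup>+x\<in>Q. f x \<partial>lborel) * ennreal (LINT x:Q|lebesgue. w x)
          = (\<integral>\<^sup>+x. (f x * indicator Q x) * ennreal (LINT x:Q|lebesgue. w x) \<partial>lborel)"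
        by (simp add: nn_integral_multc)
      also have "\<dots> \<le> (\<integral>\<^sup>+x. ennreal (\<bar>A\<bar> * measure lborel Q) * (f x * ennreal (w' x) * indicator Q x) \<partial>lborel)"
      proof (rule nn_integral_mono_AE, use ae' in eventually_elim)
        case (elim x)
        show ?case
        proof (cases "x \<in> Q")
          case True
          with elim have "ennreal (LINT x:Q|lebesgue. w x) \<le> ennreal (\<bar>A\<bar> * measure lborel Q) * ennreal (w' x)"
            by (simp add: ennreal_mult''[symmetric] less_imp_le[OF pos] ennreal_leI)
          then have "f x * ennreal (LINT x:Q|lebesgue. w x) \<le> f x * (ennreal (\<bar>A\<bar> * measure lborel Q) * ennreal (w' x))"
            by (rule mult_left_mono) simp
          with True show ?thesis by (simp add: mult_ac)
        qed simp
      qed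
      also have "\<dots> = ennreal (\<bar>A\<bar> * measure lborel Q) * (\<integral>\<^sup>+x. f x * ennreal (w' x) * indicator Q x \<partial>lborel)"
        by (rule nn_integral_cmult) simp
      finally show ?thesis using True Q0[OF Q] by (simp add: e1 W[OF Q])
    qed
    then show ?thesis unfolding Ap_bound_def by (intro exI[of _ "\<bar>A\<bar>"]) auto
  next
    case False
    with p have p1: "1 < p" by simp
    define v where "v x = w x powr (- 1 / (p - 1))" for x
    define v' where "v' x = w' x powr (- 1 / (p - 1))" for x
    have v' [measurable]: "v' \<in> borel_measurable borel" unfolding v'_def by simp
    have v'pos: "0 < v' x" for x using pos[of x] by (simp add: v'_def)
    from False Ap obtain A where vi: "\<And>Q. Q \<in> cubes \<Longrightarrow> set_integrable lebesgue Q v"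
      and A: "\<And>Q. Q \<in> cubes \<Longrightarrow> average Q w * average Q v powr (p - 1) \<le> A"
      unfolding Ap_weight_def v_def by auto
    have V: "(\<integral>\<^sup>+x\<in>Q. ennreal (v' x) \<partial>lborel) = ennreal (LINT x:Q|lebesgue. v x)" if "Q \<in> cubes" for Q
      using that ae
      by (intro set_nn_integral_lborel_eq vi Qm less_imp_le[OF v'pos] v')
        (auto simp: v_def v'_def elim!: eventually_mono)
    have V0: "0 < (LINT x:Q|lebesgue. v x)" if Q: "Q \<in> cubes" for Q
    proof (rule ccontr)
      note [measurable] = Qm[OF Q]
      assume "\<not> 0 < (LINT x:Q|lebesgue. v x)"
      then have "(\<integral>\<^sup>+x\<in>Q. ennreal (v' x) \<partial>lborel) = 0" using V[OF Q] by (simp add: ennreal_neg)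
      then have "AE x in lborel. ennreal (v' x) * indicator Q x = 0"
        by (subst (asm) nn_integral_0_iff_AE) auto
      moreover have "ennreal (v' x) \<noteq> 0" for x using v'pos[of x] by (simp add: ennreal_eq_0_iff not_le)
      ultimately have "AE x in lborel. x \<notin> Q"
        by (elim eventually_mono) (auto simp: indicator_def split: if_splits)
      then have "emeasure lborel Q = 0" using AE_iff_null_sets[of Q lborel] Qm[OF Q] by auto
      then show False using Q0[OF Q] by simp
    qed
    have "epow p (\<integral>\<^sup>+x\<in>Q. f x \<partial>lborel) * (\<integral>\<^sup>+x\<in>Q. ennreal (w' x) \<partial>lborel)
       \<le> ennreal (\<bar>A\<bar> * measure lborel Q powr p) * (\<integral>\<^sup>+x\<in>Q. epow p (f x) * ennreal (w' x) \<partial>lborel)"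
      if Q: "Q \<in> cubes" and f [measurable]: "f \<in> borel_measurable borel" for Q f
    proof -
      note [measurable] = Qm[OF Q]
      define N where "N = density lborel (\<lambda>x. ennreal (v' x) * indicator Q x)"
      define F where "F x = f x * ennreal (w' x powr (1 / (p - 1)))" for x
      define VQ where "VQ = (LINT x:Q|lebesgue. v x)"
      define WQ where "WQ = (LINT x:Q|lebesgue. w x)"
      define m where "m = measure lborel Q"
      have m: "0 < m" using Q0[OF Q] by (simp add: m_def)
      have vF: "ennreal (v' x) * F x = f x" for x
      proof -
        have "v' x * w' x powr (1 / (p - 1)) = 1"
          using pos[of x] by (simp add: v'_def powr_add[symmetric])
        then have "ennreal (v' x) * ennreal (w' x powr (1 / (p - 1))) = 1"
          by (simp add: v'_def ennreal_mult[symmetric])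
        then show ?thesis unfolding F_def by (metis mult.left_commute mult.right_neutral)
      qed
      have vFp: "ennreal (v' x) * epow p (F x) = epow p (f x) * ennreal (w' x)" for x
      proof -
        have "v' x * (w' x powr (1 / (p - 1))) powr p = w' x"
          using pos[of x] p1 by (simp add: v'_def powr_powr powr_add[symmetric] diff_divide_distrib[symmetric])
        then have e: "ennreal (v' x) * ennreal ((w' x powr (1 / (p - 1))) powr p) = ennreal (w' x)"
          by (simp add: v'_def ennreal_mult[symmetric])
        have "F x = ennreal (w' x powr (1 / (p - 1))) * f x" by (simp add: F_def mult.commute)
        then have "epow p (F x) = ennreal ((w' x powr (1 / (p - 1))) powr p) * epow p (f x)"
          by (simp add: epow_cmult)
        then have "ennreal (v' x) * epow p (F x) = (ennreal (v' x) * ennreal ((w' x powr (1 / (p - 1))) powr p)) * epow p (f x)"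
          by (simp only: mult.assoc)
        then show ?thesis by (simp only: e mult.commute)
      qed
      have Fm [measurable]: "F \<in> borel_measurable borel" unfolding F_def by simp
      have "epow p (\<integral>\<^sup>+x. F x \<partial>N) \<le> ennreal (VQ powr (p - 1)) * (\<integral>\<^sup>+x. epow p (F x) \<partial>N)"
        using V0[OF Q] p V[OF Q]
        by (intro jensen_epow) (auto simp: N_def VQ_def emeasure_density)
      also have "(\<integral>\<^sup>+x. F x \<partial>N) = (\<integral>\<^sup>+x\<in>Q. f x \<partial>lborel)"
        unfolding N_def by (subst nn_integral_density) (auto simp: vF[symmetric] mult_ac intro!: nn_integral_cong)
      also have "(\<integral>\<^sup>+x. epow p (F x) \<partial>N) = (\<integral>\<^sup>+x\<in>Q. epow p (f x) * ennreal (w' x) \<partial>lborel)"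
      proof -
        have "ennreal (v' x) * indicator Q x * epow p (F x) = epow p (f x) * ennreal (w' x) * indicator Q x" for x
          by (cases "x \<in> Q") (simp_all add: vFp)
        then show ?thesis unfolding N_def by (subst nn_integral_density) auto
      qed
      finally have 1: "epow p (\<integral>\<^sup>+x\<in>Q. f x \<partial>lborel) * ennreal WQ \<le> 
         ennreal (VQ powr (p - 1)) * (\<integral>\<^sup>+x\<in>Q. epow p (f x) * ennreal (w' x) \<partial>lborel) * ennreal WQ"
        by (rule mult_right_mono) simp
      have "WQ / m * (VQ / m) powr (p - 1) \<le> A"
        using A[OF Q] by (simp add: average_def VQ_def WQ_def m_def)
      also have "(VQ / m) powr (p - 1) = VQ powr (p - 1) / (m powr p / m)"
        using m V0[OF Q] by (simp add: powr_divide powr_diff VQ_def)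
      finally have "VQ powr (p - 1) * WQ \<le> A * m powr p" using m by (simp add: field_simps)
      also have "\<dots> \<le> \<bar>A\<bar> * m powr p" by (intro mult_right_mono) auto
      finally have "ennreal (VQ powr (p - 1)) * ennreal WQ \<le> ennreal (\<bar>A\<bar> * m powr p)"
        using W0[OF Q] by (simp add: ennreal_mult[symmetric] WQ_def ennreal_leI)
      then have "ennreal (VQ powr (p - 1)) * ennreal WQ * (\<integral>\<^sup>+x\<in>Q. epow p (f x) * ennreal (w' x) \<partial>lborel)
        \<le> ennreal (\<bar>A\<bar> * m powr p) * (\<integral>\<^sup>+x\<in>Q. epow p (f x) * ennreal (w' x) \<partial>lborel)"
        by (rule mult_right_mono) simp
      with 1 show ?thesis by (simp add: W[OF Q] WQ_def m_def mult_ac)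
    qed
    then show ?thesis unfolding Ap_bound_def by (intro exI[of _ "\<bar>A\<bar>"]) auto
  qed
qed


definition econv :: "('a::euclidean_space \<Rightarrow> ennreal) \<Rightarrow> ('a \<Rightarrow> ennreal) \<Rightarrow> 'a \<Rightarrow> ennreal" where
  "econv k f x = (\<integral>\<^sup>+y. k (x - y) * f y \<partial>lborel)"

lemma econv_measurable [measurable]:
  assumes [measurable]: "k \<in> borel_measurable borel" "f \<in> borel_measurable borel"
  shows "econv k f \<in> borel_measurable borel"
  unfolding econv_def by measurable

abbreviation eenergy :: "real \<Rightarrow> ('a::euclidean_space \<Rightarrow> real) \<Rightarrow> ('a \<Rightarrow> ennreal) \<Rightarrow> ennreal" where
  "eenergy p w f \<equiv> (\<integral>\<^sup>+x. epow p (f x) * ennreal (w x) \<partial>lborel)"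

definition conv_bounded ::
  "real \<Rightarrow> ('a::euclidean_space \<Rightarrow> real) \<Rightarrow> ('a \<Rightarrow> ennreal) \<Rightarrow> real \<Rightarrow> bool" where
  "conv_bounded p w k C \<longleftrightarrow> k \<in> borel_measurable borel \<and> 0 \<le> C \<and>
     (\<forall>f\<in>borel_measurable borel.
        eenergy p w (econv k f)
          \<le> ennreal C * eenergy p w f)"

lemma conv_bounded_mono:
  assumes "conv_bounded p w k' C" "k \<in> borel_measurable borel" "\<And>x. k x \<le> k' x" "0 \<le> p"
  shows "conv_bounded p w k C"
  unfolding conv_bounded_def
proof (intro conjI ballI)
  fix f :: "'a \<Rightarrow> ennreal" assume f: "f \<in> borel_measurable borel"
  have "econv k f x \<le> econv k' f x" for x
    unfolding econv_def by (intro nn_integral_mono mult_right_mono assms) simp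
  then have "eenergy p w (econv k f)
      \<le> (\<integral>\<^sup>+x. epow p (econv k' f x) * ennreal (w x) \<partial>lborel)"
    by (intro nn_integral_mono mult_right_mono epow_mono assms) auto
  with assms(1) f show "eenergy p w (econv k f)
          \<le> ennreal C * eenergy p w f"
    unfolding conv_bounded_def by (meson order_trans)
qed (use assms in \<open>auto simp: conv_bounded_def\<close>)

lemma conv_bounded_cmult:
  assumes "conv_bounded p w k C" "0 \<le> a" and [measurable]: "w \<in> borel_measurable borel"
  shows "conv_bounded p w (\<lambda>x. ennreal a * k x) (a powr p * C)"
  unfolding conv_bounded_def
proof (intro conjI ballI)
  have [measurable]: "k \<in> borel_measurable borel" using assms by (simp add: conv_bounded_def)
  then show "(\<lambda>x. ennreal a * k x) \<in> borel_measurable borel" by simp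
  show "0 \<le> a powr p * C" using assms by (simp add: conv_bounded_def)
  fix f :: "'a \<Rightarrow> ennreal" assume f [measurable]: "f \<in> borel_measurable borel"
  have "econv (\<lambda>x. ennreal a * k x) f x = ennreal a * econv k f x" for x
    unfolding econv_def by (simp add: nn_integral_cmult[symmetric] mult.assoc)
  then have "eenergy p w (econv (\<lambda>x. ennreal a * k x) f)
      = ennreal (a powr p) * eenergy p w (econv k f)"
    using assms by (simp add: epow_cmult mult.assoc nn_integral_cmult)
  also have "\<dots> \<le> ennreal (a powr p) * (ennreal C * eenergy p w f)"
    using assms f by (intro mult_left_mono) (auto simp: conv_bounded_def)
  finally show "eenergy p w (econv (\<lambda>x. ennreal a * k x) f)
      \<le> ennreal (a powr p * C) * eenergy p w f"
    using assms by (simp add: ennreal_mult conv_bounded_def mult.assoc)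
qed

lemma conv_bounded_superposition:
  fixes K :: "'b \<Rightarrow> 'a::euclidean_space \<Rightarrow> ennreal"
  assumes "finite_measure N" and V: "emeasure N (space N) \<le> ennreal V" "0 < V"
    and [measurable]: "(\<lambda>(s, x). K s x) \<in> borel_measurable (N \<Otimes>\<^sub>M borel)"
    and K: "\<And>s. s \<in> space N \<Longrightarrow> conv_bounded p w (K s) C" and C: "0 \<le> C"
    and p: "1 \<le> p" and w [measurable]: "w \<in> borel_measurable borel"
  shows "conv_bounded p w (\<lambda>x. \<integral>\<^sup>+s. K s x \<partial>N) (V powr p * C)"
  unfolding conv_bounded_def
proof (intro conjI ballI)
  interpret N: finite_measure N by fact
  interpret P: pair_sigma_finite N "lborel :: 'a measure" by standard
  show "(\<lambda>x. \<integral>\<^sup>+s. K s x \<partial>N) \<in> borel_measurable borel" by measurable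
  show "0 \<le> V powr p * C" using C by simp
  fix f :: "'a \<Rightarrow> ennreal" assume f [measurable]: "f \<in> borel_measurable borel"
  have Km [measurable]: "K s \<in> borel_measurable borel" if "s \<in> space N" for s
    using K[OF that] by (simp add: conv_bounded_def)
  have [measurable]: "(\<lambda>(s, x). econv (K s) f x) \<in> borel_measurable (N \<Otimes>\<^sub>M borel)"
    unfolding econv_def by measurable
  have e: "econv (\<lambda>x. \<integral>\<^sup>+s. K s x \<partial>N) f x = (\<integral>\<^sup>+s. econv (K s) f x \<partial>N)" for x
  proof -
    have "econv (\<lambda>x. \<integral>\<^sup>+s. K s x \<partial>N) f x = (\<integral>\<^sup>+y. (\<integral>\<^sup>+s. K s (x - y) * f y \<partial>N) \<partial>lborel)"
      unfolding econv_def by (simp add: nn_integral_multc)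
    also have "\<dots> = (\<integral>\<^sup>+s. (\<integral>\<^sup>+y. K s (x - y) * f y \<partial>lborel) \<partial>N)"
      by (rule P.Fubini') simp
    finally show ?thesis by (simp add: econv_def)
  qed
  have "eenergy p w (econv (\<lambda>x. \<integral>\<^sup>+s. K s x \<partial>N) f)
     \<le> (\<integral>\<^sup>+x. (ennreal (V powr (p - 1)) * (\<integral>\<^sup>+s. epow p (econv (K s) f x) \<partial>N)) * ennreal (w x) \<partial>lborel)"
    unfolding e using V p by (intro nn_integral_mono mult_right_mono jensen_epow) auto
  also have "\<dots> = (\<integral>\<^sup>+x. (\<integral>\<^sup>+s. ennreal (V powr (p - 1)) * (epow p (econv (K s) f x) * ennreal (w x)) \<partial>N) \<partial>lborel)"
    by (simp add: nn_integral_multc nn_integral_cmult mult.assoc)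
  also have "\<dots> = (\<integral>\<^sup>+s. (\<integral>\<^sup>+x. ennreal (V powr (p - 1)) * (epow p (econv (K s) f x) * ennreal (w x)) \<partial>lborel) \<partial>N)"
    by (rule P.Fubini') simp
  also have "\<dots> = (\<integral>\<^sup>+s. ennreal (V powr (p - 1)) * eenergy p w (econv (K s) f) \<partial>N)"
    by (intro nn_integral_cong nn_integral_cmult) simp
  also have "\<dots> \<le> (\<integral>\<^sup>+s. ennreal (V powr (p - 1)) * (ennreal C * eenergy p w f) \<partial>N)"
    using K f by (intro nn_integral_mono mult_left_mono) (auto simp: conv_bounded_def)
  also have "\<dots> = (ennreal (V powr (p - 1)) * (ennreal C * eenergy p w f)) * emeasure N (space N)"
    by simp
  also have "\<dots> \<le> (ennreal (V powr (p - 1)) * (ennreal C * eenergy p w f)) * ennreal V"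
    using V by (intro mult_left_mono) auto
  also have "\<dots> = ennreal (V powr (p - 1) * V * C) * eenergy p w f"
    using V C by (simp add: ennreal_mult mult_ac)
  also have "V powr (p - 1) * V = V powr p" using V by (simp add: powr_diff)
  finally show "eenergy p w (econv (\<lambda>x. \<integral>\<^sup>+s. K s x \<partial>N) f)
          \<le> ennreal (V powr p * C) * eenergy p w f" .
qed

definition centred_cube :: "real \<Rightarrow> 'a::euclidean_space set" where
  "centred_cube r = cbox (- (r / 2) *\<^sub>R One) ((r / 2) *\<^sub>R One)"

lemma centred_cube_borel [measurable]: "centred_cube r \<in> sets borel"
  by (simp add: centred_cube_def)

lemma mem_centred_cube: "x \<in> centred_cube r \<longleftrightarrow> (\<forall>b\<in>Basis. \<bar>x \<bullet> b\<bar> \<le> r / 2)"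
  by (auto simp: centred_cube_def mem_box inner_simps abs_le_iff)

lemma translate_centred_cube:
  "y - u \<in> centred_cube r \<longleftrightarrow> y \<in> cbox (u - (r / 2) *\<^sub>R One) ((u - (r / 2) *\<^sub>R One) + r *\<^sub>R One)"
proof -
  have "\<bar>(y - u) \<bullet> b\<bar> \<le> r / 2 \<longleftrightarrow> (u - (r / 2) *\<^sub>R One) \<bullet> b \<le> y \<bullet> b \<and>
      y \<bullet> b \<le> ((u - (r / 2) *\<^sub>R One) + r *\<^sub>R One) \<bullet> b" if "b \<in> Basis" for b
    
  proof -
    have "(u - (r / 2) *\<^sub>R One) \<bullet> b = u \<bullet> b - r / 2" "((u - (r / 2) *\<^sub>R One) + r *\<^sub>R One) \<bullet> b = u \<bullet> b + r / 2"
      using that by (simp_all add: inner_simps)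
    then show ?thesis unfolding inner_diff_left[of y] by linarith
  qed
  then show ?thesis by (simp add: mem_centred_cube mem_box)
qed

lemma cube_kernel_bounded:
  fixes w :: "'a::euclidean_space \<Rightarrow> real"
  assumes Ap: "Ap_bound p w A" and A: "0 \<le> A" and p: "1 \<le> p" and r: "0 < r"
    and [measurable]: "w \<in> borel_measurable borel"
  shows "conv_bounded p w (\<lambda>x. ennreal (1 / r ^ DIM('a)) * indicator (centred_cube r) x)
    (A * 2 powr (p * DIM('a)) * 2 ^ DIM('a))"
  unfolding conv_bounded_def
proof (intro conjI ballI)
  define D where "D = DIM('a)"
  define C0 where "C0 = A * 2 powr (p * D) * 2 ^ D"
  show "(\<lambda>x. ennreal (1 / r ^ DIM('a)) * indicator (centred_cube r) x :: ennreal) \<in> borel_measurable borel"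
    by measurable
  show "0 \<le> A * 2 powr (p * DIM('a)) * 2 ^ DIM('a)" using A by simp
  fix f :: "'a \<Rightarrow> ennreal" assume f [measurable]: "f \<in> borel_measurable borel"
  define k where "k = (\<lambda>x::'a. ennreal (1 / r ^ D) * indicator (centred_cube r) x)"
  have [measurable]: "k \<in> borel_measurable borel" unfolding k_def by measurable
  define S where "S u = (\<integral>\<^sup>+y. f y * indicator (centred_cube (2*r)) (y - u) \<partial>lborel)" for u
  define N where "N = eenergy p w f"
  have [measurable]: "S \<in> borel_measurable borel" unfolding S_def by measurable
  have sym: "indicator (centred_cube s) (u - x) = (indicator (centred_cube s) (x - u) :: ennreal)" for s and u x :: 'a
    by (auto simp: indicator_def mem_centred_cube inner_simps abs_minus_commute)
  have vol: "(\<integral>\<^sup>+y. indicator (centred_cube s) (y - x) \<partial>lborel) = ennreal (s ^ D)" if "0 < s" for s and x :: 'a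
  proof -
    have "(\<integral>\<^sup>+y. indicator (centred_cube s) (y - x) \<partial>lborel)
      = (\<integral>\<^sup>+y. indicator (cbox (x - (s / 2) *\<^sub>R One) ((x - (s / 2) *\<^sub>R One) + s *\<^sub>R One)) y \<partial>lborel)"
      by (intro nn_integral_cong) (simp only: indicator_def translate_centred_cube)
    also have "\<dots> = ennreal (s ^ D)" using that unfolding D_def by (subst nn_integral_indicator) (auto simp only: measure_cube sets_lborel cbox_borel)
    finally show ?thesis .
  qed
  have loc: "econv k f x * indicator (centred_cube r) (u - x) \<le> ennreal (1 / r ^ D) * S u * indicator (centred_cube r) (x - u)" for x u
  proof (cases "x - u \<in> centred_cube r")
    case True
    have "econv k f x \<le> (\<integral>\<^sup>+y. ennreal (1 / r ^ D) * (f y * indicator (centred_cube (2*r)) (y - u)) \<partial>lborel)"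
      unfolding econv_def
    proof (rule nn_integral_mono)
      fix y
      have "y - u \<in> centred_cube (2*r)" if "x - y \<in> centred_cube r"
        unfolding mem_centred_cube
      proof
        fix b :: 'a assume "b \<in> Basis"
        then have "\<bar>(x - y) \<bullet> b\<bar> \<le> r / 2" "\<bar>(x - u) \<bullet> b\<bar> \<le> r / 2"
          using that True by (auto simp: mem_centred_cube)
        then show "\<bar>(y - u) \<bullet> b\<bar> \<le> 2 * r / 2" unfolding inner_diff_left by linarith
      qed
      then show "k (x - y) * f y \<le> ennreal (1 / r ^ D) * (f y * indicator (centred_cube (2*r)) (y - u))"
        by (auto simp: k_def indicator_def)
    qed
    also have "\<dots> = ennreal (1 / r ^ D) * S u" by (simp add: S_def nn_integral_cmult)
    finally show ?thesis using True by (simp add: sym[of r u x])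
  next
    case False
    then show ?thesis by (simp add: sym[of r u x])
  qed
  have loc': "epow p (econv k f x) * ennreal (w x) * indicator (centred_cube r) (u - x)
      \<le> ennreal (r powr (- (p * D))) * epow p (S u) * (ennreal (w x) * indicator (centred_cube (2*r)) (x - u))" for x u
  proof (cases "x - u \<in> centred_cube r")
    case True
    then have T2: "x - u \<in> centred_cube (2*r)" using r by (force simp: mem_centred_cube)
    from loc[of x u] True have "econv k f x \<le> ennreal (1 / r ^ D) * S u" by (simp add: sym[of r u x])
    then have "epow p (econv k f x) \<le> ennreal ((1 / r ^ D) powr p) * epow p (S u)"
      using p r by (subst epow_cmult[symmetric]) (auto intro!: epow_mono)
    also have "(1 / r ^ D) powr p = r powr (- (p * D))" using r
      by (simp add: powr_divide powr_realpow[symmetric] powr_powr powr_minus mult.commute inverse_eq_divide)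
    finally have "epow p (econv k f x) * ennreal (w x) \<le> ennreal (r powr (- (p * D))) * epow p (S u) * ennreal (w x)"
      by (rule mult_right_mono) simp
    with True T2 show ?thesis by (simp add: sym[of r u x] mult.assoc)
  next
    case False
    then show ?thesis by (simp add: sym[of r u x])
  qed
  have Sb: "epow p (S u) * (\<integral>\<^sup>+x. ennreal (w x) * indicator (centred_cube (2*r)) (x - u) \<partial>lborel)
    \<le> ennreal (A * ((2*r) ^ D) powr p) * (\<integral>\<^sup>+x. epow p (f x) * ennreal (w x) * indicator (centred_cube (2*r)) (x - u) \<partial>lborel)" for u
  proof -
    define Q where "Q = cbox (u - (2 * r / 2) *\<^sub>R One) ((u - (2 * r / 2) *\<^sub>R One) + (2 * r) *\<^sub>R One)"
    have "Q \<in> cubes" using r unfolding cubes_def Q_def by force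
    moreover have "indicator (centred_cube (2*r)) (y - u) = (indicator Q y :: ennreal)" for y
      unfolding Q_def by (simp only: indicator_def translate_centred_cube)
    moreover have "measure lborel Q = (2*r) ^ D" using r unfolding Q_def D_def by (intro measure_cube) simp
    ultimately show ?thesis using Ap[unfolded Ap_bound_def, rule_format, of Q f] f unfolding S_def by simp
  qed
  have "ennreal (r ^ D) * eenergy p w (econv k f)
    = (\<integral>\<^sup>+x. epow p (econv k f x) * ennreal (w x) * (\<integral>\<^sup>+u. indicator (centred_cube r) (u - x) \<partial>lborel) \<partial>lborel)"
    using r by (subst nn_integral_cmult[symmetric]) (auto simp: vol mult_ac)
  also have "\<dots> = (\<integral>\<^sup>+x. (\<integral>\<^sup>+u. epow p (econv k f x) * ennreal (w x) * indicator (centred_cube r) (u - x) \<partial>lborel) \<partial>lborel)"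
    by (intro nn_integral_cong nn_integral_cmult[symmetric]) measurable
  also have "\<dots> = (\<integral>\<^sup>+u. (\<integral>\<^sup>+x. epow p (econv k f x) * ennreal (w x) * indicator (centred_cube r) (u - x) \<partial>lborel) \<partial>lborel)"
    by (rule lborel_pair.Fubini') measurable
  also have "\<dots> \<le> (\<integral>\<^sup>+u. (\<integral>\<^sup>+x. ennreal (r powr (- (p * D))) * epow p (S u) * (ennreal (w x) * indicator (centred_cube (2*r)) (x - u)) \<partial>lborel) \<partial>lborel)"
    by (intro nn_integral_mono loc')
  also have "\<dots> = (\<integral>\<^sup>+u. ennreal (r powr (- (p * D))) * (epow p (S u) * (\<integral>\<^sup>+x. ennreal (w x) * indicator (centred_cube (2*r)) (x - u) \<partial>lborel)) \<partial>lborel)"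
    by (simp add: nn_integral_cmult mult.assoc)
  also have "\<dots> \<le> (\<integral>\<^sup>+u. ennreal (r powr (- (p * D))) * (ennreal (A * ((2*r) ^ D) powr p) * (\<integral>\<^sup>+x. epow p (f x) * ennreal (w x) * indicator (centred_cube (2*r)) (x - u) \<partial>lborel)) \<partial>lborel)"
    by (intro nn_integral_mono mult_left_mono Sb) auto
  also have "\<dots> = ennreal (r powr (- (p * D))) * (ennreal (A * ((2*r) ^ D) powr p) * (\<integral>\<^sup>+u. (\<integral>\<^sup>+x. epow p (f x) * ennreal (w x) * indicator (centred_cube (2*r)) (x - u) \<partial>lborel) \<partial>lborel))"
    by (simp add: nn_integral_cmult)
  also have "(\<integral>\<^sup>+u. (\<integral>\<^sup>+x. epow p (f x) * ennreal (w x) * indicator (centred_cube (2*r)) (x - u) \<partial>lborel) \<partial>lborel)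
    = (\<integral>\<^sup>+x. (\<integral>\<^sup>+u. epow p (f x) * ennreal (w x) * indicator (centred_cube (2*r)) (x - u) \<partial>lborel) \<partial>lborel)"
    by (rule lborel_pair.Fubini') measurable
  also have "\<dots> = N * ennreal ((2*r) ^ D)"
  proof -
    have "(\<integral>\<^sup>+u. epow p (f x) * ennreal (w x) * indicator (centred_cube (2*r)) (x - u) \<partial>lborel)
      = epow p (f x) * ennreal (w x) * ennreal ((2*r) ^ D)" for x
      using r by (subst nn_integral_cmult) (auto simp: sym[of _ x] vol)
    then show ?thesis by (simp add: N_def nn_integral_multc)
  qed
  also have "ennreal (r powr (- (p * D))) * (ennreal (A * ((2*r) ^ D) powr p) * (N * ennreal ((2*r) ^ D)))
     = ennreal (r powr (- (p * D)) * (A * ((2*r) ^ D) powr p) * (2*r) ^ D) * N"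
    using A r by (simp add: ennreal_mult mult_ac)
  also have "r powr (- (p * D)) * (A * ((2*r) ^ D) powr p) * (2*r) ^ D = r ^ D * C0"
  proof -
    have "((2*r) ^ D) powr p = 2 powr (p * D) * r powr (p * D)"
      using r by (simp add: powr_realpow[symmetric] powr_powr powr_mult mult.commute)
    moreover have "r powr (- (p * D)) * r powr (p * D) = 1" using r by (simp add: powr_add[symmetric])
    ultimately show ?thesis by (simp add: C0_def power_mult_distrib mult_ac)
  qed
  also have "ennreal (r ^ D * C0) * N = ennreal (r ^ D) * (ennreal C0 * N)"
    using r A by (simp add: ennreal_mult C0_def mult.assoc)
  finally have "eenergy p w (econv k f) \<le> ennreal C0 * N"
    using r by (subst (asm) ennreal_mult_le_mult_iff) auto
  then show "(\<integral>\<^sup>+x. epow p (econv (\<lambda>x. ennreal (1 / r ^ DIM('a)) * indicator (centred_cube r) x) f x) * ennreal (w x) \<partial>lborel)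
      \<le> ennreal (A * 2 powr (p * DIM('a)) * 2 ^ DIM('a)) * eenergy p w f"
    by (simp add: k_def C0_def N_def D_def)
qed

section \<open>Exponential kernels and contour shifts\<close>

lemma nn_integral_Gamma:
  assumes a: "0 < a" and b: "0 < b"
  shows "(\<integral>\<^sup>+s\<in>{0<..}. ennreal (s powr (a - 1) * exp (- (b * s))) \<partial>lborel) = ennreal (Gamma a / b powr a)"
proof -
  have "((\<lambda>t. t powr (a - 1) / exp t) has_integral Gamma a) {0..}" by (rule Gamma_integral_real[OF a])
  then have "(\<integral>\<^sup>+t. ennreal (t powr (a - 1) / exp t) * indicator {0..} t \<partial>lborel) = ennreal (Gamma a)"
    by (intro nn_integral_has_integral_lebesgue') auto
  also have "(\<integral>\<^sup>+t. ennreal (t powr (a - 1) / exp t) * indicator {0..} t \<partial>lborel)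
    = ennreal \<bar>b\<bar> * (\<integral>\<^sup>+x. ennreal ((0 + b * x) powr (a - 1) / exp (0 + b * x)) * indicator {0..} (0 + b * x) \<partial>lborel)"
    using b by (intro nn_integral_real_affine) auto
  also have "\<dots> = ennreal b * (\<integral>\<^sup>+x. ennreal (b powr (a - 1)) * (ennreal (x powr (a - 1) * exp (- (b * x))) * indicator {0<..} x) \<partial>lborel)"
    using b AE_lborel_singleton[of "0::real"]
    by (intro arg_cong2[where f="(*)"] nn_integral_cong_AE)
       (auto elim!: eventually_mono simp: powr_mult ennreal_mult[symmetric] indicator_def exp_minus field_simps zero_le_mult_iff)
  also have "\<dots> = ennreal (b * b powr (a - 1)) * (\<integral>\<^sup>+s\<in>{0<..}. ennreal (s powr (a - 1) * exp (- (b * s))) \<partial>lborel)"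
    using b by (subst nn_integral_cmult) (auto simp: ennreal_mult mult.assoc)
  also have "b * b powr (a - 1) = b powr a" using b by (simp add: powr_diff)
  finally have *: "ennreal (b powr a) * (\<integral>\<^sup>+s\<in>{0<..}. ennreal (s powr (a - 1) * exp (- (b * s))) \<partial>lborel) = ennreal (Gamma a)" .
  also have "ennreal (Gamma a) = ennreal (b powr a) * ennreal (Gamma a / b powr a)"
    using a b Gamma_real_pos[of a] by (simp add: ennreal_mult[symmetric])
  finally show ?thesis using b by (subst (asm) ennreal_mult_cancel_left) auto
qed

lemma exp_kernel_le_superposition:
  fixes x :: "'a::euclidean_space"
  assumes \<delta>: "0 < \<delta>"
  shows "ennreal (\<delta> ^ DIM('a) * exp (- (\<delta> * norm x)))
    \<le> (\<integral>\<^sup>+s. ennreal ((2 * s) ^ DIM('a) * exp (- s)) * indicator {0<..} s *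
          (ennreal (1 / (2 * s / \<delta>) ^ DIM('a)) * indicator (centred_cube (2 * s / \<delta>)) x) \<partial>lborel)"
proof -
  define D where "D = DIM('a)"
  have "((\<lambda>s. exp (-1 * s)) has_integral exp (-1 * (\<delta> * norm x)) / 1) {\<delta> * norm x..}"
    by (rule has_integral_exp_minus_to_infinity) simp
  then have "(\<integral>\<^sup>+s. ennreal (exp (-1 * s)) * indicator {\<delta> * norm x..} s \<partial>lborel) = ennreal (exp (-1 * (\<delta> * norm x)) / 1)"
    by (intro nn_integral_has_integral_lebesgue') auto
  then have "ennreal (\<delta> ^ D * exp (- (\<delta> * norm x))) = ennreal (\<delta> ^ D) * (\<integral>\<^sup>+s. ennreal (exp (- s)) * indicator {\<delta> * norm x..} s \<partial>lborel)"
    using \<delta> by (simp add: ennreal_mult)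
  also have "\<dots> = (\<integral>\<^sup>+s. ennreal (\<delta> ^ D) * (ennreal (exp (- s)) * indicator {\<delta> * norm x..} s) \<partial>lborel)"
    by (rule nn_integral_cmult[symmetric]) simp
  also have "\<dots> \<le> (\<integral>\<^sup>+s. ennreal ((2 * s) ^ D * exp (- s)) * indicator {0<..} s *
          (ennreal (1 / (2 * s / \<delta>) ^ D) * indicator (centred_cube (2 * s / \<delta>)) x) \<partial>lborel)"
  proof (rule nn_integral_mono_AE, use AE_lborel_singleton[of "0::real"] in eventually_elim)
    case (elim s)
    show ?case
    proof (cases "\<delta> * norm x \<le> s")
      case True
      then have s: "0 < s" using elim \<delta> by (smt (verit) norm_ge_zero mult_nonneg_nonneg)
      have "x \<in> centred_cube (2 * s / \<delta>)"
        unfolding mem_centred_cube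
      proof
        fix b :: 'a assume "b \<in> Basis"
        then have "\<bar>x \<bullet> b\<bar> \<le> norm x" by (rule Basis_le_norm)
        also have "norm x \<le> s / \<delta>" using True \<delta> by (simp add: field_simps)
        finally show "\<bar>x \<bullet> b\<bar> \<le> 2 * s / \<delta> / 2" by simp
      qed
      then show ?thesis using s \<delta> True
        by (simp add: ennreal_mult[symmetric] power_mult_distrib power_divide)
    qed simp
  qed
  finally show ?thesis by (simp add: D_def)
qed

definition exp_mass :: "'a::euclidean_space itself \<Rightarrow> real" where
  "exp_mass _ = 2 ^ DIM('a) * Gamma (DIM('a) + 1)"

lemma exp_mass_pos: "0 < exp_mass TYPE('a::euclidean_space)"
  unfolding exp_mass_def by (intro mult_pos_pos Gamma_real_pos) auto

lemma nn_integral_exp_mass: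
  "(\<integral>\<^sup>+s. ennreal ((2 * s) ^ DIM('a::euclidean_space) * exp (- s)) * indicator {0<..} s \<partial>lborel) = ennreal (exp_mass TYPE('a))"
proof -
  define D where "D = DIM('a)"
  have "(\<integral>\<^sup>+s. ennreal ((2 * s) ^ D * exp (- s)) * indicator {0<..} s \<partial>lborel)
    = (\<integral>\<^sup>+s. ennreal (2 ^ D) * (ennreal (s powr ((real D + 1) - 1) * exp (- (1 * s))) * indicator {0<..} s) \<partial>lborel)"
    by (intro nn_integral_cong) (auto simp: indicator_def ennreal_mult[symmetric] power_mult_distrib powr_realpow)
  also have "\<dots> = ennreal (2 ^ D) * ennreal (Gamma (real D + 1) / 1 powr (real D + 1))"
    by (subst nn_integral_cmult) (auto simp: nn_integral_Gamma[of "real D + 1" 1, simplified] simp del: power_numeral)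
  also have "\<dots> = ennreal (exp_mass TYPE('a))"
    by (simp add: exp_mass_def D_def ennreal_mult[symmetric] add.commute)
  finally show ?thesis unfolding D_def .
qed

lemma exp_kernel_bounded:
  fixes w :: "'a::euclidean_space \<Rightarrow> real"
  assumes Ap: "Ap_bound p w A" and A: "0 \<le> A" and p: "1 \<le> p"
    and w [measurable]: "w \<in> borel_measurable borel"
  shows "\<exists>C\<ge>0. \<forall>\<delta>>0. conv_bounded p w (\<lambda>x. ennreal (\<delta> ^ DIM('a) * exp (- (\<delta> * norm x)))) C"
proof -
  define V where "V = exp_mass TYPE('a)"
  define C where "C = A * 2 powr (p * DIM('a)) * 2 ^ DIM('a)"
  have C0: "0 \<le> C" using A by (simp add: C_def)
  define N where "N = density lborel (\<lambda>s. ennreal ((2 * s) ^ DIM('a) * exp (- s)) * indicator {0<..} s)"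
  have eN: "emeasure N (space N) = ennreal V"
    unfolding N_def V_def using nn_integral_exp_mass[where 'a='a] by (subst emeasure_density) auto
  have V: "0 < V" by (simp add: V_def exp_mass_pos)
  interpret N: finite_measure N by standard (simp add: eN)
  have "conv_bounded p w (\<lambda>x. ennreal (\<delta> ^ DIM('a) * exp (- (\<delta> * norm x)))) (V powr p * C)" if \<delta>: "0 < \<delta>" for \<delta>
  proof (rule conv_bounded_mono)
    define K :: "real \<Rightarrow> 'a \<Rightarrow> ennreal" where
      "K s x = ennreal (1 / (2 * s / \<delta>) ^ DIM('a)) * indicator {y. 0 < s \<and> (\<forall>b\<in>Basis. \<bar>y \<bullet> b\<bar> \<le> s / \<delta>)} x" for s x
    have cc: "x \<in> centred_cube (2 * s / \<delta>) \<longleftrightarrow> (\<forall>b\<in>Basis. \<bar>x \<bullet> b\<bar> \<le> s / \<delta>)" for x :: 'a and s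
      by (simp add: mem_centred_cube)
    have Kpos: "K s = (\<lambda>x. ennreal (1 / (2 * s / \<delta>) ^ DIM('a)) * indicator (centred_cube (2 * s / \<delta>)) x)" if "0 < s" for s
      using that by (auto simp: K_def fun_eq_iff indicator_def cc)
    have Kneg: "K s = (\<lambda>x. 0)" if "\<not> 0 < s" for s
      using that by (auto simp: K_def fun_eq_iff indicator_def)
    show "conv_bounded p w (\<lambda>x. \<integral>\<^sup>+s. K s x \<partial>N) (V powr p * C)"
    proof (rule conv_bounded_superposition)
      have [measurable_cong]: "sets N = sets borel" by (simp add: N_def)
      show "(\<lambda>(s, x). K s x) \<in> borel_measurable (N \<Otimes>\<^sub>M borel)"
        unfolding K_def indicator_def by measurable
      show "conv_bounded p w (K s) C" for s
      proof (cases "0 < s")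
        case True
        then show ?thesis unfolding Kpos[OF True] C_def
          using \<delta> by (intro cube_kernel_bounded[OF Ap A p]) auto
      next
        case False
        then show ?thesis unfolding Kneg[OF False]
          using C0 p by (simp add: conv_bounded_def econv_def)
      qed
    qed (use V eN C0 p w N.finite_measure_axioms in auto)
    show "ennreal (\<delta> ^ DIM('a) * exp (- (\<delta> * norm x))) \<le> (\<integral>\<^sup>+s. K s x \<partial>N)" for x
    proof -
      have "(\<integral>\<^sup>+s. K s x \<partial>N) = (\<integral>\<^sup>+s. ennreal ((2 * s) ^ DIM('a) * exp (- s)) * indicator {0<..} s * K s x \<partial>lborel)"
        unfolding N_def by (subst nn_integral_density) (auto simp: K_def[abs_def] indicator_def)
      also have "\<dots> = (\<integral>\<^sup>+s. ennreal ((2 * s) ^ DIM('a) * exp (- s)) * indicator {0<..} s *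
          (ennreal (1 / (2 * s / \<delta>) ^ DIM('a)) * indicator (centred_cube (2 * s / \<delta>)) x) \<partial>lborel)"
        by (intro nn_integral_cong) (auto simp: indicator_def Kpos)
      finally show ?thesis using exp_kernel_le_superposition[OF \<delta>, of x] by simp
    qed
  qed (use p in auto)
  then show ?thesis using C0 by (intro exI[of _ "V powr p * C"]) auto
qed

lemma lborel_nn_integral_translate:
  fixes f :: "'a::euclidean_space \<Rightarrow> ennreal"
  assumes [measurable]: "f \<in> borel_measurable borel"
  shows "(\<integral>\<^sup>+x. f (x + a) \<partial>lborel) = (\<integral>\<^sup>+x. f x \<partial>lborel)"
proof -
  have "(\<integral>\<^sup>+x. f x \<partial>lborel) = (\<integral>\<^sup>+x. f x \<partial>distr lborel borel ((+) a))" by (simp add: lborel_distr_plus)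
  also have "\<dots> = (\<integral>\<^sup>+x. f (x + a) \<partial>lborel)" by (simp add: nn_integral_distr add.commute)
  finally show ?thesis by simp
qed

lemma integrable_exp_norm:
  assumes \<delta>: "0 < \<delta>"
  shows "integrable lborel (\<lambda>x::'a::euclidean_space. exp (- (\<delta> * norm x)))"
proof (rule integrableI_bounded)
  define D where "D = DIM('a)"
  let ?k = "\<lambda>s (x::'a). ennreal ((2 * s) ^ D * exp (- s)) * indicator {0<..} s *
          (ennreal (1 / (2 * s / \<delta>) ^ D) * indicator {y. \<forall>b\<in>Basis. \<bar>y \<bullet> b\<bar> \<le> s / \<delta>} x)"
  have cc: "centred_cube (2 * s / \<delta>) = {y::'a. \<forall>b\<in>Basis. \<bar>y \<bullet> b\<bar> \<le> s / \<delta>}" for s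
    by (auto simp: mem_centred_cube)
  have [measurable]: "case_prod ?k \<in> borel_measurable (lborel \<Otimes>\<^sub>M lborel)"
    unfolding indicator_def by measurable
  have "(\<integral>\<^sup>+x. ennreal (\<delta> ^ D * exp (- (\<delta> * norm x))) \<partial>(lborel :: 'a measure)) \<le> (\<integral>\<^sup>+x. (\<integral>\<^sup>+s. ?k s x \<partial>lborel) \<partial>lborel)"
    using exp_kernel_le_superposition[OF \<delta>, where 'a='a] by (intro nn_integral_mono) (simp add: D_def cc)
  also have "\<dots> = (\<integral>\<^sup>+s. (\<integral>\<^sup>+x. ?k s x \<partial>lborel) \<partial>lborel)"
    by (rule lborel_pair.Fubini') measurable
  also have "\<dots> = (\<integral>\<^sup>+s. ennreal ((2 * s) ^ D * exp (- s)) * indicator {0<..} s \<partial>lborel)"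
  proof (intro nn_integral_cong)
    fix s :: real
    show "(\<integral>\<^sup>+x. ?k s x \<partial>lborel) = ennreal ((2 * s) ^ D * exp (- s)) * indicator {0<..} s"
    proof (cases "0 < s")
      case True
      have "emeasure lborel (centred_cube (2 * s / \<delta>) :: 'a set) = ennreal ((2 * s / \<delta>) ^ D)"
      proof -
        have "centred_cube (2 * s / \<delta>) = cbox (0 - (2 * s / \<delta> / 2) *\<^sub>R One) ((0 - (2 * s / \<delta> / 2) *\<^sub>R One) + (2 * s / \<delta>) *\<^sub>R One :: 'a)"
          using translate_centred_cube[of _ "0::'a" "2 * s / \<delta>"] by (intro set_eqI) simp
        then show ?thesis using measure_cube(2)[of "2 * s / \<delta>" "0 - (2 * s / \<delta> / 2) *\<^sub>R One :: 'a"] True \<delta> by (simp add: D_def)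
      qed
      then have "(\<integral>\<^sup>+x. ennreal (1 / (2 * s / \<delta>) ^ D) * indicator (centred_cube (2 * s / \<delta>)) x \<partial>(lborel :: 'a measure)) = 1"
        using True \<delta> by (simp add: nn_integral_cmult ennreal_mult[symmetric] del: power_divide)
      then show ?thesis using True by (simp add: nn_integral_cmult cc[symmetric])
    qed simp
  qed
  also have "\<dots> = ennreal (exp_mass TYPE('a))" unfolding D_def by (rule nn_integral_exp_mass)
  finally have "ennreal (\<delta> ^ D) * (\<integral>\<^sup>+x. ennreal (exp (- (\<delta> * norm x))) \<partial>(lborel :: 'a measure)) \<le> ennreal (exp_mass TYPE('a))"
    using \<delta> by (simp add: ennreal_mult nn_integral_cmult)
  then have "ennreal (\<delta> ^ D) * (\<integral>\<^sup>+x. ennreal (exp (- (\<delta> * norm x))) \<partial>(lborel :: 'a measure)) < top"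
    by (rule le_less_trans) simp
  then show "(\<integral>\<^sup>+x. ennreal (norm (exp (- (\<delta> * norm x)))) \<partial>(lborel :: 'a measure)) < \<infinity>"
    using \<delta> by (auto simp: ennreal_mult_less_top)
qed simp

lemma holomorphic_lebesgue_integral:
  fixes F :: "'b \<Rightarrow> complex \<Rightarrow> complex"
  assumes U: "open U" and hol: "\<And>x. F x holomorphic_on U"
    and meas: "\<And>z. z \<in> U \<Longrightarrow> (\<lambda>x. F x z) \<in> borel_measurable M"
    and dom: "\<And>x z. z \<in> U \<Longrightarrow> norm (F x z) \<le> D x" and D: "integrable M D"
  shows "(\<lambda>z. LINT x|M. F x z) holomorphic_on U"
  unfolding holomorphic_on_open[OF U]
proof
  fix z assume "z \<in> U"
  then obtain r' where r': "0 < r'" "cball z r' \<subseteq> U" using U open_contains_cball by blast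
  define r where "r = r' / 2"
  have r: "0 < r" "cball z (2 * r) \<subseteq> U" using r' by (auto simp: r_def)
  have ball: "cball v r \<subseteq> U" if "v \<in> ball z r" for v
    using that r(2) by (smt (verit) dist_triangle mem_ball mem_cball subset_eq)
  have der: "(F x has_field_derivative deriv (F x) v) (at v)" if "v \<in> ball z r" for x v
    using hol U ball[OF that] r(1) by (intro holomorphic_derivI[of _ U]) auto
  have bound: "norm (deriv (F x) v) \<le> D x / r" if v: "v \<in> ball z r" for x v
  proof -
    have "norm ((deriv ^^ 1) (F x) v) \<le> fact 1 * D x / r ^ 1"
    proof (rule Cauchy_inequality)
      show "F x holomorphic_on ball v r"
        using hol ball[OF v] ball_subset_cball holomorphic_on_subset by blast
      show "continuous_on (cball v r) (F x)"
        using hol ball[OF v] holomorphic_on_imp_continuous_on holomorphic_on_subset by blast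
      show "norm (F x y) \<le> D x" if "norm (v - y) = r" for y
        using ball[OF v] that by (intro dom) (auto simp: dist_norm)
    qed (use r in auto)
    then show ?thesis by simp
  qed
  have lip: "norm (F x v - F x z) \<le> D x / r * norm (v - z)" if "v \<in> ball z r" for x v
    using that r der bound
    by (intro field_differentiable_bound[of "ball z r" "F x" "deriv (F x)"]) (auto intro: has_field_derivative_at_within)
  have int: "integrable M (\<lambda>x. F x v)" if "v \<in> U" for v
    using D by (rule Bochner_Integration.integrable_bound) (use that meas dom in \<open>auto intro!: AE_I2 order_trans[OF dom abs_ge_self]\<close>)
  have "((\<lambda>z. LINT x|M. F x z) has_field_derivative (LINT x|M. deriv (F x) z)) (at z within ball z r)"
    unfolding has_field_derivative_iff tendsto_at_iff_sequentially
  proof (intro allI impI)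
    fix X :: "nat \<Rightarrow> complex" assume X: "\<forall>i. X i \<in> ball z r - {z}" and lim: "X \<longlonglongrightarrow> z"
    have XU: "X i \<in> U" for i using X ball[of "X i"] r by auto
    have zU: "z \<in> U" by fact
    have q: "(\<lambda>i. (F x (X i) - F x z) / (X i - z)) \<longlonglongrightarrow> deriv (F x) z" for x
    proof -
      have "((\<lambda>y. (F x y - F x z) / (y - z)) \<longlongrightarrow> deriv (F x) z) (at z)"
        using der[of z x] r by (simp add: has_field_derivative_iff)
      moreover have "filterlim X (at z) sequentially" using X lim by (auto simp: filterlim_at)
      ultimately show ?thesis by (rule filterlim_compose)
    qed
    have m: "(\<lambda>x. (F x (X i) - F x z) / (X i - z)) \<in> borel_measurable M" for i
      using meas[OF XU] meas[OF zU] by measurable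
    have "(\<lambda>i. LINT x|M. (F x (X i) - F x z) / (X i - z)) \<longlonglongrightarrow> (LINT x|M. deriv (F x) z)"
    proof (rule integral_dominated_convergence)
      show "(\<lambda>x. deriv (F x) z) \<in> borel_measurable M"
        by (rule borel_measurable_LIMSEQ_metric[OF m q])
      show "integrable M (\<lambda>x. D x / r)" using D by simp
      show "AE x in M. norm ((F x (X i) - F x z) / (X i - z)) \<le> D x / r" for i
        using lip[of "X i"] X by (auto simp: norm_divide divide_le_eq mult.commute intro!: AE_I2)
    qed (use m q in auto)
    moreover have eq: "(LINT x|M. (F x (X i) - F x z) / (X i - z)) = ((LINT x|M. F x (X i)) - (LINT x|M. F x z)) / (X i - z)" for i
      using int[OF XU[of i]] int[OF zU] by simp
    ultimately show "((\<lambda>y. ((LINT x|M. F x y) - (LINT x|M. F x z)) / (y - z)) \<circ> X) \<longlonglongrightarrow> (LINT x|M. deriv (F x) z)"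
      by (simp only: o_def eq)
  qed
  then show "\<exists>f'. ((\<lambda>z. LINT x|M. F x z) has_field_derivative f') (at z)"
    using r at_within_open[of z "ball z r"] by auto
qed

text \<open>Contour shift without choosing coordinates: translation invariance makes the holomorphic
  function \<open>\<zeta> \<mapsto> \<integral> F x \<zeta> dx\<close> constant on the real segment, hence everywhere.\<close>

lemma integral_complex_shift:
  fixes F :: "'a::euclidean_space \<Rightarrow> complex \<Rightarrow> complex"
  defines "U \<equiv> \<lambda>c. {z. \<bar>Re z\<bar> < 1 \<and> \<bar>Im z\<bar> < c}"
  assumes hol: "\<And>x. F x holomorphic_on U c"
    and meas: "\<And>z. z \<in> U c \<Longrightarrow> (\<lambda>x. F x z) \<in> borel_measurable borel"
    and dom: "\<And>x z. z \<in> U c \<Longrightarrow> norm (F x z) \<le> D x" and D: "integrable lborel D"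
    and shift: "\<And>x a. \<bar>a\<bar> < 1 \<Longrightarrow> F x (of_real a) = F (x + a *\<^sub>R e) 0"
    and z: "z \<in> U c"
  shows "(LINT x|lborel. F x z) = (LINT x|lborel. F x 0)"
proof -
  define \<psi> where "\<psi> z = (LINT x|lborel. F x z) - (LINT x|lborel. F x 0)" for z
  have c: "0 < c" using z by (auto simp: U_def)
  have Ubox: "U c = box (Complex (-1) (-c)) (Complex 1 c)"
    by (auto simp: U_def in_box_complex_iff)
  have oU: "open (U c)" and cU: "connected (U c)" unfolding Ubox by (auto intro: convex_connected convex_box)
  have "\<psi> z = 0"
  proof (rule analytic_continuation[where f=\<psi> and w=z and S="U c" and U="of_real ` {-1<..<1}" and \<xi>=0])
    have "(\<lambda>z. LINT x|lborel. F x z) holomorphic_on U c"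
      by (rule holomorphic_lebesgue_integral[OF oU hol _ dom D]) (use meas in auto)
    then show "\<psi> holomorphic_on U c" unfolding \<psi>_def by (intro holomorphic_intros)
    show "(of_real ` {-1<..<1}) \<subseteq> U c" "0 \<in> U c" using c by (auto simp: U_def)
    show "(0::complex) islimpt of_real ` {-1<..<1}"
      unfolding islimpt_approachable
    proof (intro allI impI)
      fix d :: real assume d: "0 < d"
      define a where "a = min (1/2) (d/2)"
      have "0 < a" "a < 1" "a < d" using d by (auto simp: a_def)
      then show "\<exists>x'\<in>complex_of_real ` {- 1<..<1}. x' \<noteq> 0 \<and> dist x' 0 < d"
        by (intro bexI[of _ "complex_of_real a"]) auto
    qed
    show "\<psi> v = 0" if "v \<in> of_real ` {-1<..<1}" for v
    proof -
      from that obtain a where a: "v = of_real a" "\<bar>a\<bar> < 1" by auto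
      have [measurable]: "(\<lambda>x. F x 0) \<in> borel_measurable borel" using c by (intro meas) (auto simp: U_def)
      have "(LINT x|lborel. F x v) = (LINT x|lborel. F (a *\<^sub>R e + x) 0)"
        using a shift by (simp add: add.commute)
      also have "\<dots> = (LINT x|distr lborel borel ((+) (a *\<^sub>R e)). F x 0)"
        by (subst integral_distr) auto
      also have "\<dots> = (LINT x|lborel. F x 0)" by (simp add: lborel_distr_plus)
      finally show ?thesis by (simp add: \<psi>_def)
    qed
  qed (use oU cU z in auto)
  then show ?thesis by (simp add: \<psi>_def)
qed

section \<open>Heat kernels and the Bessel kernel\<close>

lemma lborel_integral_affine:
  fixes f :: "'a::euclidean_space \<Rightarrow> 'b::{banach, second_countable_topology}"
  assumes [measurable]: "f \<in> borel_measurable borel" and c: "c \<noteq> 0"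
  shows "(LINT x|lborel. f x) = (\<bar>c\<bar> ^ DIM('a)) *\<^sub>R (LINT x|lborel. f (t + c *\<^sub>R x))"
  by (subst lborel_affine[OF c, of t]) (simp add: integral_density integral_distr)

definition gauss_mass :: "'a::euclidean_space itself \<Rightarrow> real" where
  "gauss_mass _ = (LINT x|(lborel :: 'a measure). exp (- (norm x)\<^sup>2))"

lemma integrable_gauss:
  assumes t: "0 < t"
  shows "integrable lborel (\<lambda>x::'a::euclidean_space. exp (- (t * (norm x)\<^sup>2)))"
proof (rule Bochner_Integration.integrable_bound)
  show "integrable lborel (\<lambda>x::'a. exp (1 / (4 * t)) * exp (- (1 * norm x)))"
    by (intro integrable_mult_right integrable_exp_norm) simp
  have "- (t * (norm x)\<^sup>2) \<le> 1 / (4 * t) - norm x" for x :: 'a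
  proof -
    have "0 \<le> (2 * t * norm x - 1)\<^sup>2 / (4 * t)" using t by simp
    also have "\<dots> = t * (norm x)\<^sup>2 - norm x + 1 / (4 * t)" using t by (simp add: field_simps power2_eq_square)
    finally show ?thesis by simp
  qed
  then show "AE x in lborel. norm (exp (- (t * (norm (x::'a))\<^sup>2))) \<le> norm (exp (1 / (4 * t)) * exp (- (1 * norm x)))"
    by (intro AE_I2) (simp add: exp_add[symmetric])
qed simp

lemma gauss_mass_pos: "0 < gauss_mass TYPE('a::euclidean_space)"
proof -
  have i: "integrable lborel (\<lambda>x::'a. exp (- (norm x)\<^sup>2))" using integrable_gauss[of 1] by simp
  have "gauss_mass TYPE('a) \<noteq> 0"
    unfolding gauss_mass_def using i
    using AE_iff_null_sets[of "UNIV :: 'a set" lborel]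
    by (subst integral_nonneg_eq_0_iff_AE) (auto simp: null_sets_def)
  moreover have "0 \<le> gauss_mass TYPE('a)"
    unfolding gauss_mass_def by (rule Bochner_Integration.integral_nonneg) simp
  ultimately show ?thesis by simp
qed

lemma integral_gauss:
  assumes t: "0 < t"
  shows "(LINT x|lborel. exp (- (t * (norm (x::'a::euclidean_space))\<^sup>2))) = gauss_mass TYPE('a) / t powr (DIM('a) / 2)"
proof -
  have "gauss_mass TYPE('a) = (\<bar>sqrt t\<bar> ^ DIM('a)) *\<^sub>R (LINT x|lborel. exp (- (norm (sqrt t *\<^sub>R x :: 'a))\<^sup>2))"
    unfolding gauss_mass_def using t lborel_integral_affine[of "\<lambda>x::'a. exp (- (norm x)\<^sup>2)" "sqrt t" 0] by simp
  also have "\<bar>sqrt t\<bar> ^ DIM('a) = t powr (DIM('a) / 2)"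
    using t by (simp add: powr_half_sqrt[symmetric] powr_realpow[symmetric] powr_powr)
  finally show ?thesis using t by (simp add: power_mult_distrib)
qed

lemma norm_shift_square:
  "(norm (x + a *\<^sub>R y))\<^sup>2 = (norm x)\<^sup>2 + 2 * a * (x \<bullet> y) + a\<^sup>2 * (norm y)\<^sup>2"
  unfolding power2_norm_eq_inner
  by (simp add: inner_add_left inner_add_right inner_commute[of y x] power2_eq_square algebra_simps)

lemma fourier_gauss:
  fixes \<xi> :: "'a::euclidean_space"
  assumes t: "0 < t"
  shows "(LINT x|lborel. of_real (exp (- (t * (norm x)\<^sup>2))) * exp (- (\<i> * of_real (x \<bullet> \<xi>))))
     = complex_of_real (exp (- ((norm \<xi>)\<^sup>2 / (4 * t))) * (gauss_mass TYPE('a) / t powr (DIM('a) / 2)))"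
proof -
  define c where "c = 1 / (2 * t) + 1"
  have c: "0 < c" unfolding c_def using t by (intro add_pos_pos) auto
  define F where "F x z = exp (- (of_real t * (of_real ((norm x)\<^sup>2) + 2 * z * of_real (x \<bullet> \<xi>) + z\<^sup>2 * of_real ((norm \<xi>)\<^sup>2))))"
    for x :: 'a and z :: complex
  define z0 where "z0 = \<i> / of_real (2 * t)"
  have nF: "norm (F x z) = exp (- (t * (norm (x + Re z *\<^sub>R \<xi>))\<^sup>2) + t * (Im z)\<^sup>2 * (norm \<xi>)\<^sup>2)" for x z
  proof -
    have "(norm (x + Re z *\<^sub>R \<xi>))\<^sup>2 = (norm x)\<^sup>2 + 2 * Re z * (x \<bullet> \<xi>) + (Re z)\<^sup>2 * (norm \<xi>)\<^sup>2"
      by (rule norm_shift_square)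
    then show ?thesis by (simp add: F_def algebra_simps Re_power2)
  qed
  have "(LINT x|lborel. F x z0) = (LINT x|lborel. F x 0)"
  proof (rule integral_complex_shift[where c=c and e=\<xi>])
    show "F x holomorphic_on S" for x S unfolding F_def by (intro holomorphic_intros)
    show "(\<lambda>x. F x z) \<in> borel_measurable borel" for z unfolding F_def by measurable
    show "integrable lborel (\<lambda>x::'a. exp (t * (norm \<xi>)\<^sup>2 * (1 + c\<^sup>2)) * exp (- (t / 2 * (norm x)\<^sup>2)))"
      using t by (intro integrable_mult_right integrable_gauss) simp
    show "norm (F x z) \<le> exp (t * (norm \<xi>)\<^sup>2 * (1 + c\<^sup>2)) * exp (- (t / 2 * (norm x)\<^sup>2))"
      if z: "z \<in> {z. \<bar>Re z\<bar> < 1 \<and> \<bar>Im z\<bar> < c}" for x z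
    proof -
      define y where "y = x + Re z *\<^sub>R \<xi>"
      have "norm x \<le> norm y + norm (Re z *\<^sub>R \<xi>)"
        unfolding y_def by (metis add_diff_cancel norm_triangle_ineq4)
      also have "norm (Re z *\<^sub>R \<xi>) \<le> norm \<xi>" using z by (simp add: mult_left_le_one_le)
      finally have "(norm x)\<^sup>2 \<le> (norm y + norm \<xi>)\<^sup>2" by (intro power_mono) auto
      also have "\<dots> \<le> 2 * (norm y)\<^sup>2 + 2 * (norm \<xi>)\<^sup>2"
        using sum_squares_bound[of "norm y" "norm \<xi>"] by (simp add: power2_sum)
      finally have 1: "t / 2 * (norm x)\<^sup>2 \<le> t * (norm y)\<^sup>2 + t * (norm \<xi>)\<^sup>2"
        using mult_left_mono[of _ _ "t / 2"] t by (fastforce simp: algebra_simps)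
      have "(Im z)\<^sup>2 \<le> c\<^sup>2" using z by (intro power2_le_iff_abs_le[THEN iffD2]) auto
      then have 2: "t * (Im z)\<^sup>2 * (norm \<xi>)\<^sup>2 \<le> t * c\<^sup>2 * (norm \<xi>)\<^sup>2"
        using t by (intro mult_right_mono mult_left_mono) auto
      have "- (t * (norm y)\<^sup>2) + t * (Im z)\<^sup>2 * (norm \<xi>)\<^sup>2 \<le> t * (norm \<xi>)\<^sup>2 * (1 + c\<^sup>2) + - (t / 2 * (norm x)\<^sup>2)"
        using 1 2 by (simp add: algebra_simps)
      then show ?thesis unfolding nF exp_add[symmetric] y_def[symmetric] by simp
    qed
    show "F x (of_real a) = F (x + a *\<^sub>R \<xi>) 0" for x a
    proof -
      have "(norm (x + a *\<^sub>R \<xi>))\<^sup>2 = (norm x)\<^sup>2 + 2 * a * (x \<bullet> \<xi>) + a\<^sup>2 * (norm \<xi>)\<^sup>2"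
        by (rule norm_shift_square)
      then show ?thesis by (simp add: F_def)
    qed
    show "z0 \<in> {z. \<bar>Re z\<bar> < 1 \<and> \<bar>Im z\<bar> < c}" using t by (simp add: z0_def c_def Im_divide_of_real Re_divide_of_real)
  qed
  moreover have "F x z0 = of_real (exp ((norm \<xi>)\<^sup>2 / (4 * t))) * (of_real (exp (- (t * (norm x)\<^sup>2))) * exp (- (\<i> * of_real (x \<bullet> \<xi>))))" for x
    unfolding F_def z0_def exp_of_real[symmetric] exp_add[symmetric]
    using t by (intro arg_cong[where f=exp]) (simp add: field_simps power2_eq_square)
  moreover have "F x 0 = of_real (exp (- (t * (norm x)\<^sup>2)))" for x
    unfolding F_def exp_of_real[symmetric] by simp
  ultimately have "of_real (exp ((norm \<xi>)\<^sup>2 / (4 * t))) * (LINT x|lborel. of_real (exp (- (t * (norm x)\<^sup>2))) * exp (- (\<i> * of_real (x \<bullet> \<xi>))))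
     = complex_of_real (gauss_mass TYPE('a) / t powr (DIM('a) / 2))"
    by (simp add: integral_gauss[OF t])
  then have "of_real (exp (- ((norm \<xi>)\<^sup>2 / (4 * t)))) * (of_real (exp ((norm \<xi>)\<^sup>2 / (4 * t))) * (LINT x|lborel. of_real (exp (- (t * (norm x)\<^sup>2))) * exp (- (\<i> * of_real (x \<bullet> \<xi>)))))
     = of_real (exp (- ((norm \<xi>)\<^sup>2 / (4 * t)))) * complex_of_real (gauss_mass TYPE('a) / t powr (DIM('a) / 2))"
    by simp
  then show ?thesis
    by (simp only: mult.assoc[symmetric] of_real_mult[symmetric] exp_add[symmetric]) simp
qed

text \<open>The normalising constants are kept as \<open>gauss_mass\<close>; their value
  \<open>\<pi> powr (d / 2)\<close> is never needed.\<close>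

definition heat :: "real \<Rightarrow> 'a::euclidean_space \<Rightarrow> real" where
  "heat t x = exp (- ((norm x)\<^sup>2 / (4 * t))) / (gauss_mass TYPE('a) * (4 * t) powr (DIM('a) / 2))"

definition inversion_const :: "'a::euclidean_space itself \<Rightarrow> real" where
  "inversion_const _ = 1 / ((gauss_mass TYPE('a))\<^sup>2 * 4 powr (DIM('a) / 2))"

lemma heat_nonneg [simp]: "0 \<le> heat t x"
  using gauss_mass_pos[where 'a='a] by (simp add: heat_def)

lemma heat_measurable [measurable]:
  assumes [measurable]: "f \<in> borel_measurable M" "g \<in> borel_measurable M"
  shows "(\<lambda>x. heat (f x) (g x)) \<in> borel_measurable M"
  unfolding heat_def by measurable

lemma integrable_heat: "0 < t \<Longrightarrow> integrable lborel (heat t)"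
  using integrable_gauss[of "1 / (4 * t)"] by (auto simp: heat_def[abs_def])

lemma fourier_heat:
  fixes \<xi> :: "'a::euclidean_space"
  assumes t: "0 < t"
  shows "(LINT x|lborel. of_real (heat t x) * exp (- (\<i> * of_real (x \<bullet> \<xi>)))) = complex_of_real (exp (- (t * (norm \<xi>)\<^sup>2)))"
proof -
  define m where "m = gauss_mass TYPE('a) * (4 * t) powr (DIM('a) / 2)"
  have m: "0 < m" using t gauss_mass_pos[where 'a='a] by (simp add: m_def)
  have "of_real (heat t x) * exp (- (\<i> * of_real (x \<bullet> \<xi>)))
     = complex_of_real (1 / m) * (of_real (exp (- (1 / (4 * t) * (norm x)\<^sup>2))) * exp (- (\<i> * of_real (x \<bullet> \<xi>))))" for x :: 'a
    by (simp add: heat_def m_def[symmetric])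
  then have "(LINT x|lborel. of_real (heat t x) * exp (- (\<i> * of_real (x \<bullet> \<xi>))))
     = complex_of_real (1 / m) * (LINT x|lborel. of_real (exp (- (1 / (4 * t) * (norm x)\<^sup>2))) * exp (- (\<i> * of_real (x \<bullet> \<xi>))))"
    by simp
  also have "\<dots> = complex_of_real (1 / m) * of_real (exp (- (t * (norm \<xi>)\<^sup>2)) * m)"
    using t by (subst fourier_gauss) (auto simp: m_def powr_divide field_simps)
  also have "\<dots> = of_real (exp (- (t * (norm \<xi>)\<^sup>2)))"
    unfolding of_real_mult[symmetric] using m by simp
  finally show ?thesis .
qed

lemma integral_heat:
  assumes t: "0 < t" shows "(LINT x|lborel. heat t (x::'a::euclidean_space)) = 1"
proof -
  have "complex_of_real (LINT x|lborel. heat t (x::'a)) = 1"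
    using fourier_heat[OF t, of "0::'a"] by simp
  then show ?thesis using of_real_eq_1_iff by blast
qed

lemma nn_integral_heat:
  assumes t: "0 < t" shows "(\<integral>\<^sup>+x. ennreal (heat t (x::'a::euclidean_space)) \<partial>lborel) = 1"
  using integral_heat[OF t, where 'a='a] by (subst nn_integral_eq_integral[OF integrable_heat[OF t]]) auto

lemma heat_inversion:
  fixes x :: "'a::euclidean_space"
  assumes t: "0 < t"
  shows "complex_of_real (heat t x) = of_real (inversion_const TYPE('a)) *
     (LINT \<xi>|lborel. exp (\<i> * of_real (x \<bullet> \<xi>)) * of_real (exp (- (t * (norm \<xi>)\<^sup>2))))"
proof -
  have "(LINT \<xi>|lborel. exp (\<i> * of_real (x \<bullet> \<xi>)) * of_real (exp (- (t * (norm \<xi>)\<^sup>2))))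
    = (LINT \<xi>|lborel. of_real (exp (- (t * (norm \<xi>)\<^sup>2))) * exp (- (\<i> * of_real (\<xi> \<bullet> (- x)))))"
    by (simp add: inner_commute mult.commute)
  also have "\<dots> = complex_of_real (exp (- ((norm x)\<^sup>2 / (4 * t))) * (gauss_mass TYPE('a) / t powr (DIM('a) / 2)))"
    by (subst fourier_gauss[OF t]) simp
  finally have *: "(LINT \<xi>|lborel. exp (\<i> * of_real (x \<bullet> \<xi>)) * of_real (exp (- (t * (norm \<xi>)\<^sup>2)))) = \<dots>" .
  define q where "q = (4::real) powr (DIM('a) / 2)"
  have "(4 * t) powr (DIM('a) / 2) = q * t powr (DIM('a) / 2)" "0 < q"
    using t by (simp_all add: powr_mult q_def)
  then have "heat t x = inversion_const TYPE('a) * (exp (- ((norm x)\<^sup>2 / (4 * t))) * (gauss_mass TYPE('a) / t powr (DIM('a) / 2)))"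
    using gauss_mass_pos[where 'a='a] t
    by (simp add: heat_def inversion_const_def q_def[symmetric] power2_eq_square)
  then show ?thesis unfolding * of_real_mult[symmetric] by simp
qed

lemma heat_bounded:
  fixes w :: "'a::euclidean_space \<Rightarrow> real"
  assumes Ap: "Ap_bound p w A" and A: "0 \<le> A" and p: "1 \<le> p"
    and w [measurable]: "w \<in> borel_measurable borel"
  shows "\<exists>C\<ge>0. \<forall>t>0. conv_bounded p w (\<lambda>x. ennreal (heat t x)) C"
proof -
  obtain C where C: "0 \<le> C" "\<And>\<delta>. 0 < \<delta> \<Longrightarrow> conv_bounded p w (\<lambda>x. ennreal (\<delta> ^ DIM('a) * exp (- (\<delta> * norm x)))) C"
    using exp_kernel_bounded[OF Ap A p w] by blast
  define a where "a = exp 1 / (gauss_mass TYPE('a) * 4 powr (DIM('a) / 2))"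
  have a: "0 \<le> a" using gauss_mass_pos[where 'a='a] by (simp add: a_def)
  have "conv_bounded p w (\<lambda>x. ennreal (heat t x)) (a powr p * C)" if t: "0 < t" for t
  proof (rule conv_bounded_mono)
    show "conv_bounded p w (\<lambda>x. ennreal a * ennreal ((1 / sqrt t) ^ DIM('a) * exp (- (1 / sqrt t * norm x)))) (a powr p * C)"
      using t a by (intro conv_bounded_cmult C w) auto
    show "ennreal (heat t x) \<le> ennreal a * ennreal ((1 / sqrt t) ^ DIM('a) * exp (- (1 / sqrt t * norm x)))" for x :: 'a
    proof -
      have "0 \<le> (norm x / (2 * sqrt t) - 1)\<^sup>2" by simp
      also have "\<dots> = (norm x)\<^sup>2 / (4 * t) - norm x / sqrt t + 1"
        using t by (simp add: power2_diff power_divide power_mult_distrib)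
      finally have "exp (- ((norm x)\<^sup>2 / (4 * t))) \<le> exp 1 * exp (- (1 / sqrt t * norm x))"
        by (simp add: exp_add[symmetric])
      then have "heat t x \<le> exp 1 * exp (- (1 / sqrt t * norm x)) / (gauss_mass TYPE('a) * (4 * t) powr (DIM('a) / 2))"
        using gauss_mass_pos[where 'a='a] unfolding heat_def by (intro divide_right_mono) auto
      also have "(4 * t) powr (DIM('a) / 2) = 4 powr (DIM('a) / 2) * sqrt t ^ DIM('a)"
        using t by (simp add: powr_mult powr_half_sqrt[symmetric] powr_realpow[symmetric] powr_powr)
      also have "exp 1 * exp (- (1 / sqrt t * norm x)) / (gauss_mass TYPE('a) * (4 powr (DIM('a) / 2) * sqrt t ^ DIM('a)))
         = a * ((1 / sqrt t) ^ DIM('a) * exp (- (1 / sqrt t * norm x)))"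
        by (simp add: a_def power_divide)
      finally show ?thesis using a t by (simp add: ennreal_mult[symmetric] ennreal_leI)
    qed
  qed (use p in auto)
  then show ?thesis using C by (intro exI[of _ "a powr p * C"]) auto
qed

definition bessel_measure :: "real \<Rightarrow> real measure" where
  "bessel_measure a = density lborel (\<lambda>t. ennreal (t powr (a / 2 - 1) * exp (- t) / Gamma (a / 2)) * indicator {0<..} t)"

lemma sets_bessel_measure [simp, measurable_cong]: "sets (bessel_measure a) = sets borel"
  and space_bessel_measure [simp]: "space (bessel_measure a) = UNIV"
  by (auto simp: bessel_measure_def)

lemma AE_bessel_measure_pos: "AE t in bessel_measure a. 0 < t"
  unfolding bessel_measure_def by (subst AE_density) (auto simp: indicator_def)

lemma bessel_measure_powr:
  assumes a: "0 < a" and b: "0 < a / 2 + b" and c: "-1 < c"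
  shows "(\<integral>\<^sup>+t. ennreal (t powr b * exp (- (c * t))) \<partial>bessel_measure a)
    = ennreal (Gamma (a / 2 + b) / Gamma (a / 2) * (1 + c) powr (- (a / 2) - b))"
proof -
  have G: "0 < Gamma (a / 2)" using a by (intro Gamma_real_pos) simp
  have "(\<integral>\<^sup>+t. ennreal (t powr b * exp (- (c * t))) \<partial>bessel_measure a)
    = (\<integral>\<^sup>+t. ennreal (1 / Gamma (a / 2)) * (ennreal (t powr ((a / 2 + b) - 1) * exp (- ((1 + c) * t))) * indicator {0<..} t) \<partial>lborel)"
    unfolding bessel_measure_def
  proof (subst nn_integral_density, simp, simp, intro nn_integral_cong)
    fix t :: real
    have "t powr (a / 2 - 1) * t powr b = t powr ((a / 2 + b) - 1)" by (simp add: powr_add[symmetric] algebra_simps)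
    moreover have "exp (- t) * exp (- (c * t)) = exp (- ((1 + c) * t))" by (simp add: exp_add[symmetric] algebra_simps)
    moreover have "u * v / g * (y * z) = 1 / g * ((u * y) * (v * z))" for u v g y z :: real
      by simp
    ultimately have "t powr (a / 2 - 1) * exp (- t) / Gamma (a / 2) * (t powr b * exp (- (c * t)))
        = 1 / Gamma (a / 2) * (t powr ((a / 2 + b) - 1) * exp (- ((1 + c) * t)))"
      by (simp only:)
    then show "ennreal (t powr (a / 2 - 1) * exp (- t) / Gamma (a / 2)) * indicator {0<..} t * ennreal (t powr b * exp (- (c * t)))
      = ennreal (1 / Gamma (a / 2)) * (ennreal (t powr ((a / 2 + b) - 1) * exp (- ((1 + c) * t))) * indicator {0<..} t)"
      using G by (cases "0 < t") (auto simp: ennreal_mult[symmetric])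
  qed
  also have "\<dots> = ennreal (1 / Gamma (a / 2)) * ennreal (Gamma (a / 2 + b) / (1 + c) powr (a / 2 + b))"
    using b c by (subst nn_integral_cmult) (auto simp: nn_integral_Gamma)
  also have "\<dots> = ennreal (Gamma (a / 2 + b) / Gamma (a / 2) * (1 + c) powr (- (a / 2) - b))"
  proof -
    have e: "- (a / 2) - b = - (a / 2 + b)" by simp
    have "1 / Gamma (a / 2) * (Gamma (a / 2 + b) / (1 + c) powr (a / 2 + b))
        = Gamma (a / 2 + b) / Gamma (a / 2) * (1 + c) powr (- (a / 2) - b)"
      unfolding e powr_minus_divide by simp
    moreover have "0 \<le> 1 / Gamma (a / 2)" using G by simp
    ultimately show ?thesis using ennreal_mult' by metis
  qed
  finally show ?thesis .
qed

lemma bessel_measure_exp: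
  assumes a: "0 < a" and c: "-1 < c"
  shows "(\<integral>\<^sup>+t. ennreal (exp (- (c * t))) \<partial>bessel_measure a) = ennreal ((1 + c) powr (- a / 2))"
proof -
  have "(\<integral>\<^sup>+t. ennreal (exp (- (c * t))) \<partial>bessel_measure a) = (\<integral>\<^sup>+t. ennreal (t powr 0 * exp (- (c * t))) \<partial>bessel_measure a)"
    using AE_bessel_measure_pos[of a] by (intro nn_integral_cong_AE) (auto elim!: eventually_mono)
  also have "\<dots> = ennreal (Gamma (a / 2 + 0) / Gamma (a / 2) * (1 + c) powr (- (a / 2) - 0))"
    using a c by (intro bessel_measure_powr) auto
  finally have "(\<integral>\<^sup>+t. ennreal (exp (- (c * t))) \<partial>bessel_measure a) = \<dots>" .
  moreover have "0 < Gamma (a / 2)" using a by (intro Gamma_real_pos) simp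
  ultimately show ?thesis by simp
qed

lemma emeasure_bessel_measure: "0 < a \<Longrightarrow> emeasure (bessel_measure a) UNIV = 1"
  using bessel_measure_exp[of a 0] by simp

lemma finite_bessel_measure: "0 < a \<Longrightarrow> finite_measure (bessel_measure a)"
  by standard (simp add: emeasure_bessel_measure)

definition bessel :: "real \<Rightarrow> 'a::euclidean_space \<Rightarrow> real" where
  "bessel a x = (LINT t|bessel_measure a. heat t x)"

lemma bessel_nonneg [simp]: "0 \<le> bessel a x"
  unfolding bessel_def by (rule Bochner_Integration.integral_nonneg) simp

lemma bessel_measurable [measurable]:
  assumes "0 < a" shows "bessel a \<in> borel_measurable borel"
proof -
  interpret finite_measure "bessel_measure a" using assms by (rule finite_bessel_measure)
  show ?thesis unfolding bessel_def[abs_def] by measurable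
qed

lemma bessel_le: "ennreal (bessel a x) \<le> (\<integral>\<^sup>+t. ennreal (heat t x) \<partial>bessel_measure a)"
proof -
  have "bessel a x = enn2real (\<integral>\<^sup>+t. ennreal (heat t x) \<partial>bessel_measure a)"
    unfolding bessel_def by (rule integral_eq_nn_integral) auto
  then show ?thesis by (simp add: ennreal_enn2real_if)
qed

lemma integrable_heat_bessel:
  assumes a: "0 < a"
  shows "integrable (bessel_measure a \<Otimes>\<^sub>M (lborel :: 'a::euclidean_space measure)) (\<lambda>(t, x). heat t x)"
proof -
  interpret finite_measure "bessel_measure a" using a by (rule finite_bessel_measure)
  have "(\<integral>\<^sup>+t. (\<integral>\<^sup>+x. ennreal (heat t (x::'a)) \<partial>lborel) \<partial>bessel_measure a) = (\<integral>\<^sup>+t. 1 \<partial>bessel_measure a)"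
    using AE_bessel_measure_pos[of a] by (intro nn_integral_cong_AE) (auto elim!: eventually_mono simp: nn_integral_heat)
  then have 1: "(\<integral>\<^sup>+t. (\<integral>\<^sup>+x. ennreal (heat t (x::'a)) \<partial>lborel) \<partial>bessel_measure a) = 1"
    by (simp add: emeasure_bessel_measure[OF a])
  show ?thesis
  proof (rule integrableI_bounded)
    have "(\<integral>\<^sup>+z. ennreal (norm (case z of (t, x) \<Rightarrow> heat t (x::'a))) \<partial>(bessel_measure a \<Otimes>\<^sub>M lborel))
       = (\<integral>\<^sup>+t. (\<integral>\<^sup>+x. ennreal (heat t (x::'a)) \<partial>lborel) \<partial>bessel_measure a)"
      by (subst lborel.nn_integral_fst[symmetric]) auto
    then show "(\<integral>\<^sup>+z. ennreal (norm (case z of (t, x) \<Rightarrow> heat t (x::'a))) \<partial>(bessel_measure a \<Otimes>\<^sub>M lborel)) < \<infinity>"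
      using 1 by simp
  qed measurable
qed

lemma integrable_bessel:
  assumes a: "0 < a" shows "integrable lborel (bessel a :: 'a::euclidean_space \<Rightarrow> real)"
proof -
  interpret N: finite_measure "bessel_measure a" using a by (rule finite_bessel_measure)
  interpret P: pair_sigma_finite "bessel_measure a" "lborel :: 'a measure" by standard
  show ?thesis unfolding bessel_def[abs_def] by (rule P.integrable_snd[OF integrable_heat_bessel[OF a]])
qed

lemma integral_bessel_measure_exp:
  fixes \<xi> :: "'a::euclidean_space"
  assumes a: "0 < a"
  shows "(LINT t|bessel_measure a. exp (- (t * (norm \<xi>)\<^sup>2))) = (1 + (norm \<xi>)\<^sup>2) powr (- a / 2)"
proof -
  have "-1 < (norm \<xi>)\<^sup>2" using zero_le_power2[of "norm \<xi>"] by linarith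
  from bessel_measure_exp[OF a this] show ?thesis
    by (subst integral_eq_nn_integral) (auto simp: mult.commute)
qed

lemma fourier_bessel:
  fixes \<xi> :: "'a::euclidean_space"
  assumes a: "0 < a"
  shows "(LINT x|lborel. of_real (bessel a x) * exp (- (\<i> * of_real (x \<bullet> \<xi>)))) = complex_of_real ((1 + (norm \<xi>)\<^sup>2) powr (- a / 2))"
proof -
  interpret N: finite_measure "bessel_measure a" using a by (rule finite_bessel_measure)
  interpret P: pair_sigma_finite "bessel_measure a" "lborel :: 'a measure" by standard
  let ?f = "\<lambda>t x. complex_of_real (heat t x) * exp (- (\<i> * of_real (x \<bullet> \<xi>)))"
  have "integrable (bessel_measure a \<Otimes>\<^sub>M (lborel :: 'a measure)) (\<lambda>(t, x). ?f t x)"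
    by (rule Bochner_Integration.integrable_bound[OF integrable_heat_bessel[OF a]])
       (auto simp: norm_mult)
  then have "(LINT x|lborel. LINT t|bessel_measure a. ?f t x) = (LINT t|bessel_measure a. LINT x|lborel. ?f t x)"
    by (rule P.Fubini_integral)
  also have "(LINT t|bessel_measure a. LINT x|lborel. ?f t x) = (LINT t|bessel_measure a. of_real (exp (- ((norm \<xi>)\<^sup>2 * t))))"
  proof (rule integral_cong_AE)
    show "AE t in bessel_measure a. (LINT x|lborel. ?f t x) = of_real (exp (- ((norm \<xi>)\<^sup>2 * t)))"
      using AE_bessel_measure_pos[of a] by eventually_elim (simp add: fourier_heat mult.commute)
  qed measurable
  also have "\<dots> = of_real (LINT t|bessel_measure a. exp (- ((norm \<xi>)\<^sup>2 * t)))" by simp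
  also have "(LINT t|bessel_measure a. exp (- ((norm \<xi>)\<^sup>2 * t))) = (1 + (norm \<xi>)\<^sup>2) powr (- a / 2)"
    using integral_bessel_measure_exp[OF a, of \<xi>] by (simp add: mult.commute)
  finally show ?thesis by (simp add: bessel_def)
qed

lemma bessel_inversion_integrable:
  assumes a: "real DIM('a::euclidean_space) < a"
  shows "integrable (bessel_measure a \<Otimes>\<^sub>M (lborel :: 'a measure)) (\<lambda>(t, \<xi>). exp (- (t * (norm \<xi>)\<^sup>2)))"
proof -
  have a0: "0 < a" using a by linarith
  interpret finite_measure "bessel_measure a" using a0 by (rule finite_bessel_measure)
  have m: "0 < gauss_mass TYPE('a)" by (rule gauss_mass_pos)
  show ?thesis
  proof (rule integrableI_bounded)
    have "(\<integral>\<^sup>+z. ennreal (norm (case z of (t, \<xi>) \<Rightarrow> exp (- (t * (norm (\<xi>::'a))\<^sup>2)))) \<partial>(bessel_measure a \<Otimes>\<^sub>M lborel))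
       = (\<integral>\<^sup>+t. (\<integral>\<^sup>+\<xi>. ennreal (exp (- (t * (norm (\<xi>::'a))\<^sup>2))) \<partial>lborel) \<partial>bessel_measure a)"
      by (subst lborel.nn_integral_fst[symmetric]) auto
    also have "\<dots> = (\<integral>\<^sup>+t. ennreal (gauss_mass TYPE('a)) * ennreal (t powr (- (DIM('a) / 2)) * exp (- (0 * t))) \<partial>bessel_measure a)"
    proof (rule nn_integral_cong_AE, use AE_bessel_measure_pos in eventually_elim)
      case (elim t)
      have "(\<integral>\<^sup>+\<xi>. ennreal (exp (- (t * (norm (\<xi>::'a))\<^sup>2))) \<partial>lborel) = ennreal (gauss_mass TYPE('a) / t powr (DIM('a) / 2))"
        using integral_gauss[OF elim, where 'a='a] by (subst nn_integral_eq_integral[OF integrable_gauss[OF elim]]) auto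
      also have "gauss_mass TYPE('a) / t powr (DIM('a) / 2) = gauss_mass TYPE('a) * (t powr (- (DIM('a) / 2)) * exp (- (0 * t)))"
        by (simp add: powr_minus_divide)
      also have "ennreal \<dots> = ennreal (gauss_mass TYPE('a)) * ennreal (t powr (- (DIM('a) / 2)) * exp (- (0 * t)))"
        by (rule ennreal_mult'[OF less_imp_le[OF m]])
      finally show ?case .
    qed
    also have "\<dots> < top"
      using a a0 by (subst nn_integral_cmult, simp, subst bessel_measure_powr) (auto simp: ennreal_mult_less_top)
    finally show "(\<integral>\<^sup>+z. ennreal (norm (case z of (t, \<xi>) \<Rightarrow> exp (- (t * (norm (\<xi>::'a))\<^sup>2)))) \<partial>(bessel_measure a \<Otimes>\<^sub>M lborel)) < \<infinity>"
      by simp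
  qed measurable
qed

lemma integrable_symbol:
  assumes a: "real DIM('a::euclidean_space) < a"
  shows "integrable lborel (\<lambda>\<xi>::'a. (1 + (norm \<xi>)\<^sup>2) powr (- a / 2))"
proof -
  have a0: "0 < a" using a by linarith
  interpret N: finite_measure "bessel_measure a" using a0 by (rule finite_bessel_measure)
  interpret P: pair_sigma_finite "bessel_measure a" "lborel :: 'a measure" by standard
  show ?thesis using P.integrable_snd[OF bessel_inversion_integrable[OF a]]
    by (simp add: integral_bessel_measure_exp[OF a0])
qed

lemma bessel_inversion:
  fixes x :: "'a::euclidean_space"
  assumes a: "real DIM('a) < a"
  shows "complex_of_real (bessel a x) = of_real (inversion_const TYPE('a)) *
     (LINT \<xi>|lborel. exp (\<i> * of_real (x \<bullet> \<xi>)) * of_real ((1 + (norm \<xi>)\<^sup>2) powr (- a / 2)))"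
proof -
  have a0: "0 < a" using a by linarith
  interpret N: finite_measure "bessel_measure a" using a0 by (rule finite_bessel_measure)
  interpret P: pair_sigma_finite "bessel_measure a" "lborel :: 'a measure" by standard
  let ?f = "\<lambda>t \<xi>. exp (\<i> * of_real (x \<bullet> \<xi>)) * complex_of_real (exp (- (t * (norm \<xi>)\<^sup>2)))"
  have "integrable (bessel_measure a \<Otimes>\<^sub>M (lborel :: 'a measure)) (\<lambda>(t, \<xi>). ?f t \<xi>)"
    by (rule Bochner_Integration.integrable_bound[OF bessel_inversion_integrable[OF a]])
       (auto simp: norm_mult)
  then have F: "(LINT \<xi>|lborel. LINT t|bessel_measure a. ?f t \<xi>) = (LINT t|bessel_measure a. LINT \<xi>|lborel. ?f t \<xi>)"
    by (rule P.Fubini_integral)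
  have "complex_of_real (bessel a x) = (LINT t|bessel_measure a. complex_of_real (heat t x))"
    by (simp add: bessel_def)
  also have "\<dots> = (LINT t|bessel_measure a. of_real (inversion_const TYPE('a)) * (LINT \<xi>|lborel. ?f t \<xi>))"
  proof (rule integral_cong_AE)
    show "AE t in bessel_measure a. complex_of_real (heat t x) = of_real (inversion_const TYPE('a)) * (LINT \<xi>|lborel. ?f t \<xi>)"
      using AE_bessel_measure_pos[of a] by eventually_elim (rule heat_inversion)
  qed measurable
  also have "\<dots> = of_real (inversion_const TYPE('a)) * (LINT t|bessel_measure a. LINT \<xi>|lborel. ?f t \<xi>)"
    by (rule integral_mult_right_zero)
  also have "(LINT t|bessel_measure a. LINT \<xi>|lborel. ?f t \<xi>) = (LINT \<xi>|lborel. LINT t|bessel_measure a. ?f t \<xi>)"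
    by (rule F[symmetric])
  also have "\<dots> = (LINT \<xi>|lborel. exp (\<i> * of_real (x \<bullet> \<xi>)) * of_real ((1 + (norm \<xi>)\<^sup>2) powr (- a / 2)))"
    by (simp only: integral_mult_right_zero integral_complex_of_real integral_bessel_measure_exp[OF a0])
  finally show ?thesis .
qed

lemma bessel_exp_moment:
  assumes a: "0 < a"
  shows "integrable lborel (\<lambda>x::'a::euclidean_space. bessel a x * exp (norm x / 2))"
proof (rule integrableI_bounded)
  note [measurable] = bessel_measurable[OF a]
  show "(\<lambda>x::'a. bessel a x * exp (norm x / 2)) \<in> borel_measurable lborel" by measurable
  interpret N: finite_measure "bessel_measure a" using a by (rule finite_bessel_measure)
  interpret P: pair_sigma_finite "bessel_measure a" "lborel :: 'a measure" by standard
  define K where "K = (2::real) powr (DIM('a) / 2)"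
  have m: "0 < gauss_mass TYPE('a)" by (rule gauss_mass_pos)
  have pt: "heat t x * exp (norm x / 2) \<le> K * exp (t / 2) * heat (2 * t) x" if t: "0 < t" for t and x :: 'a
  proof -
    have "0 \<le> (norm x - 2 * t)\<^sup>2 / (8 * t)" using t by simp
    also have "\<dots> = (norm x)\<^sup>2 / (8 * t) - norm x / 2 + t / 2" using t by (simp add: field_simps power2_eq_square)
    finally have "- ((norm x)\<^sup>2 / (4 * t)) + norm x / 2 \<le> t / 2 + - ((norm x)\<^sup>2 / (4 * (2 * t)))" by simp
    then have "exp (- ((norm x)\<^sup>2 / (4 * t))) * exp (norm x / 2) \<le> exp (t / 2) * exp (- ((norm x)\<^sup>2 / (4 * (2 * t))))"
      unfolding exp_add[symmetric] by simp
    then have "heat t x * exp (norm x / 2) \<le> exp (t / 2) * exp (- ((norm x)\<^sup>2 / (4 * (2 * t)))) / (gauss_mass TYPE('a) * (4 * t) powr (DIM('a) / 2))"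
      using m t unfolding heat_def by (simp add: divide_right_mono)
    also have "\<dots> = K * exp (t / 2) * heat (2 * t) x"
    proof -
      have "(4 * (2 * t)) powr (DIM('a) / 2) = K * (4 * t) powr (DIM('a) / 2)"
        using t unfolding K_def by (subst powr_mult[symmetric]) (auto simp: mult_ac)
      moreover have "0 < K" by (simp add: K_def)
      ultimately show ?thesis unfolding heat_def by simp
    qed
    finally show ?thesis .
  qed
  have "(\<integral>\<^sup>+x. ennreal (norm (bessel a x * exp (norm x / 2))) \<partial>(lborel :: 'a measure))
    \<le> (\<integral>\<^sup>+x. (\<integral>\<^sup>+t. ennreal (heat t x) \<partial>bessel_measure a) * ennreal (exp (norm x / 2)) \<partial>(lborel :: 'a measure))"
    by (intro nn_integral_mono) (simp add: ennreal_mult mult_right_mono bessel_le)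
  also have "\<dots> = (\<integral>\<^sup>+x. (\<integral>\<^sup>+t. ennreal (heat t x * exp (norm x / 2)) \<partial>bessel_measure a) \<partial>(lborel :: 'a measure))"
    by (simp add: nn_integral_multc ennreal_mult)
  also have "\<dots> = (\<integral>\<^sup>+t. (\<integral>\<^sup>+x. ennreal (heat t x * exp (norm x / 2)) \<partial>(lborel :: 'a measure)) \<partial>bessel_measure a)"
    by (rule P.Fubini') measurable
  also have "\<dots> \<le> (\<integral>\<^sup>+t. ennreal K * ennreal (exp (- (- (1/2) * t))) \<partial>bessel_measure a)"
  proof (rule nn_integral_mono_AE, use AE_bessel_measure_pos in eventually_elim)
    case (elim t)
    have "(\<integral>\<^sup>+x. ennreal (heat t x * exp (norm x / 2)) \<partial>(lborel :: 'a measure))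
      \<le> (\<integral>\<^sup>+x. ennreal (K * exp (t / 2)) * ennreal (heat (2 * t) x) \<partial>(lborel :: 'a measure))"
      using pt[OF elim] by (intro nn_integral_mono) (auto simp: K_def ennreal_mult[symmetric] intro!: ennreal_leI)
    also have "\<dots> = ennreal (K * exp (t / 2))"
      using elim by (simp add: nn_integral_cmult nn_integral_heat)
    finally show ?case by (simp add: K_def ennreal_mult)
  qed
  also have "\<dots> < top"
    using a by (subst nn_integral_cmult, simp, subst bessel_measure_exp) (auto simp: ennreal_mult_less_top)
  finally show "(\<integral>\<^sup>+x. ennreal (norm (bessel a x * exp (norm x / 2))) \<partial>(lborel :: 'a measure)) < \<infinity>" by simp
qed

lemma bessel_bounded:
  fixes w :: "'a::euclidean_space \<Rightarrow> real"
  assumes Ap: "Ap_bound p w A" and A: "0 \<le> A" and p: "1 \<le> p" and a: "0 < a"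
    and w [measurable]: "w \<in> borel_measurable borel"
  shows "\<exists>C\<ge>0. conv_bounded p w (\<lambda>x. ennreal (bessel a x)) C"
proof -
  note [measurable] = bessel_measurable[OF a]
  interpret N: finite_measure "bessel_measure a" using a by (rule finite_bessel_measure)
  obtain C where C: "0 \<le> C" "\<And>t. 0 < t \<Longrightarrow> conv_bounded p w (\<lambda>x. ennreal (heat t x)) C"
    using heat_bounded[OF Ap A p w] by blast
  define K where "K t x = (if 0 < t then ennreal (heat t x) else 0)" for t and x :: 'a
  have "conv_bounded p w (\<lambda>x. \<integral>\<^sup>+t. K t x \<partial>bessel_measure a) (1 powr p * C)"
  proof (rule conv_bounded_superposition)
    show "(\<lambda>(t, x). K t x) \<in> borel_measurable (bessel_measure a \<Otimes>\<^sub>M borel)" unfolding K_def by measurable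
    show "conv_bounded p w (K t) C" for t
      using C by (cases "0 < t") (auto simp: K_def[abs_def] conv_bounded_def econv_def)
  qed (use a p C w N.finite_measure_axioms emeasure_bessel_measure[OF a] in auto)
  moreover have "ennreal (bessel a x) \<le> (\<integral>\<^sup>+t. K t x \<partial>bessel_measure a)" for x
  proof -
    have "(\<integral>\<^sup>+t. K t x \<partial>bessel_measure a) = (\<integral>\<^sup>+t. ennreal (heat t x) \<partial>bessel_measure a)"
      using AE_bessel_measure_pos[of a] by (intro nn_integral_cong_AE) (auto elim!: eventually_mono simp: K_def)
    then show ?thesis using bessel_le[of a x] by simp
  qed
  ultimately have "conv_bounded p w (\<lambda>x. ennreal (bessel a x)) (1 powr p * C)"
    using p by (elim conv_bounded_mono) auto
  then show ?thesis using C by auto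
qed

section \<open>Uniqueness of the Fourier transform\<close>

lemma lborel_integral_reflect:
  fixes f :: "'a::euclidean_space \<Rightarrow> 'b::{banach, second_countable_topology}"
  assumes [measurable]: "f \<in> borel_measurable borel"
  shows "(LINT y|lborel. f (x - y)) = (LINT y|lborel. f y)"
  using lborel_integral_affine[of f "-1" x] by simp

lemma lborel_integral_translate:
  fixes f :: "'a::euclidean_space \<Rightarrow> 'b::{banach, second_countable_topology}"
  assumes [measurable]: "f \<in> borel_measurable borel"
  shows "(LINT y|lborel. f (y + x)) = (LINT y|lborel. f y)"
  using lborel_integral_affine[of f 1 x] by (simp add: add.commute)

lemma lborel_distr_reflect: "distr lborel borel (\<lambda>y. x - y) = (lborel :: 'a::euclidean_space measure)"
  by (subst (2) lborel_affine[of "-1" x]) (auto simp: density_1)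

lemma AE_lborel_reflect:
  assumes "AE y in (lborel :: 'a::euclidean_space measure). P y"
  shows "AE y in lborel. P (x - y)"
  by (rule AE_distrD[of "\<lambda>y. x - y" lborel borel P], simp, subst lborel_distr_reflect, rule assms)

abbreviation norm_integral ::
  "('a::euclidean_space \<Rightarrow> 'b::euclidean_space \<Rightarrow> 'c::real_normed_vector) \<Rightarrow> ennreal" where
  "norm_integral f \<equiv> (\<integral>\<^sup>+x. \<integral>\<^sup>+y. ennreal (norm (f x y)) \<partial>lborel \<partial>lborel)"

abbreviation fourier_integral :: "('a::euclidean_space \<Rightarrow> complex) \<Rightarrow> 'a \<Rightarrow> complex" where
  "fourier_integral u \<xi> \<equiv> (LINT x|lborel. u x * exp (- (\<i> * of_real (x \<bullet> \<xi>))))"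

lemma integrable_lborel_pair:
  fixes f :: "'a::euclidean_space \<Rightarrow> 'b::euclidean_space \<Rightarrow> 'c::{banach, second_countable_topology}"
  assumes [measurable]: "case_prod f \<in> borel_measurable (borel \<Otimes>\<^sub>M borel)"
    and fin: "norm_integral f < \<infinity>"
  shows "integrable (lborel \<Otimes>\<^sub>M lborel) (case_prod f)"
proof (rule integrableI_bounded)
  show "case_prod f \<in> borel_measurable (lborel \<Otimes>\<^sub>M lborel)" by measurable
  have "(\<integral>\<^sup>+z. ennreal (norm (case_prod f z)) \<partial>(lborel \<Otimes>\<^sub>M lborel)) = norm_integral f"
    by (subst lborel.nn_integral_fst[symmetric]) auto
  then show "(\<integral>\<^sup>+z. ennreal (norm (case_prod f z)) \<partial>(lborel \<Otimes>\<^sub>M lborel)) < \<infinity>" using fin by simp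
qed

lemma fubini_lborel:
  fixes f :: "'a::euclidean_space \<Rightarrow> 'b::euclidean_space \<Rightarrow> 'c::{banach, second_countable_topology}"
  assumes "case_prod f \<in> borel_measurable (borel \<Otimes>\<^sub>M borel)"
    and "norm_integral f < \<infinity>"
  shows "(LINT x|lborel. LINT y|lborel. f x y) = (LINT y|lborel. LINT x|lborel. f x y)"
  using lborel_pair.Fubini_integral[OF integrable_lborel_pair[OF assms]] by simp

lemma norm_exp_imaginary [simp]: "norm (exp (\<i> * complex_of_real a)) = 1" "norm (exp (- (\<i> * complex_of_real a))) = 1"
  by simp_all

lemma heat_convolution_eq_0:
  fixes u :: "'a::euclidean_space \<Rightarrow> complex"
  assumes u: "integrable lborel u" and F: "\<And>\<xi>. fourier_integral u \<xi> = 0"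
    and t: "0 < t"
  shows "(LINT y|lborel. u y * of_real (heat t (x - y))) = 0"
proof -
  have [measurable]: "u \<in> borel_measurable borel" using u by auto
  let ?e = "\<lambda>\<xi>::'a. complex_of_real (exp (- (t * (norm \<xi>)\<^sup>2)))"
  let ?g = "\<lambda>y \<xi>. u y * (exp (\<i> * of_real ((x - y) \<bullet> \<xi>)) * ?e \<xi>)"
  have fin: "norm_integral ?g < \<infinity>"
  proof -
    have "norm_integral ?g
      = (\<integral>\<^sup>+y. ennreal (norm (u y)) * (\<integral>\<^sup>+\<xi>. ennreal (exp (- (t * (norm (\<xi>::'a))\<^sup>2))) \<partial>lborel) \<partial>lborel)"
      by (simp add: norm_mult ennreal_mult nn_integral_cmult)
    also have "\<dots> = (\<integral>\<^sup>+y. ennreal (norm (u y)) \<partial>lborel) * (\<integral>\<^sup>+\<xi>. ennreal (exp (- (t * (norm (\<xi>::'a))\<^sup>2))) \<partial>lborel)"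
      by (simp add: nn_integral_multc)
    also have "\<dots> < top"
      using u integrable_gauss[OF t, where 'a='a] by (auto simp: integrable_iff_bounded ennreal_mult_less_top)
    finally show ?thesis by simp
  qed
  have "(LINT y|lborel. u y * of_real (heat t (x - y))) = of_real (inversion_const TYPE('a)) * (LINT y|lborel. LINT \<xi>|lborel. ?g y \<xi>)"
  proof -
    have "u y * of_real (heat t (x - y)) = of_real (inversion_const TYPE('a)) * (LINT \<xi>|lborel. ?g y \<xi>)" for y
      by (simp add: heat_inversion[OF t] mult.left_commute)
    then show ?thesis by (simp only: integral_mult_right_zero)
  qed
  also have "(LINT y|lborel. LINT \<xi>|lborel. ?g y \<xi>) = (LINT \<xi>|lborel. LINT y|lborel. ?g y \<xi>)"
    by (rule fubini_lborel) (use fin in simp_all)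
  also have "(LINT \<xi>|lborel. LINT y|lborel. ?g y \<xi>) = (LINT \<xi>|(lborel :: 'a measure). 0)"
  proof (intro Bochner_Integration.integral_cong refl)
    fix \<xi> :: 'a
    have "?g y \<xi> = exp (\<i> * of_real (x \<bullet> \<xi>)) * ?e \<xi> * (u y * exp (- (\<i> * of_real (y \<bullet> \<xi>))))" for y
      by (simp add: inner_diff_left exp_diff exp_minus right_diff_distrib divide_inverse)
    then show "(LINT y|lborel. ?g y \<xi>) = 0" using F[of \<xi>] by (simp only: integral_mult_right_zero) simp
  qed
  finally show ?thesis by simp
qed

lemma indicator_heat_tendsto:
  fixes a b y :: "'a::euclidean_space"
  assumes y: "y \<in> cbox a b \<longrightarrow> y \<in> box a b"
  shows "(\<lambda>n. LINT x|lborel. indicator (box a b) x * heat ((1 / real (Suc n))\<^sup>2) (x - y)) \<longlonglongrightarrow> indicator (box a b) y"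
proof -
  define s where "s n = 1 / real (Suc n)" for n
  have s: "0 < s n" for n by (simp add: s_def)
  have s0: "s \<longlonglongrightarrow> 0" unfolding s_def by (rule LIMSEQ_Suc[OF lim_1_over_n])
  have eq: "(LINT x|lborel. indicator (box a b) x * heat ((s n)\<^sup>2) (x - y)) = (LINT z|lborel. indicator (box a b) (y + s n *\<^sub>R z) * heat 1 z)" for n
  proof -
    have h: "s n ^ DIM('a) * heat ((s n)\<^sup>2) (s n *\<^sub>R z) = heat 1 z" for z :: 'a
    proof -
      have "(4 * (s n)\<^sup>2) powr (DIM('a) / 2) = 4 powr (DIM('a) / 2) * s n ^ DIM('a)"
      proof -
        have "(s n)\<^sup>2 powr (DIM('a) / 2) = (s n powr 2) powr (DIM('a) / 2)" using s[of n] by simp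
        also have "\<dots> = s n powr real DIM('a)" unfolding powr_powr by simp
        also have "\<dots> = s n ^ DIM('a)" using s[of n] by (simp add: powr_realpow)
        finally show ?thesis using s[of n] by (simp add: powr_mult)
      qed
      moreover have "(norm (s n *\<^sub>R z))\<^sup>2 / (4 * (s n)\<^sup>2) = (norm z)\<^sup>2 / 4"
        using s[of n] by (simp add: power_mult_distrib)
      ultimately show ?thesis using s[of n] by (simp add: heat_def)
    qed
    have "(LINT x|lborel. indicator (box a b) x * heat ((s n)\<^sup>2) (x - y))
      = \<bar>s n\<bar> ^ DIM('a) *\<^sub>R (LINT z|lborel. indicator (box a b) (y + s n *\<^sub>R z) * heat ((s n)\<^sup>2) ((y + s n *\<^sub>R z) - y))"
      using s[of n] by (intro lborel_integral_affine) auto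
    also have "\<dots> = s n ^ DIM('a) * (LINT z|lborel. indicator (box a b) (y + s n *\<^sub>R z) * heat ((s n)\<^sup>2) (s n *\<^sub>R z))"
      using s[of n] by simp
    also have "\<dots> = (LINT z|lborel. s n ^ DIM('a) * (indicator (box a b) (y + s n *\<^sub>R z) * heat ((s n)\<^sup>2) (s n *\<^sub>R z)))"
      by (rule integral_mult_right_zero[symmetric])
    also have "\<dots> = (LINT z|lborel. indicator (box a b) (y + s n *\<^sub>R z) * (s n ^ DIM('a) * heat ((s n)\<^sup>2) (s n *\<^sub>R z)))"
      by (intro Bochner_Integration.integral_cong refl mult.left_commute)
    finally show ?thesis by (simp only: h)
  qed
  have "(\<lambda>n. LINT z|lborel. indicator (box a b) (y + s n *\<^sub>R z) * heat 1 z) \<longlonglongrightarrow> (LINT z|lborel. indicator (box a b) y * heat 1 (z::'a))"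
  proof (rule integral_dominated_convergence)
    show "integrable lborel (heat 1 :: 'a \<Rightarrow> real)" by (rule integrable_heat) simp
    show "AE z in lborel. (\<lambda>n. indicator (box a b) (y + s n *\<^sub>R z) * heat 1 z) \<longlonglongrightarrow> indicator (box a b) y * heat 1 z"
    proof (rule AE_I2)
      fix z :: 'a
      have lim: "(\<lambda>n. y + s n *\<^sub>R z) \<longlonglongrightarrow> y" using s0 by (auto intro!: tendsto_eq_intros)
      have "eventually (\<lambda>n. indicator (box a b) (y + s n *\<^sub>R z) = (indicator (box a b) y :: real)) sequentially"
      proof (cases "y \<in> box a b")
        case True
        then have "eventually (\<lambda>n. y + s n *\<^sub>R z \<in> box a b) sequentially"
          using lim open_box topological_tendstoD by blast
        then show ?thesis by eventually_elim (use True in auto)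
      next
        case False
        then have "y \<in> - cbox a b" using y by auto
        then have "eventually (\<lambda>n. y + s n *\<^sub>R z \<in> - cbox a b) sequentially"
          using lim closed_cbox[of a b] topological_tendstoD by (metis open_Compl)
        then show ?thesis by eventually_elim (use False box_subset_cbox[of a b] in \<open>auto simp: indicator_def\<close>)
      qed
      then have "eventually (\<lambda>n. indicator (box a b) y * heat 1 z = indicator (box a b) (y + s n *\<^sub>R z) * heat 1 z) sequentially"
        by eventually_elim simp
      then show "(\<lambda>n. indicator (box a b) (y + s n *\<^sub>R z) * heat 1 z) \<longlonglongrightarrow> indicator (box a b) y * heat 1 z"
        by (rule Lim_transform_eventually[OF tendsto_const])
    qed
    show "AE z in lborel. norm (indicator (box a b) (y + s n *\<^sub>R z) * heat 1 z) \<le> heat 1 z" for n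
      by (intro AE_I2) (auto simp: indicator_def)
  qed measurable
  then show ?thesis unfolding eq[unfolded s_def] s_def by (simp add: integral_heat)
qed

lemma AE_box_boundary: "AE y in lborel. y \<in> cbox a b \<longrightarrow> y \<in> box a (b::'a::euclidean_space)"
proof -
  have "cbox a b - box a b \<in> null_sets lborel"
    using negligible_frontier_interval[of a b] by (simp add: negligible_iff_null_sets null_sets_completion_iff)
  then have "AE y in lborel. y \<notin> cbox a b - box a b" by (rule AE_not_in)
  then show ?thesis by eventually_elim auto
qed

lemma fourier_eq_0_imp_AE_eq_0:
  fixes u :: "'a::euclidean_space \<Rightarrow> complex"
  assumes u: "integrable lborel u" and F: "\<And>\<xi>. fourier_integral u \<xi> = 0"
  shows "AE x in lborel. u x = 0"
proof -
  have um [measurable]: "u \<in> borel_measurable borel" using u by auto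
  have box0: "(LINT x:box a b|lborel. u x) = 0" for a b :: 'a
  proof -
    define t where "t n = (1 / real (Suc n))\<^sup>2" for n
    have t: "0 < t n" for n by (simp add: t_def)
    define \<psi> where "\<psi> n y = (LINT x|lborel. indicator (box a b) x * heat (t n) (x - y))" for n and y :: 'a
    have [measurable]: "\<psi> n \<in> borel_measurable borel" for n
      unfolding \<psi>_def by (rule lborel.borel_measurable_lebesgue_integral) measurable
    have trans: "(\<integral>\<^sup>+x. ennreal (heat (t n) (x - y)) \<partial>lborel) = 1" for n and y :: 'a
      using lborel_nn_integral_translate[of "\<lambda>x. ennreal (heat (t n) x)" "- y"] nn_integral_heat[OF t, of n] by simp
    have \<psi>1: "\<bar>\<psi> n y\<bar> \<le> 1" for n y
    proof -
      have le: "(\<integral>\<^sup>+x. ennreal (norm (indicator (box a b) x * heat (t n) (x - y))) \<partial>lborel) \<le> 1"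
        unfolding trans[of n y, symmetric] by (intro nn_integral_mono) (auto simp: indicator_def)
      then have "integrable lborel (\<lambda>x. indicator (box a b) x * heat (t n) (x - y))"
        by (intro integrableI_bounded) (auto intro: le_less_trans)
      then have "ennreal (norm (\<psi> n y)) \<le> (\<integral>\<^sup>+x. ennreal (norm (indicator (box a b) x * heat (t n) (x - y))) \<partial>lborel)"
        unfolding \<psi>_def by (rule integral_norm_bound_ennreal)
      also note le
      finally show ?thesis by simp
    qed
    have zero: "(LINT y|lborel. u y * of_real (\<psi> n y)) = 0" for n
    proof -
      let ?g = "\<lambda>y x. indicator (box a b) x *\<^sub>R (u y * of_real (heat (t n) (x - y)))"
      have fin: "norm_integral ?g < \<infinity>"
      proof -
        have "norm_integral ?g
          \<le> (\<integral>\<^sup>+y. \<integral>\<^sup>+x. ennreal (norm (u y)) * ennreal (heat (t n) (x - y)) \<partial>lborel \<partial>lborel)"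
          by (intro nn_integral_mono) (auto simp: indicator_def norm_mult ennreal_mult)
        also have "\<dots> = (\<integral>\<^sup>+y. ennreal (norm (u y)) \<partial>lborel)" by (simp add: nn_integral_cmult trans)
        also have "\<dots> < \<infinity>" using u by (auto simp: integrable_iff_bounded)
        finally show ?thesis .
      qed
      have "(LINT y|lborel. u y * of_real (\<psi> n y)) = (LINT y|lborel. LINT x|lborel. ?g y x)"
      proof (intro Bochner_Integration.integral_cong refl)
        fix y
        have "u y * of_real (\<psi> n y) = u y * (LINT x|lborel. of_real (indicator (box a b) x * heat (t n) (x - y)))"
          unfolding \<psi>_def by (simp only: integral_complex_of_real)
        also have "\<dots> = (LINT x|lborel. u y * of_real (indicator (box a b) x * heat (t n) (x - y)))"
          by (rule integral_mult_right_zero[symmetric])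
        also have "\<dots> = (LINT x|lborel. ?g y x)"
          by (intro Bochner_Integration.integral_cong refl) (simp add: scaleR_conv_of_real)
        finally show "u y * of_real (\<psi> n y) = (LINT x|lborel. ?g y x)" .
      qed
      also have "\<dots> = (LINT x|lborel. LINT y|lborel. ?g y x)"
        by (rule fubini_lborel) (use fin in simp_all)
      also have "\<dots> = 0" by (simp add: heat_convolution_eq_0[OF u F t])
      finally show ?thesis .
    qed
    have "(\<lambda>n. LINT y|lborel. u y * of_real (\<psi> n y)) \<longlonglongrightarrow> (LINT y|lborel. u y * of_real (indicator (box a b) y))"
    proof (rule integral_dominated_convergence)
      show "integrable lborel (\<lambda>y. norm (u y))" using u by simp
      show "AE y in lborel. (\<lambda>n. u y * of_real (\<psi> n y)) \<longlonglongrightarrow> u y * of_real (indicator (box a b) y)"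
        using AE_box_boundary[of a b]
      proof eventually_elim
        case (elim y)
        have "(\<lambda>n. \<psi> n y) \<longlonglongrightarrow> indicator (box a b) y"
          unfolding \<psi>_def t_def by (rule indicator_heat_tendsto) (use elim in simp)
        then show ?case by (intro tendsto_intros)
      qed
      show "AE y in lborel. norm (u y * of_real (\<psi> n y)) \<le> norm (u y)" for n
        using \<psi>1[of n] by (intro AE_I2) (simp add: norm_mult mult_left_le)
    qed measurable
    then have "(LINT y|lborel. u y * of_real (indicator (box a b) y)) = 0" by (simp add: zero LIMSEQ_const_iff)
    then show ?thesis by (simp add: set_lebesgue_integral_def scaleR_conv_of_real mult.commute)
  qed
  have si: "set_integrable lborel A u" if "A \<in> sets borel" for A
    using u that by (auto simp: set_integrable_def intro!: integrable_mult_indicator)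
  have A0: "(LINT x:A|lborel. u x) = 0" if "A \<in> sets lborel" for A
  proof -
    have "Int_stable (range (\<lambda>(a, b). box a b :: 'a set))" by (auto simp: Int_stable_def box_Int_box)
    moreover have "range (\<lambda>(a, b). box a b :: 'a set) \<subseteq> Pow UNIV" by auto
    moreover have "A \<in> sigma_sets UNIV (range (\<lambda>(a, b). box a b))" using that unfolding sets_lborel borel_eq_box by simp
    ultimately show ?thesis
    proof (induction rule: sigma_sets_induct_disjoint)
      case (basic A) then show ?case using box0 by auto
    next
      case empty show ?case by (simp add: set_lebesgue_integral_def)
    next
      case (compl A)
      then have A: "A \<in> sets borel" by (simp add: borel_eq_box)
      have "(LINT x:UNIV|lborel. u x) = (LINT x:A|lborel. u x) + (LINT x:UNIV - A|lborel. u x)"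
        using set_integral_Un[of A "UNIV - A" lborel u] si[of A] si[of "UNIV - A"] A by auto
      moreover have "(LINT x:UNIV|lborel. u x) = 0" using F[of 0] by (simp add: set_lebesgue_integral_def)
      ultimately show ?case using compl by simp
    next
      case (union X)
      then have X: "X i \<in> sets borel" for i by (auto simp: borel_eq_box)
      have "(LINT x:(\<Union>i. X i)|lborel. u x) = (\<Sum>i. (LINT x:(X i)|lborel. u x))"
        using X si[of "\<Union>i. X i"] union(1) by (intro lebesgue_integral_countable_add) (auto simp: disjoint_family_on_def)
      then show ?case using union by simp
    qed
  qed
  have ui: "integrable lborel (\<lambda>x. indicat_real A x *\<^sub>R u x)" if "A \<in> sets lborel" for A
    using u that by (intro integrable_mult_indicator)
  have "(LINT x:A|lborel. Re (u x)) = Re (LINT x:A|lborel. u x)" "(LINT x:A|lborel. Im (u x)) = Im (LINT x:A|lborel. u x)"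
    if "A \<in> sets lborel" for A
    using integral_Re[OF ui[OF that]] integral_Im[OF ui[OF that]] by (simp_all add: set_lebesgue_integral_def)
  then have "(LINT x:A|lborel. Re (u x)) = (LINT x:A|lborel. 0)" "(LINT x:A|lborel. Im (u x)) = (LINT x:A|lborel. 0)"
    if "A \<in> sets lborel" for A
    using that A0 by (simp_all add: set_lebesgue_integral_def)
  then have "AE x in lborel. Re (u x) = 0" "AE x in lborel. Im (u x) = 0"
    using u by (auto intro!: density_unique_real)
  then show ?thesis by eventually_elim (simp add: complex_eq_iff)
qed

lemma fourier_eq_imp_AE_eq:
  fixes u v :: "'a::euclidean_space \<Rightarrow> complex"
  assumes u: "integrable lborel u" and v: "integrable lborel v"
    and F: "\<And>\<xi>. fourier_integral u \<xi> = fourier_integral v \<xi>"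
  shows "AE x in lborel. u x = v x"
proof -
  have i: "integrable lborel (\<lambda>x. g x * exp (- (\<i> * of_real (x \<bullet> \<xi>))))" if "integrable lborel g" for g :: "'a \<Rightarrow> complex" and \<xi>
    using that by (rule Bochner_Integration.integrable_bound) (use that in \<open>auto simp: norm_mult\<close>)
  have "AE x in lborel. u x - v x = 0"
    using F i[OF u] i[OF v] by (intro fourier_eq_0_imp_AE_eq_0) (auto simp: u v left_diff_distrib)
  then show ?thesis by eventually_elim simp
qed

lemma sum_Basis_inner_square: "(\<Sum>i\<in>Basis. (\<xi> \<bullet> i)\<^sup>2) = (norm (\<xi>::'a::euclidean_space))\<^sup>2"
  unfolding power2_norm_eq_inner by (subst euclidean_inner) (simp add: power2_eq_square)

lemma completion_ex_borel_measurable_complex: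
  fixes g :: "'a \<Rightarrow> complex"
  assumes "g \<in> borel_measurable (completion M)"
  shows "\<exists>g'\<in>borel_measurable M. AE x in M. g x = g' x"
proof -
  have "(\<lambda>x. Re (g x)) \<in> borel_measurable (completion M)" "(\<lambda>x. Im (g x)) \<in> borel_measurable (completion M)"
    using assms by measurable
  from this[THEN completion_ex_borel_measurable_real]
  obtain r i where [measurable]: "r \<in> borel_measurable M" "i \<in> borel_measurable M"
    and "AE x in M. Re (g x) = r x" "AE x in M. Im (g x) = i x"
    by blast
  from this(3,4) have "AE x in M. g x = of_real (r x) + \<i> * of_real (i x)"
    by eventually_elim (simp add: complex_eq_iff)
  then show ?thesis by (intro bexI[of _ "\<lambda>x. of_real (r x) + \<i> * of_real (i x)"]) auto
qed

lemma is_bessel_kernel_bessel: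
  assumes a: "0 < a"
  shows "is_bessel_kernel a (\<lambda>x::'a::euclidean_space. complex_of_real (bessel a x))"
proof -
  note [measurable] = bessel_measurable[OF a]
  have "integrable lebesgue (\<lambda>x::'a. complex_of_real (bessel a x))"
    using integrable_bessel[OF a] by (subst integrable_completion) auto
  then show ?thesis unfolding is_bessel_kernel_def
    by (auto simp: sum_Basis_inner_square integral_completion fourier_bessel[OF a])
qed

lemma bessel_kernel_AE:
  assumes a: "0 < a"
  shows "AE x in lborel. bessel_kernel a x = complex_of_real (bessel a (x::'a::euclidean_space))"
    and "bessel_kernel a \<in> borel_measurable (lebesgue :: 'a measure)"
proof -
  have k: "is_bessel_kernel a (bessel_kernel a :: 'a \<Rightarrow> complex)"
    unfolding bessel_kernel_def by (rule someI[of "is_bessel_kernel a", OF is_bessel_kernel_bessel[OF a]])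
  then have i: "integrable lebesgue (bessel_kernel a :: 'a \<Rightarrow> complex)" by (simp add: is_bessel_kernel_def)
  then show m: "bessel_kernel a \<in> borel_measurable (lebesgue :: 'a measure)" by auto
  then obtain G where G [measurable]: "G \<in> borel_measurable (lborel :: 'a measure)" and ae: "AE x in lborel. bessel_kernel a x = G x"
    using completion_ex_borel_measurable_complex by blast
  have ael: "AE x in lebesgue. bessel_kernel a x = G x" using ae by (simp add: AE_completion_iff)
  have Gl: "G \<in> borel_measurable lebesgue" using G by (rule measurable_completion)
  have "integrable lebesgue G" by (rule integrable_cong_AE_imp[OF i Gl]) (use ael in \<open>auto elim!: eventually_mono\<close>)
  then have Gi: "integrable lborel G" by (subst (asm) integrable_completion) auto
  have "AE x in lborel. G x = complex_of_real (bessel a x)"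
  proof (rule fourier_eq_imp_AE_eq[OF Gi])
    show "integrable lborel (\<lambda>x::'a. complex_of_real (bessel a x))" using integrable_bessel[OF a, where 'a='a] by simp
    fix \<xi> :: 'a
    have e: "(\<lambda>x. exp (- (\<i> * complex_of_real (x \<bullet> \<xi>)))) \<in> borel_measurable lebesgue" by (intro measurable_completion) simp
    have "fourier_integral G \<xi> = (LINT x|lebesgue. G x * exp (- (\<i> * of_real (x \<bullet> \<xi>))))"
      by (rule integral_completion[symmetric]) measurable
    also have "\<dots> = (LINT x|lebesgue. bessel_kernel a x * exp (- (\<i> * of_real (x \<bullet> \<xi>))))"
      using ael by (intro integral_cong_AE borel_measurable_times Gl m e) (auto elim!: eventually_mono)
    also have "\<dots> = complex_of_real ((1 + (norm \<xi>)\<^sup>2) powr (- a / 2))"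
      using k by (simp add: is_bessel_kernel_def sum_Basis_inner_square)
    finally show "fourier_integral G \<xi> = (LINT x|lborel. of_real (bessel a x) * exp (- (\<i> * of_real (x \<bullet> \<xi>))))"
      by (simp add: fourier_bessel[OF a])
  qed
  then show "AE x in lborel. bessel_kernel a x = complex_of_real (bessel a (x::'a))" using ae by eventually_elim simp
qed

lemma lebesgue_measurable_reflect: "(\<lambda>y. x - y) \<in> lebesgue \<rightarrow>\<^sub>M (lebesgue :: 'a::euclidean_space measure)"
proof -
  have "(\<lambda>y. x + (\<Sum>j\<in>Basis. ((-1) * (y \<bullet> j)) *\<^sub>R j)) \<in> lebesgue \<rightarrow>\<^sub>M (lebesgue :: 'a measure)"
    by (rule lebesgue_affine_measurable) simp
  moreover have "x + (\<Sum>j\<in>Basis. ((-1) * (y \<bullet> j)) *\<^sub>R j) = x - y" for y :: 'a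
    by (simp add: sum_negf euclidean_representation)
  ultimately show ?thesis by simp
qed

lemma bessel_potential_eq:
  fixes f f' :: "'a::euclidean_space \<Rightarrow> complex"
  assumes a: "0 < a" and f: "f \<in> borel_measurable lebesgue"
    and f' [measurable]: "f' \<in> borel_measurable borel" and ae: "AE x in lborel. f x = f' x"
  shows "bessel_potential a f x = (LINT y|lborel. of_real (bessel a (x - y)) * f' y)"
proof -
  note [measurable] = bessel_measurable[OF a]
  have km: "(\<lambda>y. bessel_kernel a (x - y)) \<in> borel_measurable (lebesgue :: 'a measure)"
    by (rule measurable_compose[OF lebesgue_measurable_reflect bessel_kernel_AE(2)[OF a]])
  have "AE y in lborel. bessel_kernel a (x - y) * f y = of_real (bessel a (x - y)) * f' y"
    using AE_lborel_reflect[OF bessel_kernel_AE(1)[OF a], of x] ae by eventually_elim simp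
  then have "AE y in lebesgue. bessel_kernel a (x - y) * f y = of_real (bessel a (x - y)) * f' y"
    by (simp add: AE_completion_iff)
  then have "bessel_potential a f x = (LINT y|lebesgue. of_real (bessel a (x - y)) * f' y)"
    unfolding bessel_potential_def
    by (intro integral_cong_AE borel_measurable_times km f measurable_completion) auto
  also have "\<dots> = (LINT y|lborel. of_real (bessel a (x - y)) * f' y)"
    by (rule integral_completion) measurable
  finally show ?thesis .
qed

section \<open>Convolution and the resolvent kernel\<close>

definition cconv :: "('a::euclidean_space \<Rightarrow> complex) \<Rightarrow> ('a \<Rightarrow> complex) \<Rightarrow> 'a \<Rightarrow> complex" where
  "cconv k f x = (LINT y|lborel. k (x - y) * f y)"

definition weighted_energy :: "real \<Rightarrow> ('a::euclidean_space \<Rightarrow> real) \<Rightarrow> ('a \<Rightarrow> complex) \<Rightarrow> ennreal" where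
  "weighted_energy p w f = (\<integral>\<^sup>+x. epow p (ennreal (norm (f x))) * ennreal (w x) \<partial>lborel)"

abbreviation enorm :: "('a \<Rightarrow> complex) \<Rightarrow> 'a \<Rightarrow> ennreal" where
  "enorm f \<equiv> \<lambda>x. ennreal (norm (f x))"

lemma cconv_measurable [measurable]:
  assumes [measurable]: "k \<in> borel_measurable borel" "f \<in> borel_measurable borel"
  shows "cconv k f \<in> borel_measurable borel"
  unfolding cconv_def by measurable

lemma enorm_cconv_le:
  assumes [measurable]: "k \<in> borel_measurable borel" "f \<in> borel_measurable borel"
  shows "ennreal (norm (cconv k f x)) \<le> econv (enorm k) (enorm f) x"
proof (cases "integrable lborel (\<lambda>y. k (x - y) * f y)")
  case True
  then show ?thesis unfolding cconv_def econv_def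
    by (rule order_trans[OF integral_norm_bound_ennreal]) (simp add: norm_mult ennreal_mult)
next
  case False
  then show ?thesis by (simp add: cconv_def not_integrable_integral_eq)
qed

lemma weighted_energy_cconv:
  assumes k [measurable]: "k \<in> borel_measurable borel" and f [measurable]: "f \<in> borel_measurable borel"
    and b: "conv_bounded p w (enorm k) C" and p: "1 \<le> p"
  shows "weighted_energy p w (cconv k f) \<le> ennreal C * weighted_energy p w f"
proof -
  have "weighted_energy p w (cconv k f) \<le> eenergy p w (econv (enorm k) (enorm f))"
    unfolding weighted_energy_def using p
    by (intro nn_integral_mono mult_right_mono epow_mono enorm_cconv_le) auto
  also have "\<dots> \<le> ennreal C * weighted_energy p w f"
    using b[unfolded conv_bounded_def, THEN conjunct2, THEN conjunct2, rule_format, of "enorm f"]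
    by (simp add: weighted_energy_def del: epow_ennreal)
  finally show ?thesis .
qed

lemma weighted_energy_add:
  assumes p: "1 \<le> p" and [measurable]: "f \<in> borel_measurable borel" "g \<in> borel_measurable borel" "w \<in> borel_measurable borel"
  shows "weighted_energy p w (\<lambda>x. f x + g x) \<le> ennreal (2 powr p) * (weighted_energy p w f + weighted_energy p w g)"
proof -
  have "weighted_energy p w (\<lambda>x. f x + g x)
    \<le> (\<integral>\<^sup>+x. ennreal (2 powr p) * (epow p (enorm f x) * ennreal (w x) + epow p (enorm g x) * ennreal (w x)) \<partial>lborel)"
    unfolding weighted_energy_def
  proof (intro nn_integral_mono)
    fix x
    have "epow p (ennreal (norm (f x + g x))) \<le> epow p (enorm f x + enorm g x)"
      using p norm_triangle_ineq[of "f x" "g x"] by (intro epow_mono) (auto simp flip: ennreal_plus)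
    also have "\<dots> \<le> ennreal (2 powr p) * (epow p (enorm f x) + epow p (enorm g x))"
      using p by (intro epow_add) simp
    finally have "epow p (ennreal (norm (f x + g x))) * ennreal (w x)
       \<le> ennreal (2 powr p) * (epow p (enorm f x) + epow p (enorm g x)) * ennreal (w x)"
      by (rule mult_right_mono) simp
    then show "epow p (ennreal (norm (f x + g x))) * ennreal (w x)
       \<le> ennreal (2 powr p) * (epow p (enorm f x) * ennreal (w x) + epow p (enorm g x) * ennreal (w x))"
      by (simp only: mult.assoc distrib_right)
  qed
  also have "\<dots> = ennreal (2 powr p) * (weighted_energy p w f + weighted_energy p w g)"
    unfolding weighted_energy_def by (subst nn_integral_cmult) (auto simp: nn_integral_add)
  finally show ?thesis .
qed

lemma weighted_energy_cmult:
  assumes [measurable]: "f \<in> borel_measurable borel" "w \<in> borel_measurable borel"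
  shows "weighted_energy p w (\<lambda>x. c * f x) = ennreal (norm c powr p) * weighted_energy p w f"
proof -
  have "epow p (ennreal (norm (c * f x))) = ennreal (norm c powr p) * epow p (enorm f x)" for x
    unfolding norm_mult by (subst ennreal_mult) (auto simp: epow_cmult simp del: epow_ennreal)
  then show ?thesis unfolding weighted_energy_def
    by (subst nn_integral_cmult[symmetric]) (auto simp: mult.assoc simp del: epow_ennreal)
qed

lemma weighted_energy_cong_AE:
  assumes "AE x in lborel. f x = g x"
  shows "weighted_energy p w f = weighted_energy p w g"
  unfolding weighted_energy_def using assms by (intro nn_integral_cong_AE) (auto elim!: eventually_mono)

lemma econv_finite_AE:
  assumes b: "conv_bounded p w k C" and f [measurable]: "f \<in> borel_measurable borel"
    and fin: "eenergy p w f < \<infinity>"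
    and [measurable]: "w \<in> borel_measurable borel" and pos: "\<And>x. 0 < w x"
  shows "AE x in lborel. econv k f x < \<infinity>"
proof -
  have [measurable]: "k \<in> borel_measurable borel" using b by (simp add: conv_bounded_def)
  have "eenergy p w (econv k f) \<le> ennreal C * eenergy p w f"
    using b by (simp add: conv_bounded_def)
  also have "\<dots> < \<infinity>" using fin by (simp add: ennreal_mult_less_top)
  finally have "AE x in lborel. epow p (econv k f x) * ennreal (w x) \<noteq> \<infinity>"
    by (intro nn_integral_PInf_AE) auto
  then show ?thesis
  proof eventually_elim
    case (elim x)
    have "econv k f x \<noteq> top"
    proof
      assume "econv k f x = top"
      then have "epow p (econv k f x) * ennreal (w x) = top"
        using pos[of x] by (simp add: ennreal_top_mult)
      then show False using elim by simp
    qed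
    then show ?case by (simp add: top.not_eq_extremum)
  qed
qed

lemma integrable_of_econv_finite:
  assumes [measurable]: "k \<in> borel_measurable borel" "f \<in> borel_measurable borel"
    and "econv (enorm k) (enorm f) x < \<infinity>"
  shows "integrable lborel (\<lambda>y. k (x - y) * f y)"
  using assms(3) unfolding econv_def by (intro integrableI_bounded) (auto simp: norm_mult ennreal_mult)

lemma cconv_assoc:
  assumes k [measurable]: "k \<in> borel_measurable borel" and l [measurable]: "l \<in> borel_measurable borel"
    and f [measurable]: "f \<in> borel_measurable borel"
    and fin: "econv (enorm k) (econv (enorm l) (enorm f)) x < \<infinity>"
  shows "cconv k (cconv l f) x = cconv (cconv k l) f x"
proof -
  let ?g = "\<lambda>y u. k (x - y) * (l (y - u) * f u)"
  have "(\<integral>\<^sup>+y. \<integral>\<^sup>+u. ennreal (norm (?g y u)) \<partial>lborel \<partial>lborel) = econv (enorm k) (econv (enorm l) (enorm f)) x"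
    unfolding econv_def by (simp add: norm_mult ennreal_mult nn_integral_cmult)
  then have fin': "(\<integral>\<^sup>+y. \<integral>\<^sup>+u. ennreal (norm (?g y u)) \<partial>lborel \<partial>lborel) < \<infinity>" using fin by simp
  have "cconv k (cconv l f) x = (LINT y|lborel. LINT u|lborel. ?g y u)"
    unfolding cconv_def by simp
  also have "\<dots> = (LINT u|lborel. LINT y|lborel. ?g y u)"
    by (rule fubini_lborel) (use fin' in simp_all)
  also have "\<dots> = cconv (cconv k l) f x"
    unfolding cconv_def
  proof (intro Bochner_Integration.integral_cong refl)
    fix u
    have "(LINT y|lborel. ?g y u) = (LINT y|lborel. k (x - y) * l (y - u)) * f u"
      by (simp add: mult.assoc flip: integral_mult_left_zero)
    also have "(LINT y|lborel. k (x - y) * l (y - u)) = (LINT y|lborel. k (x - (y + u)) * l ((y + u) - u))"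
      by (rule lborel_integral_translate[symmetric]) measurable
    finally show "(LINT y|lborel. ?g y u) = (LINT y|lborel. k (x - u - y) * l y) * f u"
      by (simp add: algebra_simps)
  qed
  finally show ?thesis .
qed

lemma cconv_cong_AE:
  assumes [measurable]: "k \<in> borel_measurable borel" "k' \<in> borel_measurable borel" "f \<in> borel_measurable borel"
    and ae: "AE x in lborel. k x = k' x"
  shows "cconv k f x = cconv k' f x"
  unfolding cconv_def using AE_lborel_reflect[OF ae, of x]
  by (intro integral_cong_AE) (auto elim!: eventually_mono)

lemma nn_integral_econv:
  assumes [measurable]: "k \<in> borel_measurable borel" "f \<in> borel_measurable borel"
  shows "(\<integral>\<^sup>+x. econv k f x \<partial>lborel) = (\<integral>\<^sup>+x. k x \<partial>lborel) * (\<integral>\<^sup>+x. f x \<partial>lborel)"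
proof -
  have "(\<integral>\<^sup>+x. econv k f x \<partial>lborel) = (\<integral>\<^sup>+y. \<integral>\<^sup>+x. k (x - y) * f y \<partial>lborel \<partial>lborel)"
    unfolding econv_def by (rule lborel_pair.Fubini') measurable
  also have "\<dots> = (\<integral>\<^sup>+y. (\<integral>\<^sup>+x. k x \<partial>lborel) * f y \<partial>lborel)"
    using lborel_nn_integral_translate[of k "- y" for y] by (simp add: nn_integral_multc)
  finally show ?thesis by (simp add: nn_integral_cmult)
qed

lemma integrable_cconv:
  assumes u: "integrable lborel u" and v: "integrable lborel v"
  shows "integrable lborel (cconv u v)"
proof (rule integrableI_bounded)
  have [measurable]: "u \<in> borel_measurable borel" "v \<in> borel_measurable borel" using u v by auto
  show "cconv u v \<in> borel_measurable lborel" by measurable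
  have "(\<integral>\<^sup>+x. ennreal (norm (cconv u v x)) \<partial>lborel) \<le> (\<integral>\<^sup>+x. econv (enorm u) (enorm v) x \<partial>lborel)"
    by (intro nn_integral_mono enorm_cconv_le) auto
  also have "\<dots> < \<infinity>" using u v by (simp add: nn_integral_econv ennreal_mult_less_top integrable_iff_bounded)
  finally show "(\<integral>\<^sup>+x. ennreal (norm (cconv u v x)) \<partial>lborel) < \<infinity>" .
qed

lemma fourier_cconv:
  fixes u v :: "'a::euclidean_space \<Rightarrow> complex"
  assumes u: "integrable lborel u" and v: "integrable lborel v"
  shows "fourier_integral (cconv u v) \<xi>
    = fourier_integral u \<xi> * fourier_integral v \<xi>"
proof -
  have [measurable]: "u \<in> borel_measurable borel" "v \<in> borel_measurable borel" using u v by auto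
  let ?e = "\<lambda>x::'a. exp (- (\<i> * complex_of_real (x \<bullet> \<xi>)))"
  let ?g = "\<lambda>x y. u (x - y) * v y * ?e x"
  have "norm_integral ?g = (\<integral>\<^sup>+x. econv (enorm u) (enorm v) x \<partial>lborel)"
    unfolding econv_def by (simp add: norm_mult ennreal_mult)
  also have "\<dots> < \<infinity>" using u v by (simp add: nn_integral_econv ennreal_mult_less_top integrable_iff_bounded)
  finally have fin: "norm_integral ?g < \<infinity>" .
  have "(LINT x|lborel. cconv u v x * ?e x) = (LINT x|lborel. LINT y|lborel. ?g x y)"
    unfolding cconv_def by simp
  also have "\<dots> = (LINT y|lborel. LINT x|lborel. ?g x y)"
    by (rule fubini_lborel) (use fin in simp_all)
  also have "\<dots> = (LINT y|lborel. (LINT x|lborel. u x * ?e x) * (v y * ?e y))"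
  proof (intro Bochner_Integration.integral_cong refl)
    fix y
    have "(LINT x|lborel. ?g x y) = (LINT x|lborel. ?g (x + y) y)"
      by (rule lborel_integral_translate[symmetric]) measurable
    also have "\<dots> = (LINT x|lborel. (u x * ?e x) * (v y * ?e y))"
      by (intro Bochner_Integration.integral_cong refl) (simp add: inner_add_left distrib_left mult_exp_exp)
    also have "\<dots> = (LINT x|lborel. u x * ?e x) * (v y * ?e y)" by (rule integral_mult_left_zero)
    finally show "(LINT x|lborel. ?g x y) = (LINT x|lborel. u x * ?e x) * (v y * ?e y)" .
  qed
  also have "\<dots> = (LINT x|lborel. u x * ?e x) * (LINT x|lborel. v x * ?e x)"
    by (rule integral_mult_right_zero)
  finally show ?thesis .
qed

abbreviation cbessel :: "real \<Rightarrow> 'a::euclidean_space \<Rightarrow> complex" where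
  "cbessel a \<equiv> \<lambda>x. complex_of_real (bessel a x)"

lemma bessel_semigroup:
  assumes a: "0 < a" and b: "0 < b"
  shows "AE x in lborel. cconv (cbessel a) (cbessel b) x = cbessel (a + b) (x::'a::euclidean_space)"
proof (rule fourier_eq_imp_AE_eq)
  have i: "integrable lborel (cbessel c :: 'a \<Rightarrow> complex)" if "0 < c" for c
    using integrable_bessel[OF that, where 'a='a] by simp
  show "integrable lborel (cconv (cbessel a) (cbessel b :: 'a \<Rightarrow> complex))" "integrable lborel (cbessel (a + b) :: 'a \<Rightarrow> complex)"
    using a b by (auto intro!: integrable_cconv i)
  fix \<xi> :: 'a
  have "- (a + b) / 2 = - a / 2 + - b / 2" by simp
  then have "(1 + (norm \<xi>)\<^sup>2) powr (- a / 2) * (1 + (norm \<xi>)\<^sup>2) powr (- b / 2) = (1 + (norm \<xi>)\<^sup>2) powr (- (a + b) / 2)"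
    by (simp only: powr_add)
  then show "fourier_integral (cconv (cbessel a) (cbessel b)) \<xi>
    = fourier_integral (cbessel (a + b)) \<xi>"
    using a b by (subst fourier_cconv) (auto simp: i fourier_bessel simp flip: of_real_mult)
qed

lemma powr_near_1:
  assumes "0 < e"
  shows "\<exists>d>0. \<forall>u::complex. norm u < d \<longrightarrow> norm ((1 + u) powr of_real \<alpha> - 1) < e"
proof -
  have "isCont (\<lambda>u::complex. (1 + u) powr of_real \<alpha>) 0"
    by (intro continuous_intros) auto
  then obtain d where "0 < d" "\<And>u::complex. norm u < d \<Longrightarrow> norm ((1 + u) powr of_real \<alpha> - 1) < e"
    using assms unfolding continuous_at_eps_delta by (auto simp: dist_norm)
  then show ?thesis by blast
qed

lemma unit_vector_along:
  fixes x :: "'a::euclidean_space"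
  shows "\<exists>e. norm e = 1 \<and> x \<bullet> e = norm x"
proof (cases "x = 0")
  case True
  obtain b :: 'a where "b \<in> Basis" using nonempty_Basis by blast
  then show ?thesis using True by (intro exI[of _ b]) simp
next
  case False
  then show ?thesis
    by (intro exI[of _ "x /\<^sub>R norm x"]) (simp add: power2_norm_eq_inner[symmetric] power2_eq_square)
qed

definition resolvent_symbol :: "complex \<Rightarrow> real \<Rightarrow> real \<Rightarrow> complex \<Rightarrow> complex" where
  "resolvent_symbol z \<gamma> a s = s powr of_real (- a / 2) / (z - s powr of_real (- \<gamma> / 2))"

lemma resolvent_symbol_strip:
  assumes \<gamma>: "0 < \<gamma>" and a: "0 < a" and z: "z \<notin> complex_of_real ` {0..1}"
  shows "\<exists>c K. 0 < c \<and> 0 \<le> K \<and> (\<forall>(\<xi>::'a::euclidean_space) e \<zeta>. norm e = 1 \<longrightarrow> \<bar>Re \<zeta>\<bar> < 1 \<longrightarrow> \<bar>Im \<zeta>\<bar> < c \<longrightarrow>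
    (let s = 1 + of_real ((norm \<xi>)\<^sup>2) + 2 * \<zeta> * of_real (\<xi> \<bullet> e) + \<zeta>\<^sup>2 in
      s \<notin> \<real>\<^sub>\<le>\<^sub>0 \<and> z - s powr of_real (- \<gamma> / 2) \<noteq> 0 \<and>
      norm (resolvent_symbol z \<gamma> a s) \<le> K * (1 + (norm \<xi>)\<^sup>2) powr (- a / 2)))"
proof -
  have "closed (complex_of_real ` {0..1})"
    by (intro compact_imp_closed compact_continuous_image continuous_intros) auto
  then obtain d where d: "0 < d" "\<And>\<tau>. 0 \<le> \<tau> \<Longrightarrow> \<tau> \<le> 1 \<Longrightarrow> d \<le> norm (z - complex_of_real \<tau>)"
    using separate_point_closed[of "complex_of_real ` {0..1}" z] z by (auto simp: dist_norm)
  obtain d1 where d1: "0 < d1" "\<And>u::complex. norm u < d1 \<Longrightarrow> norm ((1 + u) powr of_real (- \<gamma> / 2) - 1) < d / 2"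
    using powr_near_1[of "d / 2" "- \<gamma> / 2"] d by auto
  obtain d2 where d2: "0 < d2" "\<And>u::complex. norm u < d2 \<Longrightarrow> norm ((1 + u) powr of_real (- a / 2) - 1) < 1"
    using powr_near_1[of 1 "- a / 2"] by auto
  define c where "c = Min {1 / 2, d1 / 2, d2 / 2}"
  have c: "0 < c" "c \<le> 1 / 2" "2 * c \<le> d1" "2 * c \<le> d2" using d1 d2 by (auto simp: c_def)
  define K where "K = 4 / d * 3 powr (a / 2)"
  have K: "0 \<le> K" using d by (simp add: K_def)
  have main: "s \<notin> \<real>\<^sub>\<le>\<^sub>0 \<and> z - s powr of_real (- \<gamma> / 2) \<noteq> 0 \<and>
      norm (resolvent_symbol z \<gamma> a s) \<le> K * (1 + (norm \<xi>)\<^sup>2) powr (- a / 2)"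
    if e: "norm e = 1" and re: "\<bar>Re \<zeta>\<bar> < 1" and im: "\<bar>Im \<zeta>\<bar> < c"
      and s: "s = 1 + of_real ((norm \<xi>)\<^sup>2) + 2 * \<zeta> * of_real (\<xi> \<bullet> e) + \<zeta>\<^sup>2"
    for \<xi> e :: 'a and \<zeta> s :: complex
  proof -
    define b where "b = Im \<zeta>"
    define y where "y = \<xi> + Re \<zeta> *\<^sub>R e"
    define \<sigma> where "\<sigma> = 1 + (norm y)\<^sup>2"
    define u where "u = Complex (- b\<^sup>2) (2 * b * (y \<bullet> e)) / of_real \<sigma>"
    have \<sigma>1: "1 \<le> \<sigma>" by (simp add: \<sigma>_def)
    have ny: "(norm y)\<^sup>2 = (norm \<xi>)\<^sup>2 + 2 * Re \<zeta> * (\<xi> \<bullet> e) + (Re \<zeta>)\<^sup>2"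
      unfolding y_def norm_shift_square using e by simp
    have ye: "y \<bullet> e = \<xi> \<bullet> e + Re \<zeta>"
      using e by (simp add: y_def inner_add_left power2_norm_eq_inner[symmetric])
    have su: "s = of_real \<sigma> * (1 + u)"
    proof -
      have "s = of_real \<sigma> + Complex (- b\<^sup>2) (2 * b * (y \<bullet> e))"
        unfolding s \<sigma>_def ny ye b_def
        by (simp add: complex_eq_iff Re_power2 Im_power2 algebra_simps power2_eq_square)
      then show ?thesis using \<sigma>1 by (simp add: u_def distrib_left)
    qed
    have "norm u < 2 * c"
    proof -
      have "norm (Complex (- b\<^sup>2) (2 * b * (y \<bullet> e))) \<le> \<bar>- b\<^sup>2\<bar> + \<bar>2 * b * (y \<bullet> e)\<bar>"
        using cmod_le[of "Complex (- b\<^sup>2) (2 * b * (y \<bullet> e))"] by simp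
      also have "\<dots> = b\<^sup>2 + \<bar>b\<bar> * (2 * \<bar>y \<bullet> e\<bar>)" by (simp add: abs_mult)
      also have "2 * \<bar>y \<bullet> e\<bar> \<le> \<sigma>"
      proof -
        have "\<bar>y \<bullet> e\<bar> \<le> norm y" using Cauchy_Schwarz_ineq2[of y e] e by simp
        moreover have "2 * norm y \<le> \<sigma>" using sum_squares_bound[of "norm y" 1] by (simp add: \<sigma>_def)
        ultimately show ?thesis by linarith
      qed
      also have "b\<^sup>2 + \<bar>b\<bar> * \<sigma> \<le> \<bar>b\<bar> * \<sigma> + \<bar>b\<bar> * \<sigma>"
      proof -
        have "b\<^sup>2 = \<bar>b\<bar> * \<bar>b\<bar>" by (simp add: power2_eq_square)
        also have "\<dots> \<le> \<bar>b\<bar> * \<sigma>" using im c \<sigma>1 by (intro mult_left_mono) (auto simp: b_def)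
        finally show ?thesis by (simp add: mult.commute)
      qed
      finally have "norm (Complex (- b\<^sup>2) (2 * b * (y \<bullet> e))) \<le> 2 * \<bar>b\<bar> * \<sigma>"
        by (simp add: mult_left_mono mult.assoc mult.commute[of \<sigma>])
      then have "norm u \<le> 2 * \<bar>b\<bar>" using \<sigma>1 by (simp add: u_def norm_divide divide_le_eq)
      then show ?thesis using im by (simp add: b_def)
    qed
    then have u1: "norm u < 1" and ud1: "norm u < d1" and ud2: "norm u < d2" using c by auto
    have "\<bar>Re u\<bar> < 1" using u1 abs_Re_le_cmod[of u] by linarith
    then have "0 < Re s" using \<sigma>1 unfolding su by simp
    then have s_nonpos: "s \<notin> \<real>\<^sub>\<le>\<^sub>0" by (auto simp: complex_nonpos_Reals_iff)
    have sp: "s powr of_real \<alpha> = of_real (\<sigma> powr \<alpha>) * (1 + u) powr of_real \<alpha>" for \<alpha>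
      unfolding su using \<sigma>1 by (subst powr_times_real_left) (auto simp: powr_of_real)
    have "d / 2 \<le> norm (z - s powr of_real (- \<gamma> / 2))"
    proof -
      define \<tau> where "\<tau> = \<sigma> powr (- \<gamma> / 2)"
      have \<tau>: "0 \<le> \<tau>" "\<tau> \<le> 1" using powr_mono[of "- \<gamma> / 2" 0 \<sigma>] \<sigma>1 \<gamma> by (auto simp: \<tau>_def)
      have "d \<le> norm (z - of_real \<tau>)" using \<tau> by (rule d)
      also have "z - of_real \<tau> = (z - s powr of_real (- \<gamma> / 2)) + of_real \<tau> * ((1 + u) powr of_real (- \<gamma> / 2) - 1)"
        unfolding sp \<tau>_def by (simp add: algebra_simps)
      also have "norm \<dots> \<le> norm (z - s powr of_real (- \<gamma> / 2)) + \<tau> * norm ((1 + u) powr of_real (- \<gamma> / 2) - 1)"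
        using \<tau> by (intro order_trans[OF norm_triangle_ineq]) (simp add: norm_mult)
      also have "\<tau> * norm ((1 + u) powr of_real (- \<gamma> / 2) - 1) \<le> 1 * (d / 2)"
        using \<tau> d1(2)[OF ud1] by (intro mult_mono) auto
      finally show ?thesis by simp
    qed
    moreover have "norm (s powr of_real (- a / 2)) \<le> 2 * \<sigma> powr (- a / 2)"
    proof -
      have "norm ((1 + u) powr of_real (- a / 2)) \<le> norm ((1 + u) powr of_real (- a / 2) - 1) + norm (1::complex)"
        using norm_triangle_ineq[of "(1 + u) powr of_real (- a / 2) - 1" 1] by simp
      also have "\<dots> \<le> 2" using d2(2)[OF ud2] by simp
      finally have "norm ((1 + u) powr of_real (- a / 2)) \<le> 2" .
      from mult_left_mono[OF this, of "\<sigma> powr (- a / 2)"] show ?thesis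
        unfolding sp norm_mult by (simp add: mult.commute)
    qed
    ultimately have "norm (resolvent_symbol z \<gamma> a s) \<le> (2 * \<sigma> powr (- a / 2)) / (d / 2)"
      using d unfolding resolvent_symbol_def norm_divide by (intro frac_le) auto
    also have "\<dots> = 4 / d * \<sigma> powr (- a / 2)" by simp
    also have "\<sigma> powr (- a / 2) \<le> 3 powr (a / 2) * (1 + (norm \<xi>)\<^sup>2) powr (- a / 2)"
    proof -
      have "norm \<xi> \<le> norm y + norm (Re \<zeta> *\<^sub>R e)"
        unfolding y_def by (metis add_diff_cancel norm_triangle_ineq4)
      then have "norm \<xi> \<le> norm y + 1" using re e by simp
      then have "(norm \<xi>)\<^sup>2 \<le> (norm y + 1)\<^sup>2" by (intro power_mono) auto
      also have "\<dots> \<le> 2 * (norm y)\<^sup>2 + 2" using sum_squares_bound[of "norm y" 1] by (simp add: power2_sum)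
      finally have "(norm \<xi>)\<^sup>2 \<le> 2 * (norm y)\<^sup>2 + 2" .
      moreover have third: "(1 + X) / 3 \<le> 1 + Y" if "X \<le> 2 * Y + 2" "0 \<le> Y" for X Y :: real
        using that by simp
      ultimately have "(1 + (norm \<xi>)\<^sup>2) / 3 \<le> \<sigma>" unfolding \<sigma>_def by (intro third zero_le_power2)
      then have "\<sigma> powr (- a / 2) \<le> ((1 + (norm \<xi>)\<^sup>2) / 3) powr (- a / 2)"
        using a by (intro powr_mono2') (auto intro: add_pos_nonneg)
      also have "\<dots> = 3 powr (a / 2) * (1 + (norm \<xi>)\<^sup>2) powr (- a / 2)"
        by (simp add: powr_divide powr_minus_divide)
      finally show ?thesis .
    qed
    finally have "norm (resolvent_symbol z \<gamma> a s) \<le> K * (1 + (norm \<xi>)\<^sup>2) powr (- a / 2)"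
      using d by (simp add: K_def mult.assoc mult_left_mono divide_right_mono)
    moreover have "z - s powr of_real (- \<gamma> / 2) \<noteq> 0"
      using \<open>d / 2 \<le> norm (z - s powr of_real (- \<gamma> / 2))\<close> d(1) by auto
    ultimately show ?thesis using s_nonpos by blast
  qed
  show ?thesis unfolding Let_def using c(1) K main by blast
qed

lemma resolvent_kernel:
  assumes \<gamma>: "0 < \<gamma>" and a: "real DIM('a::euclidean_space) < a" and z: "z \<notin> complex_of_real ` {0..1}"
  shows "\<exists>R::'a \<Rightarrow> complex. R \<in> borel_measurable borel \<and>
    (\<exists>C\<ge>0. \<exists>\<eta>>0. \<forall>x. norm (R x) \<le> C * exp (- (\<eta> * norm x))) \<and>
    (\<forall>x. z * R x - cconv R (cbessel \<gamma>) x = cbessel a x)"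
proof -
  have a0: "0 < a" using a by linarith
  define \<mu> where "\<mu> b \<xi> = (1 + (norm \<xi>)\<^sup>2) powr (- b / 2)" for b and \<xi> :: 'a
  define \<kappa> where "\<kappa> = complex_of_real (inversion_const TYPE('a))"
  define S where "S \<xi> e \<zeta> = 1 + of_real ((norm \<xi>)\<^sup>2) + 2 * \<zeta> * of_real (\<xi> \<bullet> e) + \<zeta>\<^sup>2" for \<xi> e :: 'a and \<zeta> :: complex
  have [measurable]: "\<mu> b \<in> borel_measurable borel" for b unfolding \<mu>_def by measurable
  obtain c K where c: "0 < c" and K: "0 \<le> K"
    and nonpos: "\<And>\<xi> e \<zeta>. norm e = 1 \<Longrightarrow> \<bar>Re \<zeta>\<bar> < 1 \<Longrightarrow> \<bar>Im \<zeta>\<bar> < c \<Longrightarrow> S \<xi> e \<zeta> \<notin> \<real>\<^sub>\<le>\<^sub>0"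
    and nz: "\<And>\<xi> e \<zeta>. norm e = 1 \<Longrightarrow> \<bar>Re \<zeta>\<bar> < 1 \<Longrightarrow> \<bar>Im \<zeta>\<bar> < c \<Longrightarrow> z - S \<xi> e \<zeta> powr of_real (- \<gamma> / 2) \<noteq> 0"
    and bound: "\<And>\<xi> e \<zeta>. norm e = 1 \<Longrightarrow> \<bar>Re \<zeta>\<bar> < 1 \<Longrightarrow> \<bar>Im \<zeta>\<bar> < c \<Longrightarrow> norm (resolvent_symbol z \<gamma> a (S \<xi> e \<zeta>)) \<le> K * \<mu> a \<xi>"
    using resolvent_symbol_strip[OF \<gamma> a0 z, where 'a='a] unfolding Let_def S_def \<mu>_def by blast
  define r where "r \<xi> = complex_of_real (\<mu> a \<xi>) / (z - of_real (\<mu> \<gamma> \<xi>))" for \<xi> :: 'a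
  have [measurable]: "r \<in> borel_measurable borel" unfolding r_def by measurable
  have rsym: "resolvent_symbol z \<gamma> a (of_real (1 + (norm \<xi>)\<^sup>2)) = r \<xi>" for \<xi> :: 'a
    unfolding resolvent_symbol_def r_def \<mu>_def by (subst (1 2) powr_of_real) auto
  obtain e0 :: 'a where e0: "norm e0 = 1" using unit_vector_along by blast
  have S0: "S \<xi> e 0 = of_real (1 + (norm \<xi>)\<^sup>2)" for \<xi> e by (simp add: S_def)
  have r_bound: "norm (r \<xi>) \<le> K * \<mu> a \<xi>" for \<xi>
    using bound[OF e0, of 0 \<xi>] c by (simp only: S0 rsym) simp
  have \<mu>i: "integrable lborel (\<mu> a)" unfolding \<mu>_def using integrable_symbol[OF a] .
  have ri: "integrable lborel r"
    by (rule Bochner_Integration.integrable_bound[of _ "\<lambda>\<xi>. K * \<mu> a \<xi>"])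
       (use \<mu>i in \<open>auto intro!: AE_I2 order_trans[OF r_bound]\<close>)
  define R where "R x = \<kappa> * (LINT \<xi>|lborel. exp (\<i> * of_real (x \<bullet> \<xi>)) * r \<xi>)" for x :: 'a
  have [measurable]: "R \<in> borel_measurable borel" unfolding R_def by measurable
  have decay: "norm (R x) \<le> norm \<kappa> * (LINT \<xi>|lborel. K * \<mu> a \<xi>) * exp (- (c / 2 * norm x))" for x
  proof -
    obtain e where e: "norm e = 1" "x \<bullet> e = norm x" using unit_vector_along by blast
    define F where "F \<xi> \<zeta> = exp (\<i> * (of_real (x \<bullet> \<xi>) + \<zeta> * of_real (norm x))) * resolvent_symbol z \<gamma> a (S \<xi> e \<zeta>)" for \<xi> and \<zeta> :: complex
    define \<zeta>0 where "\<zeta>0 = \<i> * of_real (c / 2)"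
    let ?U = "{\<zeta>. \<bar>Re \<zeta>\<bar> < 1 \<and> \<bar>Im \<zeta>\<bar> < c}"
    have nF: "norm (F \<xi> \<zeta>) \<le> exp (- (Im \<zeta> * norm x)) * (K * \<mu> a \<xi>)" if "\<zeta> \<in> ?U" for \<xi> \<zeta>
      unfolding F_def norm_mult using bound[OF e(1), of \<zeta> \<xi>] that
      by (intro mult_mono) (auto simp: norm_exp_eq_Re)
    have \<zeta>0: "\<zeta>0 \<in> ?U" using c by (simp add: \<zeta>0_def)
    have meas: "(\<lambda>\<xi>. F \<xi> \<zeta>) \<in> borel_measurable borel" for \<zeta>
      unfolding F_def S_def resolvent_symbol_def by measurable
    have "(LINT \<xi>|lborel. F \<xi> \<zeta>0) = (LINT \<xi>|lborel. F \<xi> 0)"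
    proof (rule integral_complex_shift[where c=c and e=e, OF _ meas])
      show "F \<xi> holomorphic_on ?U" for \<xi>
      proof -
        have hS: "S \<xi> e holomorphic_on ?U" unfolding S_def by (intro holomorphic_intros)
        show ?thesis unfolding F_def resolvent_symbol_def
          by (intro holomorphic_intros hS) (use nonpos nz e in auto)
      qed
      show "integrable lborel (\<lambda>\<xi>. exp (c * norm x) * (K * \<mu> a \<xi>))" using \<mu>i by simp
      show "norm (F \<xi> \<zeta>) \<le> exp (c * norm x) * (K * \<mu> a \<xi>)" if "\<zeta> \<in> ?U" for \<xi> \<zeta>
      proof -
        have "- (Im \<zeta> * norm x) \<le> c * norm x"
          using that mult_right_mono[of "- Im \<zeta>" c "norm x"] by auto
        then have "exp (- (Im \<zeta> * norm x)) * (K * \<mu> a \<xi>) \<le> exp (c * norm x) * (K * \<mu> a \<xi>)"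
          using K by (intro mult_right_mono) (auto simp: \<mu>_def)
        then show ?thesis using nF[OF that, of \<xi>] by linarith
      qed
      show "F \<xi> (of_real t) = F (\<xi> + t *\<^sub>R e) 0" for \<xi> t
      proof -
        have "S \<xi> e (of_real t) = S (\<xi> + t *\<^sub>R e) e 0"
          unfolding S0 norm_shift_square using e by (simp add: S_def)
        then show ?thesis using e by (simp add: F_def inner_add_right)
      qed
    qed (use \<zeta>0 in auto)
    also have "(LINT \<xi>|lborel. F \<xi> 0) = (LINT \<xi>|lborel. exp (\<i> * of_real (x \<bullet> \<xi>)) * r \<xi>)"
      unfolding F_def S0 rsym by simp
    finally have "R x = \<kappa> * (LINT \<xi>|lborel. F \<xi> \<zeta>0)" by (simp add: R_def)
    moreover have "norm (LINT \<xi>|lborel. F \<xi> \<zeta>0) \<le> (LINT \<xi>|lborel. exp (- (c / 2 * norm x)) * (K * \<mu> a \<xi>))"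
    proof (rule order_trans[OF integral_norm_bound integral_mono])
      show i: "integrable lborel (\<lambda>\<xi>. exp (- (c / 2 * norm x)) * (K * \<mu> a \<xi>))" using \<mu>i by simp
      show "norm (F \<xi> \<zeta>0) \<le> exp (- (c / 2 * norm x)) * (K * \<mu> a \<xi>)" for \<xi>
        using nF[OF \<zeta>0, of \<xi>] by (simp add: \<zeta>0_def)
      then have "integrable lborel (\<lambda>\<xi>. F \<xi> \<zeta>0)"
        by (intro Bochner_Integration.integrable_bound[OF i]) (use meas in \<open>auto intro!: AE_I2 intro: order_trans[OF _ abs_ge_self]\<close>)
      then show "integrable lborel (\<lambda>\<xi>. norm (F \<xi> \<zeta>0))" by simp
    qed
    ultimately have "norm (R x) \<le> norm \<kappa> * (LINT \<xi>|lborel. exp (- (c / 2 * norm x)) * (K * \<mu> a \<xi>))"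
      unfolding norm_mult by (simp add: norm_mult mult_left_mono)
    also have "(LINT \<xi>|lborel. exp (- (c / 2 * norm x)) * (K * \<mu> a \<xi>)) = exp (- (c / 2 * norm x)) * (LINT \<xi>|lborel. K * \<mu> a \<xi>)"
      by (rule integral_mult_right_zero)
    finally show ?thesis by (simp only: mult_ac)
  qed
  have identity: "z * R x - cconv R (cbessel \<gamma>) x = cbessel a x" for x
  proof -
    note [measurable] = bessel_measurable[OF \<gamma>]
    let ?e = "\<lambda>x \<xi>::'a. exp (\<i> * complex_of_real (x \<bullet> \<xi>))"
    let ?g = "\<lambda>y \<xi>. ?e (x - y) \<xi> * r \<xi> * cbessel \<gamma> y"
    have "norm_integral ?g = (\<integral>\<^sup>+y. (\<integral>\<^sup>+\<xi>. ennreal (norm (r \<xi>)) \<partial>lborel) * ennreal (bessel \<gamma> (y::'a)) \<partial>lborel)"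
      by (simp add: norm_mult ennreal_mult nn_integral_multc)
    also have "\<dots> < \<infinity>"
      using ri integrable_bessel[OF \<gamma>, where 'a='a] by (simp add: nn_integral_cmult ennreal_mult_less_top integrable_iff_bounded)
    finally have fin: "norm_integral ?g < \<infinity>" .
    have "cconv R (cbessel \<gamma>) x = (LINT y|lborel. \<kappa> * (LINT \<xi>|lborel. ?g y \<xi>))"
      unfolding cconv_def R_def by (intro Bochner_Integration.integral_cong refl) (simp only: integral_mult_left_zero, rule mult.assoc)
    also have "\<dots> = \<kappa> * (LINT y|lborel. LINT \<xi>|lborel. ?g y \<xi>)" by (rule integral_mult_right_zero)
    also have "(LINT y|lborel. LINT \<xi>|lborel. ?g y \<xi>) = (LINT \<xi>|lborel. LINT y|lborel. ?g y \<xi>)"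
      by (rule fubini_lborel) (use fin in simp_all)
    also have "\<dots> = (LINT \<xi>|lborel. ?e x \<xi> * r \<xi> * of_real (\<mu> \<gamma> \<xi>))"
    proof (intro Bochner_Integration.integral_cong refl)
      fix \<xi> :: 'a
      have "?g y \<xi> = ?e x \<xi> * r \<xi> * (cbessel \<gamma> y * exp (- (\<i> * of_real (y \<bullet> \<xi>))))" for y
        by (simp add: inner_diff_left right_diff_distrib exp_diff exp_minus divide_inverse)
      then show "(LINT y|lborel. ?g y \<xi>) = ?e x \<xi> * r \<xi> * of_real (\<mu> \<gamma> \<xi>)"
        by (simp only: integral_mult_right_zero fourier_bessel[OF \<gamma>] \<mu>_def)
    qed
    finally have conv: "cconv R (cbessel \<gamma>) x = \<kappa> * (LINT \<xi>|lborel. ?e x \<xi> * r \<xi> * of_real (\<mu> \<gamma> \<xi>))" .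
    have i1: "integrable lborel (\<lambda>\<xi>. ?e x \<xi> * r \<xi>)"
      by (rule Bochner_Integration.integrable_bound[OF ri]) (auto simp: norm_mult)
    have \<mu>1: "\<bar>\<mu> \<gamma> \<xi>\<bar> \<le> 1" for \<xi>
      using \<gamma> by (auto simp: \<mu>_def powr_minus_divide divide_le_eq intro!: ge_one_powr_ge_zero)
    have i2: "integrable lborel (\<lambda>\<xi>. ?e x \<xi> * r \<xi> * of_real (\<mu> \<gamma> \<xi>))"
      by (rule Bochner_Integration.integrable_bound[OF ri]) (use \<mu>1 in \<open>auto simp: norm_mult mult_left_le\<close>)
    have dist: "z - of_real (\<mu> \<gamma> \<xi>) \<noteq> 0" for \<xi>
      using z \<mu>1[of \<xi>] by (auto simp: \<mu>_def)
    have "z * R x - cconv R (cbessel \<gamma>) x = \<kappa> * (z * (LINT \<xi>|lborel. ?e x \<xi> * r \<xi>) - (LINT \<xi>|lborel. ?e x \<xi> * r \<xi> * of_real (\<mu> \<gamma> \<xi>)))"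
      unfolding conv R_def by (simp add: algebra_simps)
    also have "z * (LINT \<xi>|lborel. ?e x \<xi> * r \<xi>) - (LINT \<xi>|lborel. ?e x \<xi> * r \<xi> * of_real (\<mu> \<gamma> \<xi>))
      = (LINT \<xi>|lborel. z * (?e x \<xi> * r \<xi>) - ?e x \<xi> * r \<xi> * of_real (\<mu> \<gamma> \<xi>))"
      using i1 i2 by simp
    also have "\<dots> = (LINT \<xi>|lborel. ?e x \<xi> * of_real (\<mu> a \<xi>))"
    proof (intro Bochner_Integration.integral_cong refl)
      fix \<xi> :: 'a
      have "z * (?e x \<xi> * r \<xi>) - ?e x \<xi> * r \<xi> * of_real (\<mu> \<gamma> \<xi>) = ?e x \<xi> * (r \<xi> * (z - of_real (\<mu> \<gamma> \<xi>)))"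
        by (simp add: algebra_simps)
      then show "z * (?e x \<xi> * r \<xi>) - ?e x \<xi> * r \<xi> * of_real (\<mu> \<gamma> \<xi>) = ?e x \<xi> * of_real (\<mu> a \<xi>)"
        using dist[of \<xi>] by (simp add: r_def)
    qed
    finally show ?thesis using bessel_inversion[OF a, of x] by (simp add: \<kappa>_def \<mu>_def)
  qed
  have "0 \<le> norm \<kappa> * (LINT \<xi>|lborel. K * \<mu> a \<xi>)"
    using K by (intro mult_nonneg_nonneg Bochner_Integration.integral_nonneg) (auto simp: \<mu>_def)
  then show ?thesis using decay identity c
    by (intro exI[of _ R] conjI exI[of _ "norm \<kappa> * (LINT \<xi>|lborel. K * \<mu> a \<xi>)"] exI[of _ "c / 2"]) auto
qed

section \<open>The stability spectrum\<close>

locale borel_Ap_weight =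
  fixes p A :: real and w :: "'a::euclidean_space \<Rightarrow> real"
  assumes p: "1 \<le> p" and A: "0 \<le> A" and Ap: "Ap_bound p w A"
    and w_measurable [measurable]: "w \<in> borel_measurable borel" and w_pos: "\<And>x. 0 < w x"
    and w_local: "(\<integral>\<^sup>+x\<in>centred_cube 2. ennreal (w x) \<partial>lborel) < \<infinity>"
begin

lemma conv_bounded_cbessel:
  assumes a: "0 < a" shows "\<exists>C\<ge>0. conv_bounded p w (enorm (cbessel a)) C"
  using bessel_bounded[OF Ap A p a w_measurable] by simp

lemma conv_bounded_exp_decay:
  assumes R [measurable]: "R \<in> borel_measurable borel" and C: "0 \<le> C" and \<eta>: "0 < \<eta>"
    and decay: "\<And>x. norm (R x) \<le> C * exp (- (\<eta> * norm x))"
  shows "\<exists>C'\<ge>0. conv_bounded p w (enorm R) C'"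
proof -
  obtain C1 where C1: "0 \<le> C1" "conv_bounded p w (\<lambda>x. ennreal (\<eta> ^ DIM('a) * exp (- (\<eta> * norm x)))) C1"
    using exp_kernel_bounded[OF Ap A p w_measurable] \<eta> by blast
  define a where "a = C / \<eta> ^ DIM('a)"
  have a: "0 \<le> a" using C \<eta> by (simp add: a_def)
  have "conv_bounded p w (enorm R) (a powr p * C1)"
  proof (rule conv_bounded_mono[OF conv_bounded_cmult[OF C1(2) a w_measurable]])
    show "ennreal (norm (R x)) \<le> ennreal a * ennreal (\<eta> ^ DIM('a) * exp (- (\<eta> * norm x)))" for x
      using decay[of x] a \<eta> by (simp add: ennreal_mult[symmetric] a_def ennreal_leI)
  qed (use p in auto)
  then show ?thesis using C1 by (intro exI[of _ "a powr p * C1"]) simp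
qed

lemma cconv_integrable_AE:
  assumes k [measurable]: "k \<in> borel_measurable borel" and b: "conv_bounded p w (enorm k) C"
    and f [measurable]: "f \<in> borel_measurable borel" and fin: "weighted_energy p w f < \<infinity>"
  shows "AE x in lborel. integrable lborel (\<lambda>y. k (x - y) * f y)"
proof -
  have "AE x in lborel. econv (enorm k) (enorm f) x < \<infinity>"
    by (rule econv_finite_AE[OF b]) (use fin w_pos in \<open>simp_all add: weighted_energy_def del: epow_ennreal\<close>)
  then show ?thesis by eventually_elim (rule integrable_of_econv_finite[OF k f])
qed

lemma cconv_assoc_AE:
  assumes k [measurable]: "k \<in> borel_measurable borel" and kb: "conv_bounded p w (enorm k) C"
    and l [measurable]: "l \<in> borel_measurable borel" and lb: "conv_bounded p w (enorm l) C'"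
    and f [measurable]: "f \<in> borel_measurable borel" and fin: "weighted_energy p w f < \<infinity>"
  shows "AE x in lborel. cconv k (cconv l f) x = cconv (cconv k l) f x"
proof -
  have "eenergy p w (econv (enorm l) (enorm f)) \<le> ennreal C' * weighted_energy p w f"
    using lb[unfolded conv_bounded_def, THEN conjunct2, THEN conjunct2, rule_format, of "enorm f"]
    by (simp add: weighted_energy_def del: epow_ennreal)
  also have "\<dots> < \<infinity>" using fin by (simp add: ennreal_mult_less_top)
  finally have "AE x in lborel. econv (enorm k) (econv (enorm l) (enorm f)) x < \<infinity>"
    by (intro econv_finite_AE[OF kb]) (use w_pos in simp_all)
  then show ?thesis by eventually_elim (rule cconv_assoc[OF k l f])
qed

lemma weighted_energy_cconv_finite:
  assumes "k \<in> borel_measurable borel" "conv_bounded p w (enorm k) C" "f \<in> borel_measurable borel"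
    and "weighted_energy p w f < \<infinity>"
  shows "weighted_energy p w (cconv k f) < \<infinity>"
  by (rule le_less_trans[OF weighted_energy_cconv[OF assms(1,3,2) p]]) (use assms(4) in \<open>simp add: ennreal_mult_less_top\<close>)

lemma weighted_energy_diff:
  assumes [measurable]: "f \<in> borel_measurable borel" "g \<in> borel_measurable borel"
  shows "weighted_energy p w (\<lambda>x. f x - g x) \<le> ennreal (2 powr p) * (weighted_energy p w f + weighted_energy p w g)"
  using weighted_energy_add[OF p, of f "\<lambda>x. (-1) * g x" w] weighted_energy_cmult[of g w p "-1"] by simp

lemma cconv_diff_AE:
  assumes k: "k \<in> borel_measurable borel" and b: "conv_bounded p w (enorm k) C"
    and f: "f \<in> borel_measurable borel" and ff: "weighted_energy p w f < \<infinity>"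
    and g: "g \<in> borel_measurable borel" and gf: "weighted_energy p w g < \<infinity>"
  shows "AE x in lborel. cconv k (\<lambda>x. c * f x - g x) x = c * cconv k f x - cconv k g x"
  using cconv_integrable_AE[OF k b f ff] cconv_integrable_AE[OF k b g gf]
proof eventually_elim
  case (elim x)
  have "cconv k (\<lambda>x. c * f x - g x) x = (LINT y|lborel. c * (k (x - y) * f y) - k (x - y) * g y)"
    unfolding cconv_def by (intro Bochner_Integration.integral_cong refl) (simp add: algebra_simps)
  then show ?case using elim by (simp add: cconv_def)
qed

text \<open>Iterating \<open>z f = h + J f\<close>: each step trades \<open>f\<close> for a smoother potential of \<open>f\<close>.\<close>

lemma energy_le_iterate:
  assumes \<gamma>: "0 < \<gamma>" and z: "z \<noteq> 0"
  shows "\<exists>C<\<infinity>. \<forall>f\<in>borel_measurable borel. weighted_energy p w f < \<infinity> \<longrightarrow>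
    weighted_energy p w f \<le> C * (weighted_energy p w (\<lambda>x. z * f x - cconv (cbessel \<gamma>) f x)
      + weighted_energy p w (cconv (cbessel (real (Suc n) * \<gamma>)) f))"
proof (induction n)
  let ?E = "weighted_energy p w"
  let ?h = "\<lambda>f x. z * f x - cconv (cbessel \<gamma>) f x"
  define M where "M = ennreal (norm (1 / z) powr p) * ennreal (2 powr p)"
  have M: "M < \<infinity>" by (simp add: M_def ennreal_mult_less_top)
  have div: "?E g \<le> M * (?E u + ?E v)"
    if ae: "AE x in lborel. z * g x = u x + v x" and [measurable]: "g \<in> borel_measurable borel" "u \<in> borel_measurable borel" "v \<in> borel_measurable borel"
    for g u v :: "'a \<Rightarrow> complex"
  proof -
    have "AE x in lborel. g x = 1 / z * (u x + v x)" using ae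
    proof eventually_elim
      case (elim x)
      then show ?case using z by (simp add: field_simps)
    qed
    then have "?E g = ?E (\<lambda>x. 1 / z * (u x + v x))" by (rule weighted_energy_cong_AE)
    also have "\<dots> = ennreal (norm (1 / z) powr p) * ?E (\<lambda>x. u x + v x)" by (rule weighted_energy_cmult) measurable
    also have "\<dots> \<le> ennreal (norm (1 / z) powr p) * (ennreal (2 powr p) * (?E u + ?E v))"
      by (intro mult_left_mono weighted_energy_add p) auto
    finally show ?thesis by (simp add: M_def mult.assoc)
  qed
  {
    case 0
    show ?case using \<gamma> M by (intro exI[of _ M] conjI ballI impI div AE_I2) auto
  next
    case (Suc n)
    define a where "a = real (Suc n) * \<gamma>"
    have a: "0 < a" using \<gamma> by (simp add: a_def)
    have a': "real (Suc (Suc n)) * \<gamma> = a + \<gamma>" by (simp add: a_def algebra_simps)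
    note [measurable] = bessel_measurable[OF a] bessel_measurable[OF \<gamma>]
    from Suc obtain C where C: "C < \<infinity>"
      and IH: "\<And>f. f \<in> borel_measurable borel \<Longrightarrow> ?E f < \<infinity> \<Longrightarrow> ?E f \<le> C * (?E (?h f) + ?E (cconv (cbessel a) f))"
      unfolding a_def by blast
    obtain B where B: "0 \<le> B" "conv_bounded p w (enorm (cbessel a)) B" using conv_bounded_cbessel[OF a] by blast
    obtain B1 where B1: "0 \<le> B1" "conv_bounded p w (enorm (cbessel \<gamma>)) B1" using conv_bounded_cbessel[OF \<gamma>] by blast
    define C' where "C' = C * (1 + M * ennreal B + M)"
    have "?E f \<le> C' * (?E (?h f) + ?E (cconv (cbessel (a + \<gamma>)) f))"
      if f [measurable]: "f \<in> borel_measurable borel" and fin: "?E f < \<infinity>" for f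
    proof -
      note [measurable] = bessel_measurable[of "a + \<gamma>"]
      have a\<gamma>: "0 < a + \<gamma>" using a \<gamma> by simp
      have mB: "(cbessel a :: 'a \<Rightarrow> complex) \<in> borel_measurable borel"
        "(cbessel \<gamma> :: 'a \<Rightarrow> complex) \<in> borel_measurable borel"
        "(cbessel (a + \<gamma>) :: 'a \<Rightarrow> complex) \<in> borel_measurable borel"
        using bessel_measurable[OF a, where 'a='a] bessel_measurable[OF \<gamma>, where 'a='a] bessel_measurable[OF a\<gamma>, where 'a='a] by auto
      have fin1: "?E (cconv (cbessel \<gamma>) f) < \<infinity>"
        by (rule weighted_energy_cconv_finite[OF mB(2) B1(2) f fin])
      have sg: "cconv (cconv (cbessel a) (cbessel \<gamma>)) f x = cconv (cbessel (a + \<gamma>)) f x" for x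
        using mB by (intro cconv_cong_AE bessel_semigroup a \<gamma> f cconv_measurable)
      have hm: "?h f \<in> borel_measurable borel" using mB by measurable
      have "AE x in lborel. z * cconv (cbessel a) f x = cconv (cbessel a) (?h f) x + cconv (cbessel (a + \<gamma>)) f x"
        using cconv_diff_AE[OF mB(1) B(2) f fin cconv_measurable[OF mB(2) f] fin1, of z]
          cconv_assoc_AE[OF mB(1) B(2) mB(2) B1(2) f fin]
        by eventually_elim (simp add: sg)
      then have "?E (cconv (cbessel a) f) \<le> M * (?E (cconv (cbessel a) (?h f)) + ?E (cconv (cbessel (a + \<gamma>)) f))"
        by (rule div) (use mB hm in measurable)
      also have "\<dots> \<le> M * (ennreal B * ?E (?h f) + ?E (cconv (cbessel (a + \<gamma>)) f))"
        by (intro mult_left_mono add_right_mono weighted_energy_cconv mB hm B p) auto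
      finally have 1: "?E (cconv (cbessel a) f) \<le> \<dots>" .
      have "?E f \<le> C * (?E (?h f) + ?E (cconv (cbessel a) f))" using f fin by (rule IH)
      also have "\<dots> \<le> C * (?E (?h f) + M * (ennreal B * ?E (?h f) + ?E (cconv (cbessel (a + \<gamma>)) f)))"
        using 1 by (intro mult_left_mono add_left_mono) auto
      also have "\<dots> \<le> C * ((1 + M * ennreal B + M) * (?E (?h f) + ?E (cconv (cbessel (a + \<gamma>)) f)))"
      proof (intro mult_left_mono)
        have "X + M * (b * X + Y) \<le> (1 + M * b + M) * (X + Y)" for X Y b :: ennreal
        proof -
          have "(1 + M * b + M) * (X + Y) = (X + M * (b * X + Y)) + (M * X + Y + M * b * Y)"
            by (simp add: algebra_simps)
          then show ?thesis by simp
        qed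
        then show "?E (?h f) + M * (ennreal B * ?E (?h f) + ?E (cconv (cbessel (a + \<gamma>)) f))
          \<le> (1 + M * ennreal B + M) * (?E (?h f) + ?E (cconv (cbessel (a + \<gamma>)) f))" .
      qed simp
      finally show ?thesis by (simp add: C'_def mult.assoc)
    qed
    moreover have "C' < \<infinity>" using C M by (simp add: C'_def ennreal_mult_less_top)
    ultimately show ?case unfolding a' by blast
  }
qed

lemma energy_le_resolvent:
  assumes \<gamma>: "0 < \<gamma>" and z: "z \<notin> complex_of_real ` {0..1}"
  shows "\<exists>C<\<infinity>. \<forall>f\<in>borel_measurable borel. weighted_energy p w f < \<infinity> \<longrightarrow>
    weighted_energy p w f \<le> C * weighted_energy p w (\<lambda>x. z * f x - cconv (cbessel \<gamma>) f x)"
proof -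
  let ?E = "weighted_energy p w"
  let ?h = "\<lambda>f x. z * f x - cconv (cbessel \<gamma>) f x"
  have z0: "z \<noteq> 0" using z by (metis atLeastAtMost_iff image_eqI of_real_0 order_refl zero_le_one)
  obtain n0 where n0: "real DIM('a) < of_nat n0 * \<gamma>" using ex_less_of_nat_mult[OF \<gamma>] by blast
  define a where "a = real (Suc n0) * \<gamma>"
  have aD: "real DIM('a) < a" using n0 \<gamma> by (simp add: a_def algebra_simps)
  then have a: "0 < a" by linarith
  obtain C where C: "C < \<infinity>" and it: "\<And>f. f \<in> borel_measurable borel \<Longrightarrow> ?E f < \<infinity> \<Longrightarrow>
      ?E f \<le> C * (?E (?h f) + ?E (cconv (cbessel a) f))"
    using energy_le_iterate[OF \<gamma> z0, of n0] unfolding a_def by blast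
  obtain R :: "'a \<Rightarrow> complex" and C1 \<eta> where R: "R \<in> borel_measurable borel" and C1: "0 \<le> C1" and \<eta>: "0 < \<eta>"
    and decay: "\<And>x. norm (R x) \<le> C1 * exp (- (\<eta> * norm x))"
    and Rid: "\<And>x. z * R x - cconv R (cbessel \<gamma>) x = cbessel a x"
    using resolvent_kernel[OF \<gamma> aD z] by blast
  obtain CR where CR: "0 \<le> CR" "conv_bounded p w (enorm R) CR"
    using conv_bounded_exp_decay[OF R C1 \<eta> decay] by blast
  obtain B where B: "0 \<le> B" "conv_bounded p w (enorm (cbessel a)) B" using conv_bounded_cbessel[OF a] by blast
  obtain B1 where B1: "0 \<le> B1" "conv_bounded p w (enorm (cbessel \<gamma>)) B1" using conv_bounded_cbessel[OF \<gamma>] by blast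
  have mB: "(cbessel a :: 'a \<Rightarrow> complex) \<in> borel_measurable borel" "(cbessel \<gamma> :: 'a \<Rightarrow> complex) \<in> borel_measurable borel"
    using bessel_measurable[OF a, where 'a='a] bessel_measurable[OF \<gamma>, where 'a='a] by auto
  have "?E f \<le> C * (1 + ennreal CR) * ?E (?h f)" if f: "f \<in> borel_measurable borel" and fin: "?E f < \<infinity>" for f
  proof -
    have fin1: "?E (cconv (cbessel \<gamma>) f) < \<infinity>"
      by (rule weighted_energy_cconv_finite[OF mB(2) B1(2) f fin])
    have hm: "?h f \<in> borel_measurable borel" using cconv_measurable[OF mB(2) f] f by measurable
    have "AE x in lborel. cconv (cbessel a) f x = cconv R (?h f) x"
      using cconv_diff_AE[OF R CR(2) f fin cconv_measurable[OF mB(2) f] fin1, of z]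
        cconv_assoc_AE[OF R CR(2) mB(2) B1(2) f fin]
        cconv_integrable_AE[OF R CR(2) f fin] cconv_integrable_AE[OF mB(1) B(2) f fin]
    proof eventually_elim
      case (elim x)
      have "cconv (cconv R (cbessel \<gamma>)) f x = (LINT y|lborel. z * (R (x - y) * f y) - cbessel a (x - y) * f y)"
        unfolding cconv_def[of "cconv R (cbessel \<gamma>)"]
        by (intro Bochner_Integration.integral_cong refl) (simp add: Rid[symmetric] algebra_simps)
      also have "\<dots> = z * cconv R f x - cconv (cbessel a) f x"
        using elim(3,4) by (simp add: cconv_def)
      finally show ?case using elim(1,2) by simp
    qed
    then have "?E (cconv (cbessel a) f) = ?E (cconv R (?h f))" by (rule weighted_energy_cong_AE)
    also have "\<dots> \<le> ennreal CR * ?E (?h f)" by (rule weighted_energy_cconv[OF R hm CR(2) p])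
    finally have 1: "?E (cconv (cbessel a) f) \<le> ennreal CR * ?E (?h f)" .
    have "?E f \<le> C * (?E (?h f) + ?E (cconv (cbessel a) f))" using f fin by (rule it)
    also have "\<dots> \<le> C * (?E (?h f) + ennreal CR * ?E (?h f))"
      using 1 by (intro mult_left_mono add_left_mono) auto
    also have "\<dots> = C * (1 + ennreal CR) * ?E (?h f)" by (simp add: algebra_simps)
    finally show ?thesis .
  qed
  moreover have "C * (1 + ennreal CR) < \<infinity>" using C by (simp add: ennreal_mult_less_top)
  ultimately show ?thesis by blast
qed

lemma energy_exp_decay_finite:
  assumes \<delta>: "0 < \<delta>" and f: "\<And>x. norm (f x) = exp (- (\<delta> * norm x))"
  shows "weighted_energy p w f < \<infinity>"
proof -
  let ?Q = "centred_cube 2 :: 'a set"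
  define D where "D = DIM('a)"
  obtain C where C: "0 \<le> C" "conv_bounded p w (\<lambda>x. ennreal (\<delta> ^ D * exp (- (\<delta> * norm x)))) C"
    using exp_kernel_bounded[OF Ap A p w_measurable] \<delta> unfolding D_def by blast
  define k where "k = (\<lambda>x::'a. ennreal (\<delta> ^ D * exp (- (\<delta> * norm x))))"
  define c where "c = \<delta> ^ D * exp (- (\<delta> * D)) * 2 ^ D"
  have c: "0 < c" using \<delta> by (simp add: c_def)
  have Q: "emeasure lborel ?Q = ennreal (2 ^ D)"
  proof -
    have "?Q = cbox (0 - (2 / 2) *\<^sub>R One) ((0 - (2 / 2) *\<^sub>R One) + 2 *\<^sub>R One)"
      using translate_centred_cube[of _ "0::'a" 2] by (intro set_eqI) simp
    then show ?thesis using measure_cube(2)[of 2 "0 - (2 / 2) *\<^sub>R One :: 'a"] by (simp add: D_def)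
  qed
  have low: "ennreal (c * exp (- (\<delta> * norm x))) \<le> econv k (indicator ?Q) x" for x
  proof -
    have "ennreal (c * exp (- (\<delta> * norm x))) = ennreal (\<delta> ^ D * exp (- (\<delta> * D)) * exp (- (\<delta> * norm x))) * ennreal (2 ^ D)"
      using \<delta> by (subst ennreal_mult[symmetric]) (auto simp: c_def mult_ac)
    also have "\<dots> = (\<integral>\<^sup>+y. ennreal (\<delta> ^ D * exp (- (\<delta> * D)) * exp (- (\<delta> * norm x))) * indicator ?Q y \<partial>lborel)"
      by (simp add: nn_integral_cmult_indicator Q del: power_numeral)
    also have "\<dots> \<le> econv k (indicator ?Q) x"
      unfolding econv_def
    proof (rule nn_integral_mono)
      fix y :: 'a
      have "\<delta> ^ D * exp (- (\<delta> * D)) * exp (- (\<delta> * norm x)) \<le> \<delta> ^ D * exp (- (\<delta> * norm (x - y)))" if "y \<in> ?Q"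
      proof -
        have "norm y \<le> (\<Sum>b\<in>Basis. \<bar>y \<bullet> b\<bar>)" by (rule norm_le_l1)
        also have "\<dots> \<le> (\<Sum>b\<in>(Basis :: 'a set). 1)" using that by (intro sum_mono) (simp add: mem_centred_cube)
        finally have "norm y \<le> real D" by (simp add: D_def)
        then have "norm (x - y) \<le> norm x + D" using norm_triangle_ineq4[of x y] by linarith
        then have "\<delta> * norm (x - y) \<le> \<delta> * (norm x + D)" using \<delta> by (intro mult_left_mono) auto
        then have "exp (- (\<delta> * D)) * exp (- (\<delta> * norm x)) \<le> exp (- (\<delta> * norm (x - y)))"
          by (simp add: exp_add[symmetric] algebra_simps)
        then show ?thesis using \<delta> by (simp add: mult.assoc)
      qed
      then show "ennreal (\<delta> ^ D * exp (- (\<delta> * D)) * exp (- (\<delta> * norm x))) * indicator ?Q y \<le> k (x - y) * indicator ?Q y"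
        by (auto simp: k_def indicator_def intro!: ennreal_leI)
    qed
    finally show ?thesis .
  qed
  have scale: "epow p (ennreal (c * exp (- (\<delta> * norm x)))) = ennreal (c powr p) * epow p (ennreal (norm (f x)))" for x
    unfolding f using c by (subst ennreal_mult) (auto simp: epow_cmult simp del: epow_ennreal)
  have "ennreal (c powr p) * weighted_energy p w f
    = (\<integral>\<^sup>+x. epow p (ennreal (c * exp (- (\<delta> * norm x)))) * ennreal (w x) \<partial>lborel)"
    unfolding weighted_energy_def scale mult.assoc by (rule nn_integral_cmult[symmetric]) (simp add: f)
  also have "\<dots> \<le> eenergy p w (econv k (indicator ?Q))"
    using p by (intro nn_integral_mono mult_right_mono epow_mono low) auto
  also have "\<dots> \<le> ennreal C * (\<integral>\<^sup>+x. epow p (indicator ?Q x) * ennreal (w x) \<partial>lborel)"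
    using C(2)[unfolded conv_bounded_def, THEN conjunct2, THEN conjunct2, rule_format, of "indicator ?Q"]
    unfolding k_def by simp
  also have "(\<integral>\<^sup>+x. epow p (indicator ?Q x) * ennreal (w x) \<partial>lborel) = (\<integral>\<^sup>+x\<in>?Q. ennreal (w x) \<partial>lborel)"
  proof (intro nn_integral_cong)
    fix x :: 'a
    have "epow p 1 = 1" using epow_ennreal[of 1 p] by simp
    then show "epow p (indicator ?Q x) * ennreal (w x) = ennreal (w x) * indicator ?Q x"
      by (simp add: indicator_def)
  qed
  also have "ennreal C * \<dots> < \<infinity>" using w_local by (simp add: ennreal_mult_less_top)
  finally show ?thesis using c by (auto simp: ennreal_mult_less_top)
qed

lemma energy_pos:
  assumes [measurable]: "f \<in> borel_measurable borel" and f: "\<And>x. f x \<noteq> 0"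
  shows "0 < weighted_energy p w f"
proof -
  have "weighted_energy p w f \<noteq> 0"
  proof
    assume "weighted_energy p w f = 0"
    then have "AE x in lborel. epow p (ennreal (norm (f x))) * ennreal (w x) = 0"
      unfolding weighted_energy_def by (subst (asm) nn_integral_0_iff_AE) (auto simp del: epow_ennreal)
    then have "AE x in (lborel :: 'a measure). x \<notin> UNIV"
    proof eventually_elim
      case (elim x)
      then show ?case using f[of x] w_pos[of x] by (auto simp: epow_eq_0_iff simp del: epow_ennreal)
    qed
    then show False using AE_iff_null_sets[of "UNIV :: 'a set" lborel] by (auto simp: null_sets_def)
  qed
  then show ?thesis by (simp add: zero_less_iff_neq_zero)
qed

end

lemma bessel_tilt_small:
  assumes \<gamma>: "0 < \<gamma>" and e: "0 < e"
  shows "\<exists>\<delta>>0. integrable lborel (\<lambda>y::'a::euclidean_space. bessel \<gamma> y * (exp (\<delta> * norm y) - 1)) \<and>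
    (LINT y|lborel. bessel \<gamma> (y::'a) * (exp (\<delta> * norm y) - 1)) \<le> e"
proof -
  note [measurable] = bessel_measurable[OF \<gamma>]
  define \<delta> where "\<delta> n = 1 / real (Suc (Suc n))" for n
  have \<delta>: "0 < \<delta> n" "\<delta> n \<le> 1 / 2" for n by (auto simp: \<delta>_def)
  have \<delta>0: "\<delta> \<longlonglongrightarrow> 0" unfolding \<delta>_def by (intro LIMSEQ_Suc lim_1_over_n)
  have dom: "norm (bessel \<gamma> y * (exp (\<delta> n * norm y) - 1)) \<le> bessel \<gamma> y * exp (norm y / 2)" for n and y :: 'a
  proof -
    have "\<delta> n * norm y \<le> norm y / 2" using mult_right_mono[OF \<delta>(2)[of n], of "norm y"] by simp
    then have "exp (\<delta> n * norm y) - 1 \<le> exp (norm y / 2)" by (smt (verit) exp_le_cancel_iff)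
    moreover have "0 \<le> exp (\<delta> n * norm y) - 1" using \<delta>[of n] by simp
    ultimately show ?thesis by (simp add: abs_mult mult_left_mono)
  qed
  have "(\<lambda>n. LINT y|lborel. bessel \<gamma> (y::'a) * (exp (\<delta> n * norm y) - 1)) \<longlonglongrightarrow> (LINT y|(lborel :: 'a measure). 0)"
  proof (rule integral_dominated_convergence)
    show "integrable lborel (\<lambda>y::'a. bessel \<gamma> y * exp (norm y / 2))" by (rule bessel_exp_moment[OF \<gamma>])
    show "AE y in lborel. (\<lambda>n. bessel \<gamma> (y::'a) * (exp (\<delta> n * norm y) - 1)) \<longlonglongrightarrow> 0"
      using \<delta>0 by (intro AE_I2) (auto intro!: tendsto_eq_intros)
  qed (use dom in auto)
  then have "eventually (\<lambda>n. (LINT y|lborel. bessel \<gamma> (y::'a) * (exp (\<delta> n * norm y) - 1)) < e) sequentially"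
    using e by (intro order_tendstoD) auto
  then obtain n where n: "(LINT y|lborel. bessel \<gamma> (y::'a) * (exp (\<delta> n * norm y) - 1)) < e"
    by (auto simp: eventually_sequentially)
  have "integrable lborel (\<lambda>y::'a. bessel \<gamma> y * (exp (\<delta> n * norm y) - 1))"
    by (rule Bochner_Integration.integrable_bound[OF bessel_exp_moment[OF \<gamma>]])
       (use dom[of _ n] in \<open>auto intro!: AE_I2 intro: order_trans[OF _ abs_ge_self]\<close>)
  then show ?thesis using n \<delta>[of n] by (intro exI[of _ "\<delta> n"]) auto
qed

lemma symbol_surj:
  assumes \<gamma>: "0 < \<gamma>" and z: "0 < z" "z \<le> 1"
  shows "\<exists>\<xi>::'a::euclidean_space. (1 + (norm \<xi>)\<^sup>2) powr (- \<gamma> / 2) = z"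
proof -
  define t where "t = z powr (- 2 / \<gamma>) - 1"
  have "1 \<le> z powr (- 2 / \<gamma>)" using powr_mono'[of "- 2 / \<gamma>" 0 z] z \<gamma> by simp
  then have t: "0 \<le> t" by (simp add: t_def)
  obtain e :: 'a where "norm e = 1" using unit_vector_along by blast
  then have "(1 + (norm (sqrt t *\<^sub>R e))\<^sup>2) powr (- \<gamma> / 2) = (z powr (- 2 / \<gamma>)) powr (- \<gamma> / 2)"
    using t by (simp add: t_def)
  also have "\<dots> = z" using z \<gamma> unfolding powr_powr by simp
  finally show ?thesis by blast
qed

lemma approximate_eigenfunction:
  assumes \<gamma>: "0 < \<gamma>" and z: "0 \<le> z" "z \<le> 1" and e: "0 < e"
  shows "\<exists>\<delta>>0. \<exists>f\<in>borel_measurable borel. (\<forall>x::'a::euclidean_space. norm (f x) = exp (- (\<delta> * norm x))) \<and>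
    (\<forall>x. norm (of_real z * f x - cconv (cbessel \<gamma>) f x) \<le> e * norm (f x))"
proof -
  note [measurable] = bessel_measurable[OF \<gamma>]
  define z' where "z' = (if 0 < z then z else min 1 (e / 2))"
  have z': "0 < z'" "z' \<le> 1" "\<bar>z - z'\<bar> \<le> e / 2" using z e by (auto simp: z'_def)
  obtain \<xi> :: 'a where \<xi>: "(1 + (norm \<xi>)\<^sup>2) powr (- \<gamma> / 2) = z'" using symbol_surj[OF \<gamma> z'(1,2)] by blast
  obtain \<delta> where \<delta>: "0 < \<delta>" and ti: "integrable lborel (\<lambda>y::'a. bessel \<gamma> y * (exp (\<delta> * norm y) - 1))"
    and small: "(LINT y|lborel. bessel \<gamma> (y::'a) * (exp (\<delta> * norm y) - 1)) \<le> e / 2"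
    using bessel_tilt_small[OF \<gamma>, of "e / 2"] e by auto
  define f where "f x = exp (\<i> * of_real (x \<bullet> \<xi>)) * complex_of_real (exp (- (\<delta> * norm x)))" for x
  have [measurable]: "f \<in> borel_measurable borel" unfolding f_def by measurable
  have nf: "norm (f x) = exp (- (\<delta> * norm x))" for x by (simp add: f_def norm_mult)
  have B: "integrable lborel (cbessel \<gamma> :: 'a \<Rightarrow> complex)" using integrable_bessel[OF \<gamma>, where 'a='a] by simp
  have main: "norm (of_real z' * f x - cconv (cbessel \<gamma>) f x) \<le> e / 2 * norm (f x)" for x
  proof -
    let ?u = "\<lambda>y. cbessel \<gamma> y * exp (- (\<i> * of_real (y \<bullet> \<xi>)))"
    have ui: "integrable lborel ?u" by (rule Bochner_Integration.integrable_bound[OF B]) (auto simp: norm_mult)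
    have 1: "of_real z' * f x = (LINT y|lborel. ?u y * f x)"
      by (simp only: integral_mult_left_zero fourier_bessel[OF \<gamma>] \<xi>)
    have "cconv (cbessel \<gamma>) f x = (LINT y|lborel. cbessel \<gamma> (x - (x - y)) * f (x - y))"
      unfolding cconv_def by (rule lborel_integral_reflect[symmetric]) measurable
    then have 2: "cconv (cbessel \<gamma>) f x = (LINT y|lborel. cbessel \<gamma> y * f (x - y))" by simp
    have i1: "integrable lborel (\<lambda>y. ?u y * f x)" using ui by simp
    have i2: "integrable lborel (\<lambda>y. cbessel \<gamma> y * f (x - y))"
      by (rule Bochner_Integration.integrable_bound[OF B]) (use \<delta> in \<open>auto simp: norm_mult nf mult_left_le\<close>)
    have pt: "norm (?u y * f x - cbessel \<gamma> y * f (x - y)) \<le> norm (f x) * (bessel \<gamma> y * (exp (\<delta> * norm y) - 1))" for y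
    proof -
      have "f (x - y) = exp (\<i> * of_real (x \<bullet> \<xi>)) * exp (- (\<i> * of_real (y \<bullet> \<xi>))) * of_real (exp (- (\<delta> * norm (x - y))))"
        by (simp add: f_def inner_diff_left right_diff_distrib mult_exp_exp)
      then have "?u y * f x - cbessel \<gamma> y * f (x - y)
        = ?u y * exp (\<i> * of_real (x \<bullet> \<xi>)) * of_real (exp (- (\<delta> * norm x)) - exp (- (\<delta> * norm (x - y))))"
        by (simp add: f_def algebra_simps)
      then have "norm (?u y * f x - cbessel \<gamma> y * f (x - y)) = bessel \<gamma> y * \<bar>exp (- (\<delta> * norm x)) - exp (- (\<delta> * norm (x - y)))\<bar>"
        by (simp only: norm_mult norm_of_real norm_exp_imaginary) simp
      also have "\<dots> \<le> bessel \<gamma> y * (exp (- (\<delta> * norm x)) * (exp (\<delta> * norm y) - 1))"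
      proof (intro mult_left_mono)
        define t where "t = exp (\<delta> * norm y)"
        have t: "1 \<le> t" using \<delta> by (simp add: t_def)
        have "\<delta> * norm x \<le> \<delta> * norm (x - y) + \<delta> * norm y" "\<delta> * norm (x - y) \<le> \<delta> * norm x + \<delta> * norm y"
          using \<delta> norm_triangle_sub[of x y] norm_triangle_ineq4[of x y]
          by (auto simp: distrib_left[symmetric] add.commute)
        then have "exp (- (\<delta> * norm (x - y))) \<le> exp (- (\<delta> * norm x) + \<delta> * norm y)"
          "exp (- (\<delta> * norm x) - \<delta> * norm y) \<le> exp (- (\<delta> * norm (x - y)))" by auto
        then have up: "exp (- (\<delta> * norm (x - y))) \<le> exp (- (\<delta> * norm x)) * t"
          and lo: "exp (- (\<delta> * norm x)) * (1 / t) \<le> exp (- (\<delta> * norm (x - y)))"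
          by (simp_all only: t_def exp_add exp_diff times_divide_eq_right mult_1_right)
        have "2 \<le> t + 1 / t"
        proof -
          have "0 \<le> (t - 1)\<^sup>2 / t" using t by simp
          also have "\<dots> = t + 1 / t - 2" using t by (simp add: field_simps power2_eq_square)
          finally show ?thesis by simp
        qed
        then have "exp (- (\<delta> * norm x)) * 2 \<le> exp (- (\<delta> * norm x)) * (t + 1 / t)" by (intro mult_left_mono) auto
        with up lo show "\<bar>exp (- (\<delta> * norm x)) - exp (- (\<delta> * norm (x - y)))\<bar> \<le> exp (- (\<delta> * norm x)) * (exp (\<delta> * norm y) - 1)"
          unfolding t_def[symmetric] by (simp add: algebra_simps abs_le_iff)
      qed simp
      finally show ?thesis by (simp add: nf mult_ac)
    qed
    have "of_real z' * f x - cconv (cbessel \<gamma>) f x = (LINT y|lborel. ?u y * f x - cbessel \<gamma> y * f (x - y))"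
      unfolding 1 2 using i1 i2 by (rule Bochner_Integration.integral_diff[symmetric])
    also have "norm \<dots> \<le> (LINT y|lborel. norm (f x) * (bessel \<gamma> (y::'a) * (exp (\<delta> * norm y) - 1)))"
    proof (rule order_trans[OF integral_norm_bound integral_mono])
      show "integrable lborel (\<lambda>y. norm (?u y * f x - cbessel \<gamma> y * f (x - y)))" using i1 i2 by auto
      show "integrable lborel (\<lambda>y::'a. norm (f x) * (bessel \<gamma> y * (exp (\<delta> * norm y) - 1)))" using ti by simp
    qed (rule pt)
    also have "\<dots> = norm (f x) * (LINT y|lborel. bessel \<gamma> (y::'a) * (exp (\<delta> * norm y) - 1))"
      by (rule integral_mult_right_zero)
    also have "\<dots> \<le> norm (f x) * (e / 2)" using small by (intro mult_left_mono) auto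
    finally show ?thesis by (simp add: mult.commute)
  qed
  have "norm (of_real z * f x - cconv (cbessel \<gamma>) f x) \<le> e * norm (f x)" for x
  proof -
    have "of_real z * f x - cconv (cbessel \<gamma>) f x = of_real (z - z') * f x + (of_real z' * f x - cconv (cbessel \<gamma>) f x)"
      by (simp add: algebra_simps)
    also have "norm \<dots> \<le> norm (of_real (z - z') * f x) + norm (of_real z' * f x - cconv (cbessel \<gamma>) f x)"
      by (rule norm_triangle_ineq)
    also have "norm (of_real (z - z') * f x) \<le> e / 2 * norm (f x)"
      unfolding norm_mult norm_of_real using z'(3) by (intro mult_right_mono) auto
    also note main[of x]
    finally show ?thesis by (simp add: field_simps)
  qed
  then show ?thesis using \<delta> nf by (intro exI[of _ \<delta>] conjI bexI[of _ f]) auto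
qed

lemma weighted_energy_le_of_norm_le:
  assumes [measurable]: "f \<in> borel_measurable borel" "w \<in> borel_measurable borel"
    and e: "0 \<le> e" and p: "0 \<le> p" and le: "\<And>x. norm (h x) \<le> e * norm (f x)"
  shows "weighted_energy p w h \<le> ennreal (e powr p) * weighted_energy p w f"
proof -
  have "weighted_energy p w h \<le> weighted_energy p w (\<lambda>x. of_real e * f x)"
    unfolding weighted_energy_def using e p le
    by (intro nn_integral_mono mult_right_mono epow_mono ennreal_leI) (auto simp: norm_mult)
  also have "\<dots> = ennreal (e powr p) * weighted_energy p w f"
    using e by (simp add: weighted_energy_cmult)
  finally show ?thesis .
qed

lemma Lpw_eq_energy:
  fixes f f' :: "'a::euclidean_space \<Rightarrow> complex"
  assumes f: "f \<in> borel_measurable lebesgue" and f' [measurable]: "f' \<in> borel_measurable borel"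
    and ae: "AE x in lborel. f x = f' x"
    and w: "w \<in> borel_measurable lebesgue" and w' [measurable]: "w' \<in> borel_measurable borel"
    and wae: "AE x in lborel. w x = w' x" and pos: "\<And>x. 0 < w' x"
  shows "f \<in> Lpw p w \<longleftrightarrow> weighted_energy p w' f' < \<infinity>"
    and "Lpw_norm p w f = enn2real (weighted_energy p w' f') powr (1 / p)"
proof -
  have m: "(\<lambda>x. norm (f x) powr p * w x) \<in> borel_measurable lebesgue" using f w by measurable
  have ae1: "AE x in lborel. norm (f x) powr p * w x = norm (f' x) powr p * w' x"
    using ae wae by eventually_elim simp
  have nn: "AE x in lebesgue. 0 \<le> norm (f x) powr p * w x"
    unfolding AE_completion_iff using ae1 by eventually_elim (simp add: less_imp_le[OF pos])
  have e: "(\<integral>\<^sup>+x. ennreal (norm (f x) powr p * w x) \<partial>lebesgue) = weighted_energy p w' f'"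
    unfolding nn_integral_completion weighted_energy_def
    using ae1 by (intro nn_integral_cong_AE) (auto elim!: eventually_mono simp: ennreal_mult less_imp_le[OF pos])
  have "integrable lebesgue (\<lambda>x. norm (f x) powr p * w x) \<longleftrightarrow> weighted_energy p w' f' < \<infinity>"
    using m nn by (subst integrable_iff_bounded) (auto simp: e[symmetric] intro!: arg_cong[where f="\<lambda>u. u < top"] nn_integral_cong_AE elim!: eventually_mono)
  then show "f \<in> Lpw p w \<longleftrightarrow> weighted_energy p w' f' < \<infinity>" using f by (simp add: Lpw_def)
  show "Lpw_norm p w f = enn2real (weighted_energy p w' f') powr (1 / p)"
    unfolding Lpw_norm_def using m nn by (subst integral_eq_nn_integral) (auto simp: e)
qed

theorem mainTheorem3:
  fixes \<gamma> p :: real and w :: "'a::euclidean_space \<Rightarrow> real"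
  assumes "0 < \<gamma>" and "1 \<le> p" and "Ap_weight p w"
  shows "stability_spectrum p w (bessel_potential \<gamma>) = complex_of_real ` {0..1}"
proof -
  note \<gamma> = assms(1) and p = assms(2) and Ap = assms(3)
  have W: "weight w" using Ap by (simp add: Ap_weight_def)
  then have wm: "w \<in> borel_measurable lebesgue" by (simp add: weight_def)
  then obtain w1 where w1 [measurable]: "w1 \<in> borel_measurable lborel" and w1ae: "AE x in lborel. w x = w1 x"
    using completion_ex_borel_measurable_real by blast
  define w' where "w' x = (if 0 < w1 x then w1 x else 1)" for x
  have w' [measurable]: "w' \<in> borel_measurable borel" unfolding w'_def using w1 by measurable
  have pos: "0 < w' x" for x by (simp add: w'_def)
  have wae: "AE x in lborel. w x = w' x"
  proof -
    have "AE x in lborel. 0 < w x" using W by (simp add: weight_def AE_completion_iff)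
    then show ?thesis using w1ae by eventually_elim (simp add: w'_def)
  qed
  then have wael: "AE x in lebesgue. w x = w' x" by (simp add: AE_completion_iff)
  obtain A where A: "0 \<le> A" "Ap_bound p w' A" using Ap_weight_imp_bound[OF Ap p w' pos wael] by blast
  have loc: "(\<integral>\<^sup>+x\<in>centred_cube 2. ennreal (w' x) \<partial>lborel) < \<infinity>"
  proof -
    have "set_integrable lebesgue (centred_cube 2 :: 'a set) w"
      using W by (auto simp: weight_def centred_cube_def)
    then have "(\<integral>\<^sup>+x\<in>centred_cube 2. ennreal (w' x) \<partial>lborel) = ennreal (LINT x:centred_cube 2|lebesgue. w x)"
      by (intro set_nn_integral_lborel_eq wael w' centred_cube_borel less_imp_le[OF pos])
    then show ?thesis by simp
  qed
  interpret borel_Ap_weight p A w' by standard (use p A w' pos loc in auto)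
  let ?E = "weighted_energy p w'"
  note [measurable] = bessel_measurable[OF \<gamma>]
  have S: "Lpw_norm p w (\<lambda>x. z * f x - bessel_potential \<gamma> f x) = enn2real (?E (\<lambda>x. z * f' x - cconv (cbessel \<gamma>) f' x)) powr (1 / p)"
    if f: "f \<in> borel_measurable lebesgue" and f' [measurable]: "f' \<in> borel_measurable borel" and ae: "AE x in lborel. f x = f' x" for z f f'
  proof (rule Lpw_eq_energy(2)[OF _ _ _ wm w' wae pos])
    have J: "bessel_potential \<gamma> f = cconv (cbessel \<gamma>) f'"
      using bessel_potential_eq[OF \<gamma> f f' ae] by (auto simp: cconv_def)
    have "cconv (cbessel \<gamma>) f' \<in> borel_measurable lebesgue" by (intro measurable_completion) simp
    then show "(\<lambda>x. z * f x - bessel_potential \<gamma> f x) \<in> borel_measurable lebesgue"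
      unfolding J using f by measurable
    show "(\<lambda>x. z * f' x - cconv (cbessel \<gamma>) f' x) \<in> borel_measurable borel" by measurable
    show "AE x in lborel. z * f x - bessel_potential \<gamma> f x = z * f' x - cconv (cbessel \<gamma>) f' x"
      unfolding J using ae by eventually_elim simp
  qed
  have "stable_on_Lpw p w (\<lambda>f x. z * f x - bessel_potential \<gamma> f x)" if z: "z \<notin> complex_of_real ` {0..1}" for z
  proof -
    obtain C where C: "C < \<infinity>" and bound: "\<And>f. f \<in> borel_measurable borel \<Longrightarrow> ?E f < \<infinity> \<Longrightarrow>
        ?E f \<le> C * ?E (\<lambda>x. z * f x - cconv (cbessel \<gamma>) f x)"
      using energy_le_resolvent[OF \<gamma> z] by blast
    define c where "c = enn2real C + 1"
    have c: "0 < c" by (simp add: c_def add_nonneg_pos)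
    have Cc: "C \<le> ennreal c" using C by (cases C) (auto simp: c_def)
    obtain B where B: "0 \<le> B" "conv_bounded p w' (enorm (cbessel \<gamma>)) B" using conv_bounded_cbessel[OF \<gamma>] by blast
    have "1 / c powr (1 / p) * Lpw_norm p w f \<le> Lpw_norm p w (\<lambda>x. z * f x - bessel_potential \<gamma> f x)" if f: "f \<in> Lpw p w" for f
    proof -
      have fm: "f \<in> borel_measurable lebesgue" using f by (simp add: Lpw_def)
      obtain f' where f' [measurable]: "f' \<in> borel_measurable borel" and ae: "AE x in lborel. f x = f' x"
        using completion_ex_borel_measurable_complex[OF fm] by auto
      have fin: "?E f' < \<infinity>" using f Lpw_eq_energy(1)[OF fm f' ae wm w' wae pos] by simp
      let ?h = "\<lambda>x. z * f' x - cconv (cbessel \<gamma>) f' x"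
      have "?E (cconv (cbessel \<gamma>) f') < \<infinity>"
        by (rule weighted_energy_cconv_finite[OF _ B(2) f' fin]) measurable
      moreover have "?E (\<lambda>x. z * f' x) < \<infinity>" using fin by (simp add: weighted_energy_cmult ennreal_mult_less_top)
      ultimately have hfin: "?E ?h < \<infinity>"
        by (intro le_less_trans[OF weighted_energy_diff]) (auto simp: ennreal_mult_less_top)
      have "?E f' \<le> C * ?E ?h" using f' fin by (rule bound)
      also have "\<dots> \<le> ennreal c * ?E ?h" using Cc by (rule mult_right_mono) simp
      finally have "enn2real (?E f') \<le> enn2real (ennreal c * ?E ?h)"
        using hfin by (intro enn2real_mono) (auto simp: ennreal_mult_less_top)
      also have "\<dots> = c * enn2real (?E ?h)" using c by (simp add: enn2real_mult)
      finally have "enn2real (?E f') powr (1 / p) \<le> (c * enn2real (?E ?h)) powr (1 / p)"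
        using p by (intro powr_mono2) auto
      then have "enn2real (?E f') powr (1 / p) \<le> c powr (1 / p) * enn2real (?E ?h) powr (1 / p)"
        using c by (simp add: powr_mult)
      then show ?thesis
        using c unfolding S[OF fm f' ae] Lpw_eq_energy(2)[OF fm f' ae wm w' wae pos]
        by (simp add: field_simps)
    qed
    then show ?thesis unfolding stable_on_Lpw_def using c by (intro exI[of _ "1 / c powr (1 / p)"]) auto
  qed
  moreover have "\<not> stable_on_Lpw p w (\<lambda>f x. of_real z * f x - bessel_potential \<gamma> f x)" if z: "0 \<le> z" "z \<le> 1" for z
  proof
    assume "stable_on_Lpw p w (\<lambda>f x. of_real z * f x - bessel_potential \<gamma> f x)"
    then obtain C where C: "0 < C" and st: "\<And>f. f \<in> Lpw p w \<Longrightarrow> C * Lpw_norm p w f \<le> Lpw_norm p w (\<lambda>x. of_real z * f x - bessel_potential \<gamma> f x)"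
      unfolding stable_on_Lpw_def by blast
    obtain \<delta> f where \<delta>: "0 < \<delta>" and f [measurable]: "f \<in> borel_measurable borel"
      and nf: "\<And>x::'a. norm (f x) = exp (- (\<delta> * norm x))"
      and small: "\<And>x. norm (of_real z * f x - cconv (cbessel \<gamma>) f x) \<le> C / 2 * norm (f x)"
      using approximate_eigenfunction[OF \<gamma> z, of "C / 2", where 'a='a] C by auto
    have fm: "f \<in> borel_measurable lebesgue" by (intro measurable_completion) simp
    have fin: "?E f < \<infinity>" by (rule energy_exp_decay_finite[OF \<delta> nf])
    have fL: "f \<in> Lpw p w" using fin Lpw_eq_energy(1)[OF fm f _ wm w' wae pos] by simp
    have "f x \<noteq> 0" for x using nf[of x] by auto
    then have "0 < ?E f" by (intro energy_pos f)
    then have E: "0 < enn2real (?E f)" using fin by (simp add: enn2real_positive_iff)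
    have nm: "Lpw_norm p w f = enn2real (?E f) powr (1 / p)" by (rule Lpw_eq_energy(2)[OF fm f _ wm w' wae pos]) simp
    let ?h = "\<lambda>x. of_real z * f x - cconv (cbessel \<gamma>) f x"
    have "?E ?h \<le> ennreal ((C / 2) powr p) * ?E f"
      using C p by (intro weighted_energy_le_of_norm_le f w' small) auto
    then have "enn2real (?E ?h) \<le> enn2real (ennreal ((C / 2) powr p) * ?E f)"
      using fin by (intro enn2real_mono) (auto simp: ennreal_mult_less_top)
    also have "\<dots> = (C / 2) powr p * enn2real (?E f)" by (simp add: enn2real_mult)
    finally have "enn2real (?E ?h) powr (1 / p) \<le> ((C / 2) powr p * enn2real (?E f)) powr (1 / p)"
      using p by (intro powr_mono2) auto
    also have "\<dots> = C / 2 * enn2real (?E f) powr (1 / p)"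
      using C p by (simp add: powr_mult powr_powr)
    finally have "Lpw_norm p w (\<lambda>x. of_real z * f x - bessel_potential \<gamma> f x) \<le> C / 2 * Lpw_norm p w f"
      unfolding nm by (subst S[OF fm f]) auto
    with st[OF fL] have "C * Lpw_norm p w f \<le> C / 2 * Lpw_norm p w f" by linarith
    moreover have "0 < Lpw_norm p w f" using E by (simp add: nm)
    ultimately show False using C by simp
  qed
  ultimately show ?thesis unfolding stability_spectrum_def by fastforce
qed

end
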